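(* Let $a_n^0>0$ and $b_n^0\in\mathbb{R}$, $n=1,2,\ldots$, be given sequences, let $A^0$ be the corresponding semi-infinite Jacobi matrix, and let $d\rho^0_{\infty,\alpha}$ be the spectral measure of its self-adjoint realization $A^0_{\infty,\alpha}$ described in the context. For $N\in\mathbb{N}$ let $A^0_N$ be the upper-left $N\times N$ block of $A^0$, let $d\rho^0_N$ be its spectral measure, let $H_N(t)$, $t\geqslant0$, be the Jacobi matrix evolving by the $N$-particle finite Toda lattice with $H_N(0)=A^0_N$, let $s_{N,k}(t)$ be the moments of the spectral measure of $H_N(t)$, and let $\Omega_N(t)=\int_{\mathbb{R}}e^{2\lambda t}\,d\rho^0_N(\lambda)$. If $$\operatorname{supp}\{d\rho^0_{\infty,\alpha}\}\subset(-\infty,M)\quad\text{for some } M\in\mathbb{R},$$ then for $t\geqslant0$ there exist the limits $$s_k(t):=\lim_{N\to\infty}s_{N,k}(t)=\frac{\int_{\mathbb{R}}\lambda^ke^{2\lambda t}\,d\rho^0_{\infty,\alpha}(\lambda)}{\int_{\mathbb{R}}e^{2\lambda t}\,d\rho^0_{\infty,\alpha}(\lambda)},\quad k=0,1,\ldots,$$ $$\Omega_\alpha(t):=\lim_{N\to\infty}\Omega_N(t)=\int_{\mathbb{R}}e^{2\lambda t}\,d\rho^0_{\infty,\alpha}(\lambda).$$ Moreover, the functions $s_k(t)$ satisfy the recurrent relation $$\dot s_k(t)+\left(\ln\Omega_\alpha(t)\right)'s_k(t)=2s_{k+1}(t),\quad k=0,1,\ldots,\ t>0,$$ where $s_0(t)=1$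 for $t\geqslant0$.
   Context: A dot or prime denotes $d/dt$. Finite objects. $H_N(t)$ is the real symmetric tridiagonal $N\times N$ matrix with diagonal entries $b_{N,1}(t),\ldots,b_{N,N}(t)$ and off-diagonal entries $a_{N,1}(t),\ldots,a_{N,N-1}(t)$, where these functions solve the finite Toda lattice $$\dot a_{N,n}=a_{N,n}(b_{N,n+1}-b_{N,n})\ (1\le n\le N-1),\qquad \dot b_{N,n}=2(a_{N,n}^2-a_{N,n-1}^2)\ (1\le n\le N),\quad t\geqslant0,$$ with $a_{N,0}=a_{N,N}=0$ and initial data $a_{N,n}(0)=a_n^0$, $b_{N,n}(0)=b_n^0$. The spectral measure of an $N\times N$ Jacobi matrix with eigenvalues $\lambda_1,\ldots,\lambda_N$ and eigenvectors $\phi_k\in\mathbb{R}^N$ normalized by having first component equal to $1$ is $\sum_{k=1}^N\sigma_k^2\,\delta(\lambda-\lambda_k)$ with $\sigma_k^2=1/(\phi_k,\phi_k)$. If $d\rho^t_N$ is the spectral measure of $H_N(t)$, then $s_{N,k}(t)=\int_{\mathbb{R}}\lambda^k\,d\rho_N^t(\lambda)$. Semi-infinite objects. $A^0$ is the symmetric tridiagonal semi-infinite matrix with diagonal entries $b_n^0$ and off-diagonal entries $a_n^0$ ($A^0_{nn}=b_n^0$, $A^0_{n,n+1}=A^0_{n+1,n}=a_n^0$), regarded also as a symmetric operator in $l_2$ with domain the finitely supported sequences; $\overline{A^0}$ is its closure and $(A^0)^*$ its adjoint. If its deficiency indices are $(0,0)$ (limit point case), $A^0_{\infty,\alpha}$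 means the unique self-adjoint extension $\overline{A^0}$. If its deficiency indices are $(1,1)$ (limit circle case), let $p(\lambda)=(p_n(\lambda))_{n\ge1}$, $q(\lambda)=(q_n(\lambda))_{n\ge1}$ be the solutions of $a^0_n\phi_{n+1}+a^0_{n-1}\phi_{n-1}+b^0_n\phi_n=\lambda\phi_n$, $n\ge2$, with $p_1=1$, $p_2=(\lambda-b^0_1)/a^0_1$, $q_1=0$, $q_2=1/a^0_1$, and set $\alpha=-\lim_{n\to\infty}q_n(0)/p_n(0)\in\mathbb{R}\cup\{\infty\}$. Then $A^0_{\infty,\alpha}$ is the self-adjoint restriction of $(A^0)^*$ to $D(\overline{A^0})\dot+\operatorname{span}\{q(0)+\alpha p(0)\}$ if $\alpha\in\mathbb{R}$, and to $D(\overline{A^0})\dot+\operatorname{span}\{p(0)\}$ if $\alpha=\infty$. With $E$ the projection-valued spectral measure of $A^0_{\infty,\alpha}$, $[\cdot,\cdot]$ the scalar product in $l_2$ and $e_1=(1,0,0,\ldots)$, one sets $d\rho^0_{\infty,\alpha}(\lambda)=d[E_\lambda e_1,e_1]$. It is known that $d\rho^0_N\to d\rho^0_{\infty,\alpha}$ $*$-weakly as $N\to\infty$. *)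

theory Defs
  imports
    "HOL-Probability.Probability"
    "Jordan_Normal_Form.Char_Poly"
begin

section \<open>Jacobi matrices\<close>

text \<open>
  The sequences \<open>a\<close>, \<open>b\<close> are indexed by \<open>1, 2, \<dots>\<close> as on paper; the values \<open>a 0\<close>, \<open>b 0\<close> are
  never used by the entries with indices \<open>\<ge> 1\<close>.
\<close>

definition jacobi_entry :: "(nat \<Rightarrow> real) \<Rightarrow> (nat \<Rightarrow> real) \<Rightarrow> nat \<Rightarrow> nat \<Rightarrow> real" where
  "jacobi_entry a b m n =
     (if m = n then b n
      else if n = m + 1 then a m
      else if m = n + 1 then a n
      else 0)"

text \<open>Matrices of \<open>Jordan_Normal_Form\<close> are indexed from \<open>0\<close>, hence the shift.\<close>

definition jacobi_block :: "nat \<Rightarrow> (nat \<Rightarrow> real) \<Rightarrow> (nat \<Rightarrow> real) \<Rightarrow> real Matrix.mat" where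
  "jacobi_block N a b = Matrix.mat N N (\<lambda>(i, j). jacobi_entry a b (i + 1) (j + 1))"

text \<open>
  A Jacobi matrix with positive off-diagonal entries has only simple eigenvalues, and no
  eigenvector of it has vanishing first component; so the description below is unique, and the
  sum of point masses ranges over the set of eigenvalues.
\<close>

definition normalized_eigenvector :: "real Matrix.mat \<Rightarrow> real \<Rightarrow> real Matrix.vec" where
  "normalized_eigenvector J l = (THE v. eigenvector J v l \<and> vec_index v 0 = 1)"

definition block_spectral_measure :: "real Matrix.mat \<Rightarrow> real measure" where
  "block_spectral_measure J =
     distr
       (point_measure {l. eigenvalue J l}
          (\<lambda>l. ennreal (1 / scalar_prod (normalized_eigenvector J l) (normalized_eigenvector J l))))
       borel (\<lambda>l. l)"


section \<open>The finite Toda lattice\<close>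

definition finite_toda ::
  "nat \<Rightarrow> (nat \<Rightarrow> real) \<Rightarrow> (nat \<Rightarrow> real) \<Rightarrow> (nat \<Rightarrow> real \<Rightarrow> real) \<Rightarrow> (nat \<Rightarrow> real \<Rightarrow> real) \<Rightarrow> bool" where
  "finite_toda N a0 b0 a b \<longleftrightarrow>
     (\<forall>t\<ge>0. a 0 t = 0 \<and> a N t = 0) \<and>
     (\<forall>t\<ge>0. \<forall>n\<in>{1..<N}.
        (a n has_real_derivative a n t * (b (n + 1) t - b n t)) (at t within {0..})) \<and>
     (\<forall>t\<ge>0. \<forall>n\<in>{1..N}.
        (b n has_real_derivative 2 * ((a n t)\<^sup>2 - (a (n - 1) t)\<^sup>2)) (at t within {0..})) \<and>
     (\<forall>n\<in>{1..<N}. a n 0 = a0 n) \<and>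
     (\<forall>n\<in>{1..N}. b n 0 = b0 n)"


section \<open>The Hilbert space of square-summable sequences\<close>

text \<open>
  A sequence \<open>(f\<^sub>1, f\<^sub>2, \<dots>)\<close> is encoded as a function on \<open>nat\<close> which vanishes at \<open>0\<close>.
\<close>

definition l2 :: "(nat \<Rightarrow> complex) set" where
  "l2 = {f. f 0 = 0 \<and> summable (\<lambda>n. (cmod (f n))\<^sup>2)}"

definition l2_inner :: "(nat \<Rightarrow> complex) \<Rightarrow> (nat \<Rightarrow> complex) \<Rightarrow> complex" where
  "l2_inner f g = (\<Sum>n. f n * cnj (g n))"

definition l2_norm :: "(nat \<Rightarrow> complex) \<Rightarrow> real" where
  "l2_norm f = sqrt (\<Sum>n. (cmod (f n))\<^sup>2)"

definition l2_tendsto :: "(nat \<Rightarrow> nat \<Rightarrow> complex) \<Rightarrow> (nat \<Rightarrow> complex) \<Rightarrow> bool" where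
  "l2_tendsto F f \<longleftrightarrow> (\<lambda>k. l2_norm (\<lambda>n. F k n - f n)) \<longlonglongrightarrow> 0"

definition finite_sequences :: "(nat \<Rightarrow> complex) set" where
  "finite_sequences = {f. f 0 = 0 \<and> finite {n. f n \<noteq> 0}}"

definition unit_e1 :: "nat \<Rightarrow> complex" where
  "unit_e1 = (\<lambda>n. if n = 1 then 1 else 0)"


section \<open>Unbounded operators\<close>

text \<open>
  Operators in \<open>l2\<close> are represented by their graphs; \<^const>\<open>Domain\<close> gives the domain.
\<close>

type_synonym l2_operator = "((nat \<Rightarrow> complex) \<times> (nat \<Rightarrow> complex)) set"

definition op_closure :: "l2_operator \<Rightarrow> l2_operator" where
  "op_closure T = {(f, g). f \<in> l2 \<and> g \<in> l2 \<and>
     (\<exists>F G. (\<forall>k. (F k, G k) \<in> T) \<and> l2_tendsto F f \<and> l2_tendsto G g)}"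

definition op_adjoint :: "l2_operator \<Rightarrow> l2_operator" where
  "op_adjoint T = {(g, h). g \<in> l2 \<and> h \<in> l2 \<and> (\<forall>(f, k)\<in>T. l2_inner k g = l2_inner f h)}"

definition op_restrict :: "l2_operator \<Rightarrow> (nat \<Rightarrow> complex) set \<Rightarrow> l2_operator" where
  "op_restrict T D = {(f, g) \<in> T. f \<in> D}"

text \<open>\<open>V\<close> has a basis consisting of \<open>d\<close> vectors.\<close>

definition has_dimension :: "(nat \<Rightarrow> complex) set \<Rightarrow> nat \<Rightarrow> bool" where
  "has_dimension V d \<longleftrightarrow>
     (\<exists>v :: nat \<Rightarrow> nat \<Rightarrow> complex.
        V = {(\<lambda>n. \<Sum>i<d. c i * v i n) | c. True} \<and>
        (\<forall>c. (\<forall>n. (\<Sum>i<d. c i * v i n) = 0) \<longrightarrow> (\<forall>i<d. c i = 0)))"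

definition eigenspace :: "l2_operator \<Rightarrow> complex \<Rightarrow> (nat \<Rightarrow> complex) set" where
  "eigenspace T z = {f. (f, \<lambda>n. z * f n) \<in> T}"

definition deficiency_indices :: "l2_operator \<Rightarrow> nat \<Rightarrow> nat \<Rightarrow> bool" where
  "deficiency_indices T m n \<longleftrightarrow>
     has_dimension (eigenspace (op_adjoint T) \<i>) m \<and>
     has_dimension (eigenspace (op_adjoint T) (- \<i>)) n"


section \<open>Spectral measures\<close>

text \<open>
  A projection-valued measure on the real line acting in \<open>l2\<close>; its values are only relevant on
  Borel sets and on elements of \<open>l2\<close>.
\<close>

definition projection_valued_measure ::
  "(real set \<Rightarrow> (nat \<Rightarrow> complex) \<Rightarrow> (nat \<Rightarrow> complex)) \<Rightarrow> bool" where
  "projection_valued_measure E \<longleftrightarrow>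
     (\<forall>B\<in>sets borel. \<forall>f\<in>l2. E B f \<in> l2 \<and> E B (E B f) = E B f) \<and>
     (\<forall>B\<in>sets borel. \<forall>f\<in>l2. \<forall>g\<in>l2. \<forall>c.
        E B (\<lambda>n. f n + c * g n) = (\<lambda>n. E B f n + c * E B g n)) \<and>
     (\<forall>B\<in>sets borel. \<forall>f\<in>l2. \<forall>g\<in>l2. l2_inner (E B f) g = l2_inner f (E B g)) \<and>
     (\<forall>f\<in>l2. E UNIV f = f) \<and>
     (\<forall>A\<in>sets borel. \<forall>B\<in>sets borel. \<forall>f\<in>l2. E (A \<inter> B) f = E A (E B f)) \<and>
     (\<forall>S. range S \<subseteq> sets borel \<longrightarrow> disjoint_family S \<longrightarrow>
        (\<forall>f\<in>l2. l2_tendsto (\<lambda>k n. \<Sum>i<k. E (S i) f n) (E (\<Union>i. S i) f)))"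

text \<open>The measure \<open>d[E\<^sub>\<lambda> f, f]\<close>.\<close>

definition scalar_spectral_measure ::
  "(real set \<Rightarrow> (nat \<Rightarrow> complex) \<Rightarrow> (nat \<Rightarrow> complex)) \<Rightarrow> (nat \<Rightarrow> complex) \<Rightarrow> real measure" where
  "scalar_spectral_measure E f =
     measure_of UNIV (sets borel) (\<lambda>B. ennreal (Re (l2_inner (E B f) f)))"

text \<open>
  \<open>T = \<integral> \<lambda> dE\<^sub>\<lambda>\<close>: the domain is the set of all \<open>f\<close> with \<open>\<integral> \<lambda>\<^sup>2 d[E\<^sub>\<lambda> f, f] < \<infinity>\<close>, and
  \<open>[T f, f] = \<integral> \<lambda> d[E\<^sub>\<lambda> f, f]\<close> there, which determines \<open>T\<close> by polarization.
\<close>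

definition spectral_resolution ::
  "(real set \<Rightarrow> (nat \<Rightarrow> complex) \<Rightarrow> (nat \<Rightarrow> complex)) \<Rightarrow> l2_operator \<Rightarrow> bool" where
  "spectral_resolution E T \<longleftrightarrow>
     projection_valued_measure E \<and>
     Domain T = {f \<in> l2. integrable (scalar_spectral_measure E f) (\<lambda>x. x\<^sup>2)} \<and>
     (\<forall>(f, g)\<in>T. l2_inner g f = complex_of_real (LINT x|scalar_spectral_measure E f. x))"

definition measure_support :: "real measure \<Rightarrow> real set" where
  "measure_support \<mu> = {x. \<forall>U. open U \<and> x \<in> U \<longrightarrow> emeasure \<mu> U > 0}"


section \<open>The semi-infinite Jacobi operator and its self-adjoint realization\<close>

definition jacobi_op :: "(nat \<Rightarrow> real) \<Rightarrow> (nat \<Rightarrow> real) \<Rightarrow> l2_operator" where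
  "jacobi_op a b =
     {(f, \<lambda>m. if m = 0 then 0
              else \<Sum>n | f n \<noteq> 0. complex_of_real (jacobi_entry a b m n) * f n) | f.
      f \<in> finite_sequences}"

definition limit_point :: "(nat \<Rightarrow> real) \<Rightarrow> (nat \<Rightarrow> real) \<Rightarrow> bool" where
  "limit_point a b \<longleftrightarrow> deficiency_indices (jacobi_op a b) 0 0"

definition limit_circle :: "(nat \<Rightarrow> real) \<Rightarrow> (nat \<Rightarrow> real) \<Rightarrow> bool" where
  "limit_circle a b \<longleftrightarrow> deficiency_indices (jacobi_op a b) 1 1"

text \<open>
  The solutions \<open>p(\<lambda>)\<close> and \<open>q(\<lambda>)\<close>; the last equation of each is the three-term recurrence with
  \<open>n + 2\<close> in place of \<open>n\<close>, solved for the term of highest index.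
\<close>

fun jacobi_p :: "(nat \<Rightarrow> real) \<Rightarrow> (nat \<Rightarrow> real) \<Rightarrow> real \<Rightarrow> nat \<Rightarrow> real" where
  "jacobi_p a b l 0 = 0"
| "jacobi_p a b l (Suc 0) = 1"
| "jacobi_p a b l (Suc (Suc 0)) = (l - b 1) / a 1"
| "jacobi_p a b l (Suc (Suc (Suc n))) =
     ((l - b (n + 2)) * jacobi_p a b l (Suc (Suc n)) - a (n + 1) * jacobi_p a b l (Suc n)) / a (n + 2)"

fun jacobi_q :: "(nat \<Rightarrow> real) \<Rightarrow> (nat \<Rightarrow> real) \<Rightarrow> real \<Rightarrow> nat \<Rightarrow> real" where
  "jacobi_q a b l 0 = 0"
| "jacobi_q a b l (Suc 0) = 0"
| "jacobi_q a b l (Suc (Suc 0)) = 1 / a 1"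
| "jacobi_q a b l (Suc (Suc (Suc n))) =
     ((l - b (n + 2)) * jacobi_q a b l (Suc (Suc n)) - a (n + 1) * jacobi_q a b l (Suc n)) / a (n + 2)"

text \<open>
  \<open>\<real> \<union> {\<infinity>}\<close> is the one-point compactification of the real line, with \<^const>\<open>None\<close> as \<open>\<infinity>\<close>.
  The quotient is \<open>\<infinity>\<close> where \<open>p\<^sub>n(0)\<close> vanishes (\<open>p\<^sub>n(0)\<close> and \<open>q\<^sub>n(0)\<close> have no common zero, \<open>n \<ge> 1\<close>).
\<close>

definition is_boundary_parameter :: "(nat \<Rightarrow> real) \<Rightarrow> (nat \<Rightarrow> real) \<Rightarrow> real option \<Rightarrow> bool" where
  "is_boundary_parameter a b \<alpha> \<longleftrightarrow>
     limitin (Alexandroff_compactification euclideanreal)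
       (\<lambda>n. if jacobi_p a b 0 n = 0 then None else Some (- (jacobi_q a b 0 n / jacobi_p a b 0 n)))
       \<alpha> sequentially"

definition boundary_vector :: "(nat \<Rightarrow> real) \<Rightarrow> (nat \<Rightarrow> real) \<Rightarrow> real option \<Rightarrow> nat \<Rightarrow> complex" where
  "boundary_vector a b \<alpha> =
     (case \<alpha> of
        Some r \<Rightarrow> (\<lambda>n. complex_of_real (jacobi_q a b 0 n + r * jacobi_p a b 0 n))
      | None \<Rightarrow> (\<lambda>n. complex_of_real (jacobi_p a b 0 n)))"

text \<open>In the limit point case the result does not depend on \<open>\<alpha>\<close>.\<close>

definition jacobi_realization :: "(nat \<Rightarrow> real) \<Rightarrow> (nat \<Rightarrow> real) \<Rightarrow> real option \<Rightarrow> l2_operator" where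
  "jacobi_realization a b \<alpha> =
     (if limit_point a b then op_closure (jacobi_op a b)
      else op_restrict (op_adjoint (jacobi_op a b))
             {(\<lambda>n. f n + c * boundary_vector a b \<alpha> n) | f c. f \<in> Domain (op_closure (jacobi_op a b))})"

end

theory Submission
  imports Defs "HOL-Real_Asymp.Real_Asymp"
begin

text \<open>
  The moments of the spectral measure of \<open>H\<^sub>N(t)\<close>, multiplied by \<open>exp (2 \<integral>\<^sub>0\<^sup>t b\<^sub>1)\<close>, satisfy the linear
  system \<open>S\<^sub>k' = 2 S\<^sub>k\<^sub>+\<^sub>1\<close>, which among functions of at most geometric growth in \<open>k\<close> has only one
  solution with given initial values. The moments of \<open>e\<^sup>2\<^sup>\<lambda>\<^sup>t d\<rho>\<^sub>N\<^sup>0\<close> are such a solution; hence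
  \<open>s\<^sub>N\<^sub>,\<^sub>k(t)\<close> is the quotient of exponential moments of the initial measure, and it remains to pass to
  the limit in these.

  Every pair in the graph of the self-adjoint realization is a limit of pairs \<open>(\<phi>\<^sub>N, A\<^sub>N \<phi>\<^sub>N)\<close>; for the
  boundary vector \<open>q(0) + \<alpha> p(0)\<close> this uses \<open>q(0) - (q\<^sub>N\<^sub>+\<^sub>1 / p\<^sub>N\<^sub>+\<^sub>1) p(0)\<close>, which vanishes at
  \<open>N + 1\<close> and converges by the choice of \<open>\<alpha>\<close>. So the resolvents converge strongly. Since \<open>E\<close>
  vanishes on \<open>[M, \<infinity>)\<close> at \<open>e\<^sub>1\<close>, hence at all finite sequences, the quadratic form is bounded by \<open>M\<close>
  and all eigenvalues of \<open>A\<^sub>N\<close> lie in \<open>(-\<infinity>, M]\<close>. The integrals of \<open>(M + 1 - \<lambda>)\<^sup>-\<^sup>j\<close> therefore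
  converge, and for \<open>t > 0\<close> the Weierstrass theorem in the variable \<open>1 / (M + 1 - \<lambda>)\<close> gives the
  convergence of the integrals of \<open>\<lambda>\<^sup>k e\<^sup>2\<^sup>\<lambda>\<^sup>t\<close>. For \<open>t = 0\<close> the moments are eventually constant.
\<close>

section \<open>Operators with a spectral resolution\<close>

text \<open>\<open>spectral_resolution\<close> supplies projections, a domain and a quadratic form,
  but no functional calculus: commutation of \<open>T\<close> with the projections and the formula
  for the norm of \<open>T f\<close> must first be extracted from the form. The key is that a
  symmetric operator whose form is within \<open>d\<close> of \<open>s\<close> on a spectral
  subspace is within \<open>d\<close> of \<open>s\<close> in norm there. Cutting the line into short
  pieces then yields step-function substitutes for the powers of the resolvent.

  On the Toda side the Lax equation gives \<open>s\<^sub>k' = 2 s\<^sub>k\<^sub>+\<^sub>1 - 2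
  b\<^sub>1 s\<^sub>k\<close>, which is nonlinear only through \<open>b\<^sub>1\<close>; this is the
  reason for the factor \<open>exp (2 \<integral> b\<^sub>1)\<close>. For fixed \<open>N\<close> the
  entries are bounded on compact time intervals, whence the geometric growth that uniqueness
  requires.

  In the limit, the integrand grows at plus infinity, where convergence against bounded continuous
  functions gives no control; the common bound on the eigenvalues closes this gap. At minus infinity
  it decays only for \<open>t > 0\<close>, hence the separate treatment of
  \<open>t = 0\<close>.\<close>

definition vector_measure_of :: "(real set \<Rightarrow> 'v::real_inner \<Rightarrow> 'v) \<Rightarrow> 'v \<Rightarrow> real measure" where
  "vector_measure_of P f = measure_of UNIV (sets borel) (\<lambda>B. ennreal (inner (P B f) f))"

text \<open>The scalars are real because complex sequences enter through the real part of their
  scalar product. Density of the domain is phrased as triviality of its orthogonal complement, the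
  form in which it is applied.\<close>

locale spectral_operator =
  fixes T :: "('v::real_inner \<times> 'v) set" and P :: "real set \<Rightarrow> 'v \<Rightarrow> 'v"
  assumes T_subspace: "subspace T"
    and T_sym: "(f, h) \<in> T \<Longrightarrow> (f', h') \<in> T \<Longrightarrow> inner h f' = inner f h'"
    and T_dense: "(\<And>f h. (f, h) \<in> T \<Longrightarrow> inner f g = 0) \<Longrightarrow> g = 0"
    and P_linear: "B \<in> sets borel \<Longrightarrow> linear (P B)"
    and P_sym: "B \<in> sets borel \<Longrightarrow> inner (P B f) g = inner f (P B g)"
    and P_Int: "A \<in> sets borel \<Longrightarrow> B \<in> sets borel \<Longrightarrow> P (A \<inter> B) f = P A (P B f)"
    and P_UNIV: "P UNIV f = f"
    and P_sums: "range S \<subseteq> sets borel \<Longrightarrow> disjoint_family S \<Longrightarrow>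
      (\<lambda>i. P (S i) f) sums P (\<Union>i. S i) f"
    and T_Domain: "Domain T = {f. integrable (vector_measure_of P f) (\<lambda>x. x\<^sup>2)}"
    and T_quad: "(f, h) \<in> T \<Longrightarrow> inner h f = (LINT x|vector_measure_of P f. x)"
begin

abbreviation mu where "mu \<equiv> vector_measure_of P"

lemma T_add: "(f, h) \<in> T \<Longrightarrow> (f', h') \<in> T \<Longrightarrow> (f + f', h + h') \<in> T"
  using subspace_add[OF T_subspace, of "(f, h)" "(f', h')"] by simp

lemma T_scale: "(f, h) \<in> T \<Longrightarrow> (c *\<^sub>R f, c *\<^sub>R h) \<in> T"
  using subspace_scale[OF T_subspace, of "(f, h)" c] by simp

lemma T_diff: "(f, h) \<in> T \<Longrightarrow> (f', h') \<in> T \<Longrightarrow> (f - f', h - h') \<in> T"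
  using subspace_diff[OF T_subspace, of "(f, h)" "(f', h')"] by simp

text \<open>A symmetric graph with dense domain is single-valued, since such an \<open>h\<close> is
  orthogonal to the domain.\<close>

lemma T_zero: "(0, h) \<in> T \<Longrightarrow> h = 0"
  using T_dense[of h] T_sym[of 0 h] by (metis inner_commute inner_zero_left)

text \<open>Additivity over countably many copies of the empty set gives a convergent series with
  constant terms.\<close>

lemma P_empty [simp]: "P {} f = 0"
proof -
  have "(\<lambda>i::nat. P {} f) sums P (\<Union>i::nat. {}) f"
    by (rule P_sums) (auto simp: disjoint_family_on_def)
  then have "(\<lambda>i::nat. P {} f) \<longlonglongrightarrow> 0"
    by (intro summable_LIMSEQ_zero) (auto simp: sums_iff)
  then show ?thesis by (simp add: LIMSEQ_const_iff)
qed

lemma P_inner_self: "B \<in> sets borel \<Longrightarrow> inner (P B f) f = (norm (P B f))\<^sup>2"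
  by (metis Int_absorb P_Int P_sym dot_square_norm)

lemma P_Un:
  assumes "A \<in> sets borel" "B \<in> sets borel" "A \<inter> B = {}"
  shows "P (A \<union> B) f = P A f + P B f"
proof -
  let ?S = "binaryset A B"
  have 1: "(\<lambda>i. P (?S i) f) sums P (\<Union>i. ?S i) f"
    using assms by (intro P_sums)
      (auto simp: binaryset_def disjoint_family_on_def split: if_splits)
  have "(\<lambda>i. P (?S i) f) sums (\<Sum>i<2. P (?S i) f)"
    by (rule sums_finite) (auto simp: binaryset_def)
  then have "(\<lambda>i. P (?S i) f) sums (P A f + P B f)"
    by (simp add: numeral_2_eq_2 binaryset_def)
  with 1 show ?thesis
    by (metis UN_binaryset_eq sums_unique2)
qed

lemma P_Compl: "B \<in> sets borel \<Longrightarrow> P (- B) f = f - P B f"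
  using P_Un[of B "- B" f] by (simp add: P_UNIV Compl_eq_Diff_UNIV sup_compl_top algebra_simps)

lemma P_orth:
  assumes "A \<in> sets borel" "B \<in> sets borel" "A \<inter> B = {}"
  shows "inner (P A f) (P B g) = 0"
  using assms by (metis P_Int P_empty P_sym inner_zero_right)

lemma space_mu [simp]: "space (mu f) = UNIV"
  and sets_mu [simp, measurable_cong]: "sets (mu f) = sets borel"
  by (simp_all add: vector_measure_of_def sets_measure_of_conv space_measure_of_conv
      sets.sigma_sets_eq[of borel, simplified])

lemma measurable_mu [simp]: "borel_measurable (mu f) = borel_measurable borel"
  by (rule measurable_cong_sets) simp_all

lemma emeasure_mu: "B \<in> sets borel \<Longrightarrow> emeasure (mu f) B = ennreal ((norm (P B f))\<^sup>2)"
proof -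
  assume B: "B \<in> sets borel"
  have "emeasure (mu f) B = ennreal (inner (P B f) f)"
  proof (rule emeasure_measure_of[OF vector_measure_of_def])
    show "positive (sets (mu f)) (\<lambda>B. ennreal (inner (P B f) f))"
      by (simp add: positive_def)
    show "countably_additive (sets (mu f)) (\<lambda>B. ennreal (inner (P B f) f))"
    proof (rule countably_additiveI)
      fix S :: "nat \<Rightarrow> real set"
      assume S: "range S \<subseteq> sets (mu f)" "disjoint_family S"
      then have "(\<lambda>i. inner (P (S i) f) f) sums inner (P (\<Union>i. S i) f) f"
        by (intro bounded_linear.sums[OF bounded_linear_inner_left P_sums]) auto
      then have "(\<lambda>i. ennreal (inner (P (S i) f) f)) sums ennreal (inner (P (\<Union>i. S i) f) f)"
        using S by (subst sums_ennreal) (auto simp: P_inner_self)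
      then show "(\<Sum>i. ennreal (inner (P (S i) f) f)) = ennreal (inner (P (\<Union>i. S i) f) f)"
        by (simp add: sums_iff)
    qed
  qed (use B in auto)
  with B show ?thesis by (simp add: P_inner_self)
qed

lemma measure_mu: "B \<in> sets borel \<Longrightarrow> measure (mu f) B = (norm (P B f))\<^sup>2"
  by (simp add: measure_def emeasure_mu)

lemma finite_measure_mu: "finite_measure (mu f)"
  by (rule finite_measureI) (simp add: emeasure_mu)

lemma measure_mu_UNIV: "measure (mu f) UNIV = (norm f)\<^sup>2"
  by (simp add: measure_mu P_UNIV)

lemma mu_P: "B \<in> sets borel \<Longrightarrow> mu (P B f) = density (mu f) (\<lambda>x. ennreal (indicator B x))"
proof (rule measure_eqI)
  fix A assume B: "B \<in> sets borel" and "A \<in> sets (mu (P B f))"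
  then have A: "A \<in> sets borel" by simp
  have "emeasure (density (mu f) (indicator B)) A = emeasure (mu f) (B \<inter> A)"
    using A B by (subst emeasure_density) (auto simp: indicator_inter_arith[symmetric])
  then show "emeasure (mu (P B f)) A = emeasure (density (mu f) (\<lambda>x. ennreal (indicator B x))) A"
    using A B by (simp add: emeasure_mu P_Int[symmetric] Int_commute ennreal_indicator)
qed simp

lemma integral_mu_P:
  fixes g :: "real \<Rightarrow> real"
  assumes "B \<in> sets borel" "g \<in> borel_measurable borel"
  shows "(LINT x|mu (P B f). g x) = (LINT x|mu f. indicator B x * g x)"
  using assms by (subst mu_P, simp, subst integral_density) auto

lemma integrable_mu_P:
  fixes g :: "real \<Rightarrow> real"
  assumes "B \<in> sets borel" "g \<in> borel_measurable borel"
  shows "integrable (mu (P B f)) g \<longleftrightarrow> integrable (mu f) (\<lambda>x. indicator B x * g x)"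
  using assms by (subst mu_P, simp, subst integrable_density) auto

lemma integrable_bounded:
  fixes g :: "real \<Rightarrow> real"
  assumes "g \<in> borel_measurable borel" "\<And>x. \<bar>g x\<bar> \<le> K"
  shows "integrable (mu f) g"
  using assms by (intro finite_measure.integrable_const_bound[OF finite_measure_mu, of _ K]) auto

lemma integrable_indicator_mult:
  fixes g :: "real \<Rightarrow> real"
  assumes "B \<in> sets borel" "integrable (mu f) g"
  shows "integrable (mu f) (\<lambda>x. indicator B x * g x)"
  using integrable_real_mult_indicator[of B "mu f" g] assms by (simp add: mult.commute)

section \<open>Commutation of the operator with its spectral projections\<close>

lemma Domain_P:
  assumes B: "B \<in> sets borel" and f: "f \<in> Domain T"
  shows "P B f \<in> Domain T"
proof -
  have "integrable (mu f) (\<lambda>x. x\<^sup>2)" using f by (simp add: T_Domain)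
  then have "integrable (mu f) (\<lambda>x. indicator B x * x\<^sup>2)"
    using B by (intro integrable_indicator_mult) auto
  then show ?thesis using B by (simp add: T_Domain integrable_mu_P)
qed

lemma Domain_P_bounded:
  assumes B: "B \<in> sets borel" "B \<subseteq> {-L..L}"
  shows "P B f \<in> Domain T"
proof -
  have "integrable (mu f) (\<lambda>x. indicator B x * x\<^sup>2)"
  proof (rule integrable_bounded)
    show "\<bar>indicator B x * x\<^sup>2\<bar> \<le> L\<^sup>2" for x
      using B by (force simp: indicator_def abs_le_square_iff[symmetric])
  qed (use B in auto)
  then show ?thesis using B by (simp add: T_Domain integrable_mu_P)
qed

lemma Domain_integrable:
  assumes "f \<in> Domain T"
  shows "integrable (mu f) (\<lambda>x. x\<^sup>2)" "integrable (mu f) (\<lambda>x. x)"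
proof -
  show 1: "integrable (mu f) (\<lambda>x. x\<^sup>2)" using assms by (simp add: T_Domain)
  show "integrable (mu f) (\<lambda>x. x)"
    by (rule finite_measure.square_integrable_imp_integrable[OF finite_measure_mu _ 1]) simp
qed

text \<open>The form at \<open>P B f + P (- B) g\<close> is an integral that splits into its parts
  over \<open>B\<close> and \<open>- B\<close>, and these are the forms of the two summands. So the
  two mixed terms add up to zero, and symmetry makes them equal.\<close>

lemma T_cross:
  assumes B: "B \<in> sets borel" and u: "(P B f, k) \<in> T" and v: "(P (- B) g, l) \<in> T"
  shows "inner k (P (- B) g) = 0"
proof -
  let ?w = "P B f + P (- B) g"
  have B': "- B \<in> sets borel" using B by auto
  have T: "(?w, k + l) \<in> T" using u v by (rule T_add)
  have 1: "P B ?w = P B f" "P (- B) ?w = P (- B) g"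
    using B B' by (simp_all add: linear_add[OF P_linear] P_Int[symmetric])
  have i: "integrable (mu ?w) (\<lambda>x. x)"
    using T by (intro Domain_integrable) auto
  have "inner (k + l) ?w = (LINT x|mu ?w. x)"
    using T by (rule T_quad)
  also have "\<dots> = (LINT x|mu ?w. indicator B x * x + indicator (- B) x * x)"
    by (intro Bochner_Integration.integral_cong) (auto simp: indicator_def)
  also have "\<dots> = (LINT x|mu ?w. indicator B x * x) + (LINT x|mu ?w. indicator (- B) x * x)"
    using B B' i by (intro Bochner_Integration.integral_add integrable_indicator_mult) auto
  also have "\<dots> = inner k (P B f) + inner l (P (- B) g)"
    using B B' T_quad[OF u] T_quad[OF v] by (simp add: integral_mu_P[symmetric] 1)
  finally have "inner k (P (- B) g) + inner l (P B f) = 0"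
    by (simp add: inner_add_left inner_add_right)
  moreover have "inner l (P B f) = inner k (P (- B) g)"
    using T_sym[OF v u] by (simp add: inner_commute)
  ultimately show ?thesis by simp
qed

text \<open>By \<open>T_cross\<close>, \<open>k\<close> has no component along the vectors
  \<open>P (- B) g\<close> and \<open>h - k\<close> none along \<open>P B g\<close>, for
  \<open>g\<close> in the domain. Hence \<open>k - P B h\<close> is orthogonal to the
  domain.\<close>

lemma T_P:
  assumes B: "B \<in> sets borel" and f: "(f, h) \<in> T"
  shows "(P B f, P B h) \<in> T"
proof -
  have B': "- B \<in> sets borel" using B by auto
  obtain k where k: "(P B f, k) \<in> T" using Domain_P[OF B, of f] f by auto
  have k': "(P (- B) f, h - k) \<in> T"
    using T_diff[OF f k] B by (simp add: P_Compl)
  have "k - P B h = 0"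
  proof (rule T_dense)
    fix g l assume g: "(g, l) \<in> T"
    obtain m where m: "(P B g, m) \<in> T" using Domain_P[OF B, of g] g by auto
    have m': "(P (- B) g, l - m) \<in> T"
      using T_diff[OF g m] B by (simp add: P_Compl)
    have "inner k (P (- B) g) = 0" using T_cross[OF B k m'] .
    moreover have "inner (h - k) (P B g) = 0"
      using T_cross[OF B' k', of g m] m by simp
    ultimately show "inner g (k - P B h) = 0"
      using B P_sym[OF B, of h g] by (simp add: P_Compl inner_diff_right inner_diff_left inner_commute)
  qed
  with k show ?thesis by simp
qed

lemma T_P_quad:
  assumes B: "B \<in> sets borel" and f: "(f, h) \<in> T"
  shows "inner (P B h) f = (LINT x|mu f. indicator B x * x)"
proof -
  have "inner (P B h) f = inner (P B h) (P B f)"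
    using B by (metis P_Int P_sym inf.idem)
  also have "\<dots> = (LINT x|mu (P B f). x)"
    by (rule T_quad[OF T_P[OF assms]])
  finally show ?thesis using B by (simp add: integral_mu_P)
qed

section \<open>From the quadratic form to norms\<close>

lemma T_quad_le:
  assumes B: "B \<in> sets borel" "B \<subseteq> {s - d..s + d}" and v: "(P B v, k) \<in> T"
  shows "\<bar>inner (k - s *\<^sub>R P B v) (P B v)\<bar> \<le> d * (norm (P B v))\<^sup>2"
proof -
  let ?v = "P B v"
  have i: "integrable (mu ?v) (\<lambda>x. x)" using v by (intro Domain_integrable) auto
  have "inner (k - s *\<^sub>R ?v) ?v = (LINT x|mu ?v. x) - s * (norm ?v)\<^sup>2"
    by (simp add: inner_diff_left T_quad[OF v] dot_square_norm)
  also have "\<dots> = (LINT x|mu ?v. x - s)"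
    using i by (subst Bochner_Integration.integral_diff) (auto simp: measure_mu_UNIV finite_measure.integrable_const[OF finite_measure_mu])
  also have "\<dots> = (LINT x|mu v. indicator B x * (x - s))"
    using B by (simp add: integral_mu_P)
  finally have "\<bar>inner (k - s *\<^sub>R ?v) ?v\<bar> = \<bar>LINT x|mu v. indicator B x * (x - s)\<bar>" by simp
  also have "\<dots> \<le> (LINT x|mu v. \<bar>indicator B x * (x - s)\<bar>)"
    by (rule integral_abs_bound)
  also have "\<dots> \<le> (LINT x|mu v. d * indicator B x)"
  proof (rule integral_mono)
    have *: "\<bar>indicator B x * (x - s)\<bar> \<le> \<bar>d\<bar>" for x
      using B by (force simp: indicator_def)
    show "integrable (mu v) (\<lambda>x. \<bar>indicator B x * (x - s)\<bar>)"
      by (rule integrable_bounded) (use * B in auto)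
    show "integrable (mu v) (\<lambda>x. d * indicator B x)"
      by (rule integrable_bounded[of _ "\<bar>d\<bar>"]) (use B in \<open>auto simp: indicator_def\<close>)
    show "\<bar>indicator B x * (x - s)\<bar> \<le> d * indicator B x" for x
      using B by (force simp: indicator_def)
  qed
  also have "\<dots> = d * (norm ?v)\<^sup>2"
    using B by (simp add: measure_mu)
  finally show ?thesis .
qed

text \<open>The norm of a symmetric operator is bounded by its numerical radius. The argument is
  polarization: \<open>T_quad_le\<close> is used at \<open>u + c *\<^sub>R w\<close> for
  \<open>c = \<tau>\<close> and \<open>c = - \<tau>\<close>.\<close>

lemma T_local_norm:
  assumes B: "B \<in> sets borel" "B \<subseteq> {s - d..s + d}" and f: "(f, h) \<in> T"
  shows "norm (P B h - s *\<^sub>R P B f) \<le> d * norm (P B f)"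
proof -
  define u where "u = P B f"
  define w where "w = P B h - s *\<^sub>R P B f"
  have lin: "linear (P B)" using P_linear B by simp
  have idem: "P B (P B g) = P B g" for g using B by (metis P_Int inf.idem)
  have w: "P B w = w" by (simp add: w_def linear_diff[OF lin] linear_scale[OF lin] idem)
  have u: "P B u = u" by (simp add: u_def idem)
  have Tu: "(u, P B h) \<in> T" using T_P[OF B(1) f] by (simp add: u_def)
  show ?thesis
  proof (cases "u = 0")
    case True
    then show ?thesis using T_zero Tu by (simp add: u_def[symmetric])
  next
    case False
    show ?thesis
    proof (cases "w = 0")
      case True
      \<comment> \<open>The sign of \<open>d\<close> is not given directly; the form bound at the
        nonzero vector \<open>u\<close> supplies it.\<close>
      have "0 \<le> d * (norm u)\<^sup>2"
        using T_quad_le[OF B, of f "P B h"] Tu unfolding u_def by linarith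
      with False have "0 \<le> d" by (simp add: zero_le_mult_iff)
      with True show ?thesis by (simp add: w_def)
    next
      case w0: False
      have "B \<subseteq> {- (\<bar>s\<bar> + \<bar>d\<bar>)..\<bar>s\<bar> + \<bar>d\<bar>}" using B(2) by force
      then obtain k where k: "(w, k) \<in> T" using Domain_P_bounded[OF B(1), of _ w] w by force
      \<comment> \<open>This choice makes \<open>u\<close> and \<open>\<tau> *\<^sub>R w\<close>
        equally long, so that subtracting the two form bounds loses nothing.\<close>
      define \<tau> where "\<tau> = norm u / norm w"
      define z where "z = k - s *\<^sub>R w"
      have w': "P B h = w + s *\<^sub>R u" by (simp add: w_def u_def)
      have key: "\<bar>inner (w + c *\<^sub>R z) (u + c *\<^sub>R w)\<bar> \<le> d * (norm (u + c *\<^sub>R w))\<^sup>2" for c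
      proof -
        have "P B (u + c *\<^sub>R w) = u + c *\<^sub>R w"
          using u w by (simp add: linear_add[OF lin] linear_scale[OF lin])
        moreover have "(u + c *\<^sub>R w, P B h + c *\<^sub>R k) \<in> T"
          using T_add[OF Tu T_scale[OF k]] .
        ultimately have "\<bar>inner (P B h + c *\<^sub>R k - s *\<^sub>R (u + c *\<^sub>R w)) (u + c *\<^sub>R w)\<bar> \<le> d * (norm (u + c *\<^sub>R w))\<^sup>2"
          using T_quad_le[OF B, of "u + c *\<^sub>R w" "P B h + c *\<^sub>R k"] by simp
        also have "P B h + c *\<^sub>R k - s *\<^sub>R (u + c *\<^sub>R w) = w + c *\<^sub>R z"
          by (simp add: w' z_def algebra_simps)
        finally show ?thesis .
      qed
      \<comment> \<open>With \<open>w\<close> as \<open>(T - s) u\<close> and \<open>z\<close> as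
        \<open>(T - s) w\<close>, symmetry moves one factor across.\<close>
      have sym: "inner z u = inner w w"
        using T_sym[OF k Tu] by (simp add: z_def w' inner_diff_left inner_diff_right inner_add_right inner_commute)
      have e: "inner (w + c *\<^sub>R z) (u + c *\<^sub>R w) = inner w u + 2 * c * inner w w + c\<^sup>2 * inner z w" for c
        by (simp add: inner_add_left inner_add_right sym algebra_simps power2_eq_square)
      have n: "(norm (u + c *\<^sub>R w))\<^sup>2 = inner u u + 2 * c * inner u w + c\<^sup>2 * inner w w" for c
        unfolding power2_norm_eq_inner by (simp add: inner_add_left inner_add_right inner_commute[of w u] algebra_simps power2_eq_square)
      define W where "W = inner w w"
      have a: "inner w u + 2 * \<tau> * W + \<tau>\<^sup>2 * inner z w \<le> d * (inner u u + 2 * \<tau> * inner u w + \<tau>\<^sup>2 * W)"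
        using key[of \<tau>] unfolding e n W_def by linarith
      have b: "- (inner w u - 2 * \<tau> * W + \<tau>\<^sup>2 * inner z w) \<le> d * (inner u u - 2 * \<tau> * inner u w + \<tau>\<^sup>2 * W)"
        using key[of "- \<tau>"] unfolding e n W_def by simp
      have "4 * \<tau> * W \<le> d * (2 * (inner u u + \<tau>\<^sup>2 * W))"
        using add_mono[OF a b] by (simp add: algebra_simps)
      moreover have "\<tau>\<^sup>2 * W = inner u u"
        using w0 by (simp add: W_def \<tau>_def power_divide power2_norm_eq_inner)
      moreover have "\<tau> * W = norm u * norm w"
        using w0 unfolding \<tau>_def W_def power2_norm_eq_inner[symmetric] by (simp add: power2_eq_square)
      ultimately have "4 * (norm u * norm w) \<le> d * (4 * (norm u)\<^sup>2)"
        by (simp add: power2_norm_eq_inner mult.assoc)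
      then have "norm u * norm w \<le> norm u * (d * norm u)"
        by (simp add: power2_eq_square algebra_simps)
      then have "norm w \<le> d * norm u"
        using False by simp
      then show ?thesis by (simp add: w_def u_def)
    qed
  qed
qed

end

text \<open>Second-order increments force a vanishing derivative. This is what turns approximate
  identities on short intervals into exact ones.\<close>

lemma quadratic_increment_imp_const:
  fixes G :: "real \<Rightarrow> real"
  assumes "\<And>x y. x \<le> y \<Longrightarrow> \<bar>G y - G x\<bar> \<le> K * (y - x)\<^sup>2"
  shows "G x = G y"
proof -
  have "DERIV G x :> 0" for x
  proof -
    have K: "\<bar>G (x + h) - G x\<bar> \<le> K * h\<^sup>2" for h
      using assms[of x "x + h"] assms[of "x + h" x] by (cases "h \<ge> 0") (auto simp: abs_minus_commute)
    have "(\<lambda>h. (G (x + h) - G x) / h) \<midarrow>0\<rightarrow> 0"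
    proof (rule Lim_null_comparison)
      show "\<forall>\<^sub>F h in at 0. norm ((G (x + h) - G x) / h) \<le> K * \<bar>h\<bar>"
        unfolding eventually_at_filter
      proof (intro always_eventually allI impI)
        fix h :: real assume "h \<noteq> 0"
        have "\<bar>G (x + h) - G x\<bar> \<le> (K * \<bar>h\<bar>) * \<bar>h\<bar>"
          using K[of h] by (simp add: power2_eq_square mult.assoc)
        then show "norm ((G (x + h) - G x) / h) \<le> K * \<bar>h\<bar>"
          using \<open>h \<noteq> 0\<close> by (simp add: field_simps abs_divide)
      qed
      show "(\<lambda>h. K * \<bar>h\<bar>) \<midarrow>0\<rightarrow> 0" by (auto intro!: tendsto_eq_intros)
    qed
    then show ?thesis by (simp add: DERIV_def)
  qed
  then show ?thesis by (intro DERIV_isconst_all) auto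
qed

context spectral_operator
begin

lemma norm_P_le: "B \<in> sets borel \<Longrightarrow> norm (P B f) \<le> norm f"
proof -
  assume B: "B \<in> sets borel"
  have "(norm (P B f))\<^sup>2 = inner (P B f) f" using B by (simp add: P_inner_self)
  also have "\<dots> \<le> norm (P B f) * norm f" by (rule norm_cauchy_schwarz)
  finally show ?thesis
    by (cases "P B f = 0") (auto simp: power2_eq_square)
qed

text \<open>Both quantities are expanded around \<open>s\<close>. The linear terms agree because
  \<open>inner (P B h) (P B f)\<close> is the first moment over \<open>B\<close>; what remains are
  two numbers between \<open>0\<close> and \<open>d\<^sup>2 * (norm f)\<^sup>2\<close>.\<close>

lemma T_local_square:
  assumes B: "B \<in> sets borel" "B \<subseteq> {s - d..s + d}" and f: "(f, h) \<in> T"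
  shows "\<bar>(norm (P B h))\<^sup>2 - (LINT x|mu f. indicator B x * x\<^sup>2)\<bar> \<le> d\<^sup>2 * (norm f)\<^sup>2"
proof -
  have fD: "f \<in> Domain T" using f by auto
  have i: "integrable (mu f) (\<lambda>x. indicator B x * x)" "integrable (mu f) (\<lambda>x. indicator B x * x\<^sup>2)"
    "integrable (mu f) (\<lambda>x. indicator B x :: real)"
    using integrable_indicator_mult[OF B(1) Domain_integrable(2)[OF fD]]
      integrable_indicator_mult[OF B(1) Domain_integrable(1)[OF fD]]
      integrable_bounded[of "indicator B" 1 f] B(1)
    by (auto simp: indicator_def[abs_def])
  have "inner (P B h) (P B f) = inner (P B h) f"
    using B by (metis P_Int P_sym inf.idem)
  also have "\<dots> = (LINT x|mu f. indicator B x * x)"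
    by (rule T_P_quad[OF B(1) f])
  finally have q: "inner (P B h) (P B f) = (LINT x|mu f. indicator B x * x)" .
  have n: "(norm (u - s *\<^sub>R v))\<^sup>2 = (norm u)\<^sup>2 - 2 * s * inner u v + s\<^sup>2 * (norm v)\<^sup>2" for u v :: 'v
    unfolding power2_norm_eq_inner
    by (simp add: inner_diff_left inner_diff_right inner_commute power2_eq_square)
  have 1: "(norm (P B h - s *\<^sub>R P B f))\<^sup>2 =
      (norm (P B h))\<^sup>2 - 2 * s * (LINT x|mu f. indicator B x * x) + s\<^sup>2 * (norm (P B f))\<^sup>2"
    unfolding n q ..
  have "(LINT x|mu f. indicator B x * (x - s)\<^sup>2) =
      (LINT x|mu f. indicator B x * x\<^sup>2 - 2 * s * (indicator B x * x) + s\<^sup>2 * indicator B x)"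
    by (intro Bochner_Integration.integral_cong) (auto simp: power2_eq_square algebra_simps)
  also have "\<dots> = (LINT x|mu f. indicator B x * x\<^sup>2) - 2 * s * (LINT x|mu f. indicator B x * x)
      + s\<^sup>2 * (norm (P B f))\<^sup>2"
    using i B by (simp add: measure_mu)
  finally have 2: "(norm (P B h))\<^sup>2 - (LINT x|mu f. indicator B x * x\<^sup>2) =
      (norm (P B h - s *\<^sub>R P B f))\<^sup>2 - (LINT x|mu f. indicator B x * (x - s)\<^sup>2)"
    using 1 by simp
  have dB: "d\<^sup>2 * (norm (P B f))\<^sup>2 \<le> d\<^sup>2 * (norm f)\<^sup>2"
    using norm_P_le[OF B(1), of f] by (intro mult_left_mono power_mono) auto
  have "(norm (P B h - s *\<^sub>R P B f))\<^sup>2 \<le> (d * norm (P B f))\<^sup>2"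
    using T_local_norm[OF B f] by (intro power_mono) auto
  moreover have "(LINT x|mu f. indicator B x * (x - s)\<^sup>2) \<le> (LINT x|mu f. d\<^sup>2 * indicator B x)"
  proof (rule integral_mono)
    have *: "indicator B x * (x - s)\<^sup>2 \<le> d\<^sup>2 * indicator B x" for x
      using B(2) by (force simp: indicator_def abs_le_square_iff[symmetric])
    show "integrable (mu f) (\<lambda>x. indicator B x * (x - s)\<^sup>2)"
    proof (rule integrable_bounded)
      show "\<bar>indicator B x * (x - s)\<^sup>2\<bar> \<le> d\<^sup>2" for x
        using *[of x] by (auto simp: indicator_def split: if_splits)
    qed (use B in auto)
    show "integrable (mu f) (\<lambda>x. d\<^sup>2 * indicator B x)" using i by simp
    show "indicator B x * (x - s)\<^sup>2 \<le> d\<^sup>2 * indicator B x" for x by (rule *)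
  qed
  moreover have "(LINT x|mu f. d\<^sup>2 * indicator B x) = d\<^sup>2 * (norm (P B f))\<^sup>2"
    using B by (simp add: measure_mu)
  moreover have "0 \<le> (LINT x|mu f. indicator B x * (x - s)\<^sup>2)"
    by (intro integral_nonneg_AE) auto
  ultimately show ?thesis
    using dB zero_le_power2[of "norm (P B h - s *\<^sub>R P B f)"] unfolding 2 power_mult_distrib by linarith
qed

lemma T_norm_interval:
  assumes f: "(f, h) \<in> T" and "a \<le> b"
  shows "(norm (P {a..<b} h))\<^sup>2 = (LINT x|mu f. indicator {a..<b} x * x\<^sup>2)"
proof -
  define D where "D B = (norm (P B h))\<^sup>2 - (LINT x|mu f. indicator B x * x\<^sup>2)" for B
  have fD: "f \<in> Domain T" using f by auto
  have add: "D {..<y} = D {..<x} + D {x..<y}" if "x \<le> y" for x y :: real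
  proof -
    have u: "{..<y} = {..<x} \<union> {x..<y}" using that by auto
    have "P {..<y} h = P {..<x} h + P {x..<y} h" unfolding u by (rule P_Un) auto
    moreover have "inner (P {..<x} h) (P {x..<y} h) = 0" by (rule P_orth) auto
    ultimately have "(norm (P {..<y} h))\<^sup>2 = (norm (P {..<x} h))\<^sup>2 + (norm (P {x..<y} h))\<^sup>2"
      by (simp add: power2_norm_eq_inner inner_add_left inner_add_right inner_commute)
    moreover have "(LINT z|mu f. indicator {..<y} z * z\<^sup>2) =
        (LINT z|mu f. indicator {..<x} z * z\<^sup>2 + indicator {x..<y} z * z\<^sup>2)"
      using that by (intro Bochner_Integration.integral_cong) (auto simp: indicator_def)
    moreover have "\<dots> = (LINT z|mu f. indicator {..<x} z * z\<^sup>2) + (LINT z|mu f. indicator {x..<y} z * z\<^sup>2)"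
      by (intro Bochner_Integration.integral_add integrable_indicator_mult Domain_integrable[OF fD]) auto
    ultimately show ?thesis by (simp add: D_def)
  qed
  \<comment> \<open>\<open>D\<close> is additive over adjacent intervals and of second order in
    their length, so its distribution function is constant.\<close>
  have "D {..<a} = D {..<b}"
  proof (rule quadratic_increment_imp_const[where G = "\<lambda>x. D {..<x}"])
    fix x y :: real assume "x \<le> y"
    then have "D {..<y} - D {..<x} = D {x..<y}" "{x..<y} \<subseteq> {x - (y - x)..x + (y - x)}"
      using add[of x y] by auto
    then show "\<bar>D {..<y} - D {..<x}\<bar> \<le> (norm f)\<^sup>2 * (y - x)\<^sup>2"
      using T_local_square[OF _ _ f, of "{x..<y}" x "y - x"] by (simp add: D_def mult.commute)
  qed
  then show ?thesis using add[OF \<open>a \<le> b\<close>] by (simp add: D_def)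
qed

text \<open>Half-open intervals form an intersection-stable generator of the Borel sets, and
  \<open>T_norm_interval\<close> gives equality on them.\<close>

lemma mu_T:
  assumes f: "(f, h) \<in> T"
  shows "mu h = density (mu f) (\<lambda>x. ennreal (x\<^sup>2))"
proof -
  let ?E = "range (\<lambda>(a, b). {a..<b :: real})"
  show ?thesis
  proof (rule measure_eqI_generator_eq[where E = ?E and A = "\<lambda>n. {- real n..<real n}"])
    show "Int_stable ?E" by (auto simp: Int_stable_def)
    show "sets (mu h) = sigma_sets UNIV ?E"
      "sets (density (mu f) (\<lambda>x. ennreal (x\<^sup>2))) = sigma_sets UNIV ?E"
      by (simp_all add: borel_eq_atLeastLessThan)
    show "range (\<lambda>n. {- real n..<real n}) \<subseteq> ?E" by auto
    show "(\<Union>n. {- real n..<real n}) = UNIV"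
    proof -
      have "\<exists>n. - real n \<le> x \<and> x < real n" for x
      proof -
        obtain n where "\<bar>x\<bar> < real n" using reals_Archimedean2 by blast
        then show ?thesis by (intro exI[of _ n]) auto
      qed
      then show ?thesis by auto
    qed
    show "emeasure (mu h) {- real n..<real n} \<noteq> \<infinity>" for n by (simp add: emeasure_mu)
    fix X assume "X \<in> ?E"
    then obtain a b where X: "X = {a..<b}" by auto
    have i: "integrable (mu f) (\<lambda>x. indicator X x * x\<^sup>2)"
      using f X by (intro integrable_indicator_mult Domain_integrable) auto
    have "emeasure (density (mu f) (\<lambda>x. ennreal (x\<^sup>2))) X = (\<integral>\<^sup>+x. ennreal (x\<^sup>2) * indicator X x \<partial>mu f)"
      using X by (intro emeasure_density) auto
    also have "\<dots> = (\<integral>\<^sup>+x. ennreal (indicator X x * x\<^sup>2) \<partial>mu f)"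
      by (intro nn_integral_cong) (auto simp: indicator_def)
    also have "\<dots> = ennreal (LINT x|mu f. indicator X x * x\<^sup>2)"
      using i by (intro nn_integral_eq_integral) auto
    also have "\<dots> = emeasure (mu h) X"
      using T_norm_interval[OF f, of a b] X by (cases "a \<le> b") (auto simp: emeasure_mu)
    finally show "emeasure (mu h) X = emeasure (density (mu f) (\<lambda>x. ennreal (x\<^sup>2))) X" by simp
  qed auto
qed

text \<open>By iteration of \<open>mu_T\<close>, the measure of \<open>g j\<close> has density
  \<open>x ^ (2 * j)\<close>. Even moments are thus total masses, and odd ones are values of the
  quadratic form.\<close>

lemma moments:
  assumes g: "\<And>k. (g k, g (Suc k)) \<in> T"
  shows "integrable (mu (g 0)) (\<lambda>x. x ^ k)" "(LINT x|mu (g 0). x ^ k) = inner (g k) (g 0)"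
proof -
  have dens: "mu (g k) = density (mu (g 0)) (\<lambda>x. ennreal (x ^ (2 * k)))" for k
  proof (induction k)
    case 0
    show ?case by (simp add: density_1)
  next
    case (Suc k)
    have "mu (g (Suc k)) = density (mu (g 0)) (\<lambda>x. ennreal (x ^ (2 * k)) * ennreal (x\<^sup>2))"
      unfolding mu_T[OF g] Suc by (rule density_density_eq) auto
    then show ?case by (simp add: ennreal_mult'[symmetric] power_add power2_eq_square mult_ac)
  qed
  \<comment> \<open>Symmetry moves the applications of \<open>T\<close> one by one to the other
    side.\<close>
  have shift: "inner (g (i + j)) (g 0) = inner (g i) (g j)" for i j
  proof (induction j arbitrary: i)
    case (Suc j)
    have "inner (g (i + Suc j)) (g 0) = inner (g (Suc i)) (g j)"
      using Suc[of "Suc i"] by simp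
    also have "\<dots> = inner (g i) (g (Suc j))" by (rule T_sym[OF g g])
    finally show ?case .
  qed simp
  have "integrable (mu (g 0)) (\<lambda>x. x ^ k) \<and> (LINT x|mu (g 0). x ^ k) = inner (g k) (g 0)"
  proof (cases "even k")
    case True
    then obtain j where k: "k = 2 * j" by (rule evenE)
    have "integrable (mu (g j)) (\<lambda>x. 1 :: real)"
      by (rule finite_measure.integrable_const[OF finite_measure_mu])
    moreover have "(LINT x|mu (g j). 1 :: real) = inner (g k) (g 0)"
      using shift[of j j] by (simp add: measure_mu_UNIV k power2_norm_eq_inner mult_2)
    ultimately show ?thesis
      unfolding dens[of j] k
      by (simp add: integrable_density integral_density del: lebesgue_integral_const)
  next
    case False
    then obtain j where k: "k = 2 * j + 1" by (rule oddE)
    have "integrable (mu (g j)) (\<lambda>x. x)" using g[of j] by (intro Domain_integrable) auto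
    moreover have "(LINT x|mu (g j). x) = inner (g k) (g 0)"
      using shift[of "Suc j" j] T_quad[OF g[of j]] by (simp add: k mult_2)
    moreover have "(\<lambda>x::real. x ^ (2 * j) *\<^sub>R x) = (\<lambda>x. x ^ k)"
      unfolding k by (rule ext) (simp add: mult.commute)
    ultimately show ?thesis
      unfolding dens[of j] by (simp only: integrable_density integral_density
        measurable_mu measurable_ident_sets borel_measurable_const AE_I2 zero_le_even_power
        borel_measurable_power measurable_ident even_mult_iff even_numeral simp_thms measurable_ident[unfolded id_def])
  qed
  then show "integrable (mu (g 0)) (\<lambda>x. x ^ k)" "(LINT x|mu (g 0). x ^ k) = inner (g k) (g 0)" by auto
qed

section \<open>Approximate resolvent powers\<close>

lemma P_lessThan_tendsto_0:
  assumes "d > 0"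
  shows "(\<lambda>n. norm (P {..<M - real n * d} f)) \<longlonglongrightarrow> 0"
proof -
  let ?A = "\<lambda>n::nat. {..<M - real n * d}"
  have "(\<lambda>n. measure (mu f) (?A n)) \<longlonglongrightarrow> measure (mu f) (\<Inter>n. ?A n)"
  proof (rule finite_measure.finite_Lim_measure_decseq[OF finite_measure_mu])
    show "decseq ?A" using assms by (auto simp: decseq_def intro: order.strict_trans2 mult_right_mono)
  qed auto
  also have "(\<Inter>n. ?A n) = {}"
  proof -
    have "x \<notin> (\<Inter>n. ?A n)" for x
    proof -
      obtain n where "M - x < real n * d" using ex_less_of_nat_mult[OF assms] by auto
      then show ?thesis by (auto intro!: exI[of _ n])
    qed
    then show ?thesis by blast
  qed
  finally have "(\<lambda>n. sqrt ((norm (P (?A n) f))\<^sup>2)) \<longlonglongrightarrow> sqrt 0"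
    by (intro tendsto_real_sqrt) (simp add: measure_mu)
  then show ?thesis by simp
qed

text \<open>The vectors \<open>u j\<close> stand for \<open>(M + 1 - T)\<^sup>-\<^sup>j f\<close>.
  The function \<open>1 / (M + 1 - x)\<close> is replaced by a step function on finitely many
  intervals of length \<open>d\<close>; this keeps every \<open>u (Suc j)\<close> in the domain,
  with image \<open>k j\<close>. The errors stem from the mesh and from the tail that is cut
  off.\<close>

lemma resolvent_powers:
  assumes M: "P {M..} f = 0" and e: "e > 0"
  shows "\<exists>u k. norm (u 0 - f) < e \<and>
    (\<forall>j. (u (Suc j), k j) \<in> T \<and> norm ((M + 1) *\<^sub>R u (Suc j) - k j - u j) < e) \<and>
    (\<forall>j\<le>J. \<bar>inner (u j) f - (LINT x|mu f. indicator {..<M} x * (1 / (M + 1 - x)) ^ j)\<bar> < e)"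
proof -
  \<comment> \<open>The first bound serves the defect in the resolvent equation, the second the
    integrals, where a power up to \<open>J\<close> multiplies the mesh error by at most
    \<open>J\<close>.\<close>
  define d where "d = min (e / (2 * (norm f + 1))) (e / (2 * (real J * (norm f)\<^sup>2 + 1)))"
  have d0: "d > 0" using e by (auto simp: d_def add_nonneg_pos)
  have frac: "e / (2 * (a + 1)) * a \<le> e / 2" if "a \<ge> 0" for a
  proof -
    have "e / 2 * (a / (a + 1)) \<le> e / 2 * 1"
      using that e by (intro mult_left_mono) auto
    then show ?thesis by simp
  qed
  have d1: "d * norm f < e"
  proof -
    have "d * norm f \<le> e / (2 * (norm f + 1)) * norm f" by (intro mult_right_mono) (auto simp: d_def)
    also have "\<dots> < e" using frac[OF norm_ge_zero[of f]] e by linarith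
    finally show ?thesis .
  qed
  have d2: "d * (real J * (norm f)\<^sup>2) \<le> e / 2"
  proof -
    let ?a = "real J * (norm f)\<^sup>2"
    have a: "?a \<ge> 0" by simp
    have "d * ?a \<le> e / (2 * (?a + 1)) * ?a" by (intro mult_right_mono) (auto simp: d_def)
    also have "\<dots> \<le> e / 2" using frac[OF a] .
    finally show ?thesis .
  qed
  \<comment> \<open>The tail enters \<open>u 0 - f\<close> through its norm and the integrals
    through its square, hence the two bounds.\<close>
  have "\<forall>\<^sub>F n in sequentially. norm (P {..<M - real n * d} f) < min e (sqrt (e / 2))"
    using order_tendstoD(2)[OF P_lessThan_tendsto_0[OF d0, of M f], of "min e (sqrt (e / 2))"] e by simp
  then obtain K where K: "norm (P {..<M - real K * d} f) < min e (sqrt (e / 2))"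
    by (auto simp: eventually_sequentially)
  define I where "I i = {M - real (Suc i) * d..<M - real i * d}" for i :: nat
  \<comment> \<open>The value of \<open>1 / (M + 1 - x)\<close> at the right end
    \<open>M - real i * d\<close> of \<open>I i\<close>.\<close>
  define y where "y i = 1 / (1 + real i * d)" for i :: nat
  have I [measurable]: "I i \<in> sets borel" for i by (simp add: I_def)
  have Isub: "I i \<subseteq> {M - real i * d - d..M - real i * d + d}" for i
    using d0 by (auto simp: I_def algebra_simps)
  have Idisj: "I i \<inter> I j = {}" if "i \<noteq> j" for i j
  proof -
    have *: "I i \<inter> I j = {}" if "i < j" for i j
    proof -
      have "real (Suc i) * d \<le> real j * d" using that d0 by (intro mult_right_mono) auto
      then show ?thesis by (auto simp: I_def)
    qed
    show ?thesis using *[of i j] *[of j i] that by (auto simp: Int_commute linorder_neq_iff)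
  qed
  have y: "0 < y i" "y i \<le> 1" for i using d0 by (auto simp: y_def add_pos_nonneg)
  have "\<exists>t. (P (I i) f, t) \<in> T" for i
  proof -
    have "I i \<subseteq> {- (\<bar>M - real i * d\<bar> + d)..\<bar>M - real i * d\<bar> + d}" using Isub[of i] by force
    then show ?thesis using Domain_P_bounded[of "I i"] I by blast
  qed
  then obtain t where t: "(P (I i) f, t i) \<in> T" for i by metis
  have idem: "P (I i) (P (I i) g) = P (I i) g" for i g
    using P_Int[of "I i" "I i" g] I by simp
  have Pt: "P (I i) (t i) = t i" for i
  proof -
    have "(P (I i) f, P (I i) (t i)) \<in> T" using T_P[OF I[of i] t[of i]] by (simp add: idem)
    from T_diff[OF this t[of i]] show ?thesis using T_zero by fastforce
  qed
  have near: "norm (t i - (M - real i * d) *\<^sub>R P (I i) f) \<le> d * norm (P (I i) f)" for i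
    using T_local_norm[OF I[of i] Isub t[of i]] by (simp add: Pt idem)
  define u where "u j = (\<Sum>i<K. y i ^ j *\<^sub>R P (I i) f)" for j
  define k where "k j = (\<Sum>i<K. y i ^ Suc j *\<^sub>R t i)" for j
  have Psum: "P {M - real n * d..<M} g = (\<Sum>i<n. P (I i) g)" for n g
  proof (induction n)
    case (Suc n)
    have "0 \<le> real n * d" using d0 by simp
    then have "M - real n * d \<le> M" "M - real (Suc n) * d \<le> M - real n * d"
      using d0 by (auto simp: algebra_simps)
    then have "{M - real (Suc n) * d..<M} = I n \<union> {M - real n * d..<M}"
      unfolding I_def by auto
    moreover have "I n \<inter> {M - real n * d..<M} = {}" by (auto simp: I_def)
    ultimately show ?case using P_Un[of "I n" "{M - real n * d..<M}" g] Suc by (simp add: add.commute)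
  qed simp
  have u0: "f - u 0 = P {..<M - real K * d} f"
  proof -
    have n: "real K * d \<ge> 0" using d0 by simp
    have "{..<M} \<union> {M..} = UNIV" by auto
    moreover have "{..<M} \<inter> {M..} = {}" by auto
    ultimately have "f = P {..<M} f" using M P_Un[of "{..<M}" "{M..}" f] P_UNIV[of f] by simp
    also have "{..<M} = {..<M - real K * d} \<union> {M - real K * d..<M}" using n by auto
    also have "P \<dots> f = P {..<M - real K * d} f + P {M - real K * d..<M} f"
      by (rule P_Un) auto
    finally have "f = P {..<M - real K * d} f + u 0" by (simp add: u_def Psum)
    then show ?thesis by (metis add_diff_cancel_right')
  qed
  show ?thesis
  proof (rule exI[of _ u], rule exI[of _ k], intro conjI allI impI)
    show "norm (u 0 - f) < e"
      using u0 K by (simp add: norm_minus_commute)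
    show "(u (Suc j), k j) \<in> T" for j
    proof -
      have "(\<Sum>i<K. (y i ^ Suc j *\<^sub>R P (I i) f, y i ^ Suc j *\<^sub>R t i)) \<in> T"
        by (intro subspace_sum[OF T_subspace] T_scale t)
      then show ?thesis by (simp add: u_def k_def sum_prod)
    qed
    show "norm ((M + 1) *\<^sub>R u (Suc j) - k j - u j) < e" for j
    proof -
      define w where "w i = y i ^ Suc j *\<^sub>R ((M - real i * d) *\<^sub>R P (I i) f - t i)" for i
      have "(M + 1) *\<^sub>R u (Suc j) - k j - u j = (\<Sum>i<K. w i)"
      proof -
        have "(M + 1) *\<^sub>R (y i ^ Suc j *\<^sub>R v) - y i ^ Suc j *\<^sub>R t i - y i ^ j *\<^sub>R v =
            y i ^ Suc j *\<^sub>R ((M - real i * d) *\<^sub>R v - t i)" for i v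
        proof -
          have "y i * (1 + real i * d) = 1" using d0 by (simp add: y_def add_pos_nonneg less_imp_neq[THEN not_sym])
          then have "y i ^ Suc j * (1 + real i * d) = y i ^ j" by simp
          moreover have "(M + 1) *\<^sub>R (Y *\<^sub>R v) - Y *\<^sub>R t i - (Y * (1 + r)) *\<^sub>R v = Y *\<^sub>R ((M - r) *\<^sub>R v - t i)" for Y r
          proof -
            have "(M + 1) *\<^sub>R (Y *\<^sub>R v) - (Y * (1 + r)) *\<^sub>R v = ((M + 1) * Y - Y * (1 + r)) *\<^sub>R v"
              by (simp add: scaleR_diff_left)
            also have "(M + 1) * Y - Y * (1 + r) = Y * (M - r)" by (simp add: algebra_simps)
            finally show ?thesis by (simp add: scaleR_diff_right diff_right_commute)
          qed
          ultimately show ?thesis by metis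
        qed
        then show ?thesis
          by (simp add: u_def k_def w_def scaleR_sum_right sum_subtractf[symmetric] del: power_Suc)
      qed
      \<comment> \<open>The pieces lie in mutually orthogonal ranges, so their errors add in squares
        and the bound is independent of \<open>K\<close>, which was chosen after
        \<open>d\<close>.\<close>
      moreover have "(norm (\<Sum>i<K. w i))\<^sup>2 \<le> (d * norm f)\<^sup>2"
      proof -
        have wP: "w i = P (I i) (w i)" for i
          using P_linear[OF I, of i]
          by (simp add: w_def linear_scale linear_diff idem Pt)
        have "(norm (\<Sum>i<K. w i))\<^sup>2 = (\<Sum>i<K. (norm (w i))\<^sup>2)"
        proof (rule norm_sum_Pythagorean)
          show "pairwise (\<lambda>i j. real_inner_class.orthogonal (w i) (w j)) {..<K}"
            unfolding pairwise_def real_inner_class.orthogonal_def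
            using P_orth[OF I I Idisj] wP by metis
        qed simp
        also have "\<dots> \<le> (\<Sum>i<K. d\<^sup>2 * (norm (P (I i) f))\<^sup>2)"
        proof (rule sum_mono)
          fix i
          have "norm (w i) \<le> 1 * (d * norm (P (I i) f))"
            unfolding w_def norm_scaleR using near[of i] y[of i]
            by (intro mult_mono) (auto simp: norm_minus_commute power_le_one simp del: power_Suc)
          then show "(norm (w i))\<^sup>2 \<le> d\<^sup>2 * (norm (P (I i) f))\<^sup>2"
            using power_mono[of "norm (w i)" "d * norm (P (I i) f)" 2] by (simp add: power_mult_distrib)
        qed
        also have "\<dots> = d\<^sup>2 * (norm (\<Sum>i<K. P (I i) f))\<^sup>2"
        proof -
          have "(norm (\<Sum>i<K. P (I i) f))\<^sup>2 = (\<Sum>i<K. (norm (P (I i) f))\<^sup>2)"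
          proof (rule norm_sum_Pythagorean)
            show "pairwise (\<lambda>i j. real_inner_class.orthogonal (P (I i) f) (P (I j) f)) {..<K}"
              unfolding pairwise_def real_inner_class.orthogonal_def using P_orth[OF I I Idisj] by metis
          qed simp
          then show ?thesis by (simp add: sum_distrib_left)
        qed
        also have "\<dots> \<le> (d * norm f)\<^sup>2"
          unfolding Psum[symmetric] power_mult_distrib
          by (intro mult_left_mono power_mono norm_P_le) auto
        finally show ?thesis .
      qed
      then have "norm (\<Sum>i<K. w i) \<le> d * norm f"
        using d0 by (auto intro: power2_le_imp_le)
      ultimately show ?thesis using d1 by simp
    qed
    fix j assume j: "j \<le> J"
    let ?\<psi> = "\<lambda>x. indicator {..<M} x * (1 / (M + 1 - x)) ^ j :: real"
    let ?\<phi> = "\<lambda>x. \<Sum>i<K. y i ^ j * indicator (I i) x :: real"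
    let ?\<chi> = "indicator {..<M - real K * d} :: real \<Rightarrow> real"
    have p01: "0 \<le> 1 / (M + 1 - x)" "1 / (M + 1 - x) \<le> 1" if "x < M" for x
      using that by (auto simp: divide_le_eq)
    have \<psi>1: "\<bar>?\<psi> x\<bar> \<le> 1" for x
      using p01[of x] by (auto simp: indicator_def power_le_one)
    have \<psi>i: "integrable (mu f) ?\<psi>"
      by (rule integrable_bounded[OF _ \<psi>1]) measurable
    have Ii: "integrable (mu f) (indicator B :: real \<Rightarrow> real)" if "B \<in> sets borel" for B
      by (rule integrable_bounded[of _ 1]) (use that in \<open>auto simp: indicator_def\<close>)
    have \<phi>i: "integrable (mu f) ?\<phi>"
      by (intro Bochner_Integration.integrable_sum integrable_mult_right Ii I)
    have "(LINT x|mu f. ?\<phi> x) = (\<Sum>i<K. LINT x|mu f. y i ^ j * indicator (I i) x)"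
      by (intro Bochner_Integration.integral_sum integrable_mult_right Ii I)
    also have "\<dots> = inner (u j) f"
      using I by (simp add: u_def inner_sum_left measure_mu P_inner_self)
    finally have "\<bar>inner (u j) f - (LINT x|mu f. ?\<psi> x)\<bar> = \<bar>LINT x|mu f. ?\<phi> x - ?\<psi> x\<bar>"
      by (simp only: Bochner_Integration.integral_diff[OF \<phi>i \<psi>i])
    also have "\<dots> \<le> (LINT x|mu f. \<bar>?\<phi> x - ?\<psi> x\<bar>)" by (rule integral_abs_bound)
    also have "\<dots> \<le> (LINT x|mu f. real J * d + ?\<chi> x)"
    proof (rule integral_mono)
      show "integrable (mu f) (\<lambda>x. \<bar>?\<phi> x - ?\<psi> x\<bar>)" by (intro integrable_abs Bochner_Integration.integrable_diff \<phi>i \<psi>i)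
      show "integrable (mu f) (\<lambda>x. real J * d + ?\<chi> x)"
        by (intro Bochner_Integration.integrable_add Ii finite_measure.integrable_const[OF finite_measure_mu]) simp
      fix x
      have d': "0 \<le> real J * d" using d0 by simp
      consider "x \<ge> M" | "x < M - real K * d" | "M - real K * d \<le> x" "x < M" by linarith
      then show "\<bar>?\<phi> x - ?\<psi> x\<bar> \<le> real J * d + ?\<chi> x"
      proof cases
        case 1
        have "x \<notin> I i" for i
        proof -
          have "real i * d \<ge> 0" using d0 by simp
          then show ?thesis using 1 by (auto simp: I_def)
        qed
        then show ?thesis using 1 d' by (simp add: indicator_def)
      next
        case 2
        have "x \<notin> I i" if "i < K" for i
        proof -
          have "real (Suc i) * d \<le> real K * d" using that d0 by (intro mult_right_mono) auto
          then show ?thesis using 2 by (auto simp: I_def)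
        qed
        then have "?\<phi> x = 0" by (intro sum.neutral) auto
        then show ?thesis using \<psi>1[of x] 2 d' by simp
      next
        case 3
        \<comment> \<open>The index of the interval containing \<open>x\<close>. As
          \<open>I i\<close> is closed on the left, \<open>(M - x) / d\<close> is above
          \<open>i\<close> and at most \<open>i + 1\<close>, hence the ceiling minus one.\<close>
        define i where "i = nat (\<lceil>(M - x) / d\<rceil> - 1)"
        have pos: "(M - x) / d > 0" using 3 d0 by simp
        then have "real i = of_int (\<lceil>(M - x) / d\<rceil> - 1)"
          unfolding i_def by (intro of_nat_nat) (simp add: less_ceiling_iff)
        then have "real i < (M - x) / d" "(M - x) / d \<le> real i + 1"
          by linarith+
        then have xi: "real i * d < M - x" "M - x \<le> (real i + 1) * d"
          using d0 by (auto simp: field_simps)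
        then have xI: "x \<in> I i" by (auto simp: I_def algebra_simps)
        have "real i * d < real K * d" using xi(1) 3 by linarith
        then have iK: "i < K" using d0 by simp
        have "?\<phi> x = (\<Sum>i'<K. if i' = i then y i ^ j else 0)"
        proof (rule sum.cong)
          fix i'
          show "y i' ^ j * indicator (I i') x = (if i' = i then y i ^ j else 0)"
            using Idisj[of i' i] xI by (auto simp: indicator_def)
        qed simp
        then have phi: "?\<phi> x = y i ^ j" using iK by simp
        let ?z = "1 / (M + 1 - x)"
        have "\<bar>y i - ?z\<bar> \<le> d"
        proof -
          have a: "1 + real i * d \<ge> 1" using d0 by simp
          have b: "M + 1 - x \<ge> 1" using 3 by simp
          have "y i - ?z = (M - x - real i * d) / ((1 + real i * d) * (M + 1 - x))"
            unfolding y_def using a b by (subst diff_frac_eq) (auto simp: algebra_simps)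
          also have "\<bar>\<dots>\<bar> \<le> \<bar>M - x - real i * d\<bar>"
          proof -
            have "1 \<le> (1 + real i * d) * (M + 1 - x)" using mult_mono[OF a b] a by simp
            then show ?thesis
              by (simp add: abs_divide divide_le_eq abs_of_pos mult_le_cancel_left1)
          qed
          also have "\<dots> \<le> d" using xi by (simp add: algebra_simps)
          finally show ?thesis .
        qed
        moreover have "\<bar>y i ^ j - ?z ^ j\<bar> \<le> real j * \<bar>y i - ?z\<bar>"
          using norm_power_diff[of "y i" ?z j] y[of i] p01[of x] 3 by simp
        ultimately have "\<bar>y i ^ j - ?z ^ j\<bar> \<le> real J * d"
          using j d0 by (smt (verit) mult_mono of_nat_0_le_iff of_nat_mono abs_ge_zero)
        then show ?thesis using phi 3 by simp
      qed
    qed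
    also have "\<dots> = real J * d * (norm f)\<^sup>2 + (norm (P {..<M - real K * d} f))\<^sup>2"
    proof -
      have "(LINT x|mu f. real J * d + ?\<chi> x) = (LINT x|mu f. real J * d) + (LINT x|mu f. ?\<chi> x)"
        by (intro Bochner_Integration.integral_add Ii finite_measure.integrable_const[OF finite_measure_mu]) simp
      then show ?thesis by (simp add: measure_mu measure_mu_UNIV mult.commute)
    qed
    also have "\<dots> < e"
    proof -
      have "(norm (P {..<M - real K * d} f))\<^sup>2 < (sqrt (e / 2))\<^sup>2"
        using K by (intro power_strict_mono) auto
      then show ?thesis using d2 e by (simp add: mult_ac)
    qed
    finally show "\<bar>inner (u j) f - (LINT x|mu f. ?\<psi> x)\<bar> < e" .
  qed
qed

end

section \<open>Truncated Jacobi matrices\<close>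

text \<open>The tridiagonal matrix as a difference expression on arbitrary sequences; the general
  ring lets the same identities serve real and complex ones.\<close>

definition jac :: "(nat \<Rightarrow> 'a::comm_ring) \<Rightarrow> (nat \<Rightarrow> 'a) \<Rightarrow> (nat \<Rightarrow> 'a) \<Rightarrow> nat \<Rightarrow> 'a" where
  "jac a b f n = (if n = 0 then 0 else a (n - 1) * f (n - 1) + b n * f n + a n * f (Suc n))"

lemma jac_0 [simp]: "jac a b f 0 = 0"
  by (simp add: jac_def)

lemma jac_Suc: "jac a b f (Suc n) = a n * f n + b (Suc n) * f (Suc n) + a (Suc n) * f (Suc (Suc n))"
  by (simp add: jac_def)

text \<open>Summation by parts: the sum telescopes and leaves the Wronskian at \<open>K\<close>.
  Reality and simplicity of the zeros, orthogonality, and the symmetry of the operators all come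
  from this identity.\<close>

lemma jac_green:
  assumes "f 0 = 0" "g 0 = 0"
  shows "(\<Sum>n<Suc K. jac a b f n * g n - f n * jac a b g n) = a K * (f (Suc K) * g K - f K * g (Suc K))"
proof (induction K)
  case 0
  then show ?case using assms by simp
next
  case (Suc K)
  then show ?case by (simp add: jac_Suc algebra_simps)
qed

lemma sum_jacobi_entry:
  fixes f :: "nat \<Rightarrow> 'a::real_normed_field"
  assumes S: "finite S" "\<And>n. n \<notin> S \<Longrightarrow> f n = 0" and "f 0 = 0" "m \<ge> 1"
  shows "(\<Sum>n\<in>S. of_real (jacobi_entry a b m n) * f n) = jac (\<lambda>n. of_real (a n)) (\<lambda>n. of_real (b n)) f m"
proof -
  obtain k where k: "m = Suc k" using \<open>m \<ge> 1\<close> by (cases m) auto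
  let ?g = "\<lambda>n. of_real (jacobi_entry a b m n) * f n"
  have "sum ?g S = sum ?g (S \<union> {k, Suc k, Suc (Suc k)})"
    using S by (intro sum.mono_neutral_left) auto
  also have "\<dots> = sum ?g {k, Suc k, Suc (Suc k)}"
    using S by (intro sum.mono_neutral_right) (auto simp: jacobi_entry_def k)
  also have "\<dots> = jac (\<lambda>n. of_real (a n)) (\<lambda>n. of_real (b n)) f m"
    by (simp add: k jac_Suc jacobi_entry_def)
  finally show ?thesis .
qed

text \<open>The polynomials of the first kind. They are kept as polynomials because the count of
  their zeros uses degree and derivative, and over a general field because it passes through the
  complex numbers.\<close>

fun jpoly :: "(nat \<Rightarrow> 'a::field) \<Rightarrow> (nat \<Rightarrow> 'a) \<Rightarrow> nat \<Rightarrow> 'a poly" where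
  "jpoly a b 0 = 0"
| "jpoly a b (Suc 0) = 1"
| "jpoly a b (Suc (Suc n)) = Polynomial.smult (1 / a (Suc n))
    ([:- b (Suc n), 1:] * jpoly a b (Suc n) - Polynomial.smult (a n) (jpoly a b n))"

lemma jpoly_rec:
  assumes "a (Suc n) \<noteq> 0"
  shows "[:0, 1:] * jpoly a b (Suc n) = Polynomial.smult (a n) (jpoly a b n) + Polynomial.smult (b (Suc n)) (jpoly a b (Suc n))
    + Polynomial.smult (a (Suc n)) (jpoly a b (Suc (Suc n)))"
  using assms by (simp add: algebra_simps)

lemma jac_jpoly:
  assumes "\<And>n. n \<ge> 1 \<Longrightarrow> a n \<noteq> 0"
  shows "jac a b (\<lambda>n. poly (jpoly a b n) x) n = x * poly (jpoly a b n) x"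
proof (cases n)
  case (Suc k)
  have "poly ([:0, 1:] * jpoly a b (Suc k)) x = jac a b (\<lambda>n. poly (jpoly a b n) x) (Suc k)"
    by (subst jpoly_rec) (use assms in \<open>auto simp: jac_Suc simp del: jpoly.simps\<close>)
  then show ?thesis using Suc by simp
qed simp

text \<open>The recurrence differentiated in \<open>x\<close>; in Green's formula the additional
  summand produces a sum of squares.\<close>

lemma jac_pderiv_jpoly:
  assumes "\<And>n. n \<ge> 1 \<Longrightarrow> a n \<noteq> 0"
  shows "jac a b (\<lambda>n. poly (pderiv (jpoly a b n)) x) n =
    x * poly (pderiv (jpoly a b n)) x + poly (jpoly a b n) x"
proof (cases n)
  case (Suc k)
  have "poly (pderiv ([:0, 1:] * jpoly a b (Suc k))) x = jac a b (\<lambda>n. poly (pderiv (jpoly a b n)) x) (Suc k)"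
    by (subst jpoly_rec) (use assms in \<open>auto simp: jac_Suc pderiv_add pderiv_smult simp del: jpoly.simps\<close>)
  then show ?thesis using Suc by (simp add: pderiv_mult pderiv_pCons add.commute del: jpoly.simps)
qed simp

lemma degree_jpoly:
  assumes "\<And>n. n \<ge> 1 \<Longrightarrow> a n \<noteq> 0"
  shows "jpoly a b (Suc n) \<noteq> 0 \<and> degree (jpoly a b (Suc n)) = n"
proof (induction n rule: less_induct)
  case (less n)
  show ?case
  proof (cases n)
    case (Suc k)
    have k: "jpoly a b (Suc k) \<noteq> 0" "degree (jpoly a b (Suc k)) = k" using less[of k] Suc by auto
    have "degree (jpoly a b k) \<le> k" using less[of "k - 1"] Suc by (cases k) auto
    then have 1: "degree (Polynomial.smult (a k) (jpoly a b k)) < Suc k"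
      by (meson degree_smult_le le_less_trans lessI)
    have 2: "degree ([:- b (Suc k), 1:] * jpoly a b (Suc k)) = Suc k"
      using k by (subst degree_mult_eq) auto
    have "degree ([:- b (Suc k), 1:] * jpoly a b (Suc k) - Polynomial.smult (a k) (jpoly a b k)) = Suc k"
      using 1 2 degree_add_eq_left[of "- Polynomial.smult (a k) (jpoly a b k)"] by (simp only: degree_minus diff_conv_add_uminus)
    then have 3: "degree (jpoly a b (Suc (Suc k))) = Suc k"
      using assms[of "Suc k"] by simp
    moreover from 3 have "jpoly a b (Suc (Suc k)) \<noteq> 0" by (metis degree_0 nat.distinct(1))
    ultimately show ?thesis using Suc by (simp del: jpoly.simps)
  qed simp
qed

lemma poly_jpoly_of_real:
  fixes a b :: "nat \<Rightarrow> real"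
  shows "poly (jpoly (\<lambda>n. complex_of_real (a n)) (\<lambda>n. complex_of_real (b n)) n) (of_real x)
    = of_real (poly (jpoly a b n) x)"
  by (induction a b n rule: jpoly.induct) (auto simp: algebra_simps)

lemma cnj_poly_jpoly:
  fixes a b :: "nat \<Rightarrow> real"
  shows "cnj (poly (jpoly (\<lambda>n. complex_of_real (a n)) (\<lambda>n. complex_of_real (b n)) n) z)
    = poly (jpoly (\<lambda>n. complex_of_real (a n)) (\<lambda>n. complex_of_real (b n)) n) (cnj z)"
  by (induction a b n rule: jpoly.induct) auto

text \<open>At a complex root \<open>z\<close>, Green's formula for \<open>p(z)\<close> and its
  conjugate gives \<open>z - cnj z\<close> times a positive sum, so \<open>z\<close> is real. For
  \<open>p\<close> and its derivative it gives minus a sum of squares, so \<open>z\<close> is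
  simple. The degree then counts the roots.\<close>

lemma jpoly_real_roots:
  fixes a b :: "nat \<Rightarrow> real"
  assumes a: "\<And>n. n \<ge> 1 \<Longrightarrow> a n \<noteq> 0"
  shows "card {x. poly (jpoly a b (Suc N)) x = 0} = N"
proof -
  define A where "A n = complex_of_real (a n)" for n
  define B where "B n = complex_of_real (b n)" for n
  have A: "\<And>n. n \<ge> 1 \<Longrightarrow> A n \<noteq> 0" using a by (simp add: A_def)
  let ?p = "\<lambda>z n. poly (jpoly A B n) z"
  let ?P = "jpoly A B (Suc N)"
  have cnj: "cnj (?p z n) = ?p (cnj z) n" for z n
    using cnj_poly_jpoly[of a b] by (simp add: A_def[abs_def] B_def[abs_def])
  have ofr: "?p (of_real x) n = of_real (poly (jpoly a b n) x)" for x n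
    using poly_jpoly_of_real[of a b] by (simp add: A_def[abs_def] B_def[abs_def])
  show ?thesis
  proof (cases "N = 0")
    case N: False
    have real: "z \<in> \<real>" if z: "poly ?P z = 0" for z
    proof -
      have "(\<Sum>n<Suc N. jac A B (?p z) n * ?p (cnj z) n - ?p z n * jac A B (?p (cnj z)) n) = 0"
        using z cnj[where n = "Suc N" and z = z] by (subst jac_green) (simp_all del: jpoly.simps(3))
      then have "(\<Sum>n<Suc N. (z - cnj z) * (?p z n * ?p (cnj z) n)) = 0"
        by (simp only: jac_jpoly[OF A]) (simp add: algebra_simps)
      then have "(z - cnj z) * (\<Sum>n<Suc N. ?p z n * ?p (cnj z) n) = 0"
        by (simp only: sum_distrib_left)
      moreover have "(\<Sum>n<Suc N. ?p z n * ?p (cnj z) n) = of_real (\<Sum>n<Suc N. (cmod (?p z n))\<^sup>2)"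
        unfolding of_real_sum by (intro sum.cong) (simp_all only: cnj[symmetric] complex_norm_square)
      moreover have "(\<Sum>n<Suc N. (cmod (?p z n))\<^sup>2) > 0"
        using N by (intro sum_pos2[of _ 1]) auto
      ultimately have "z = cnj z" by (simp del: of_real_sum sum.lessThan_Suc)
      then show ?thesis by (metis Reals_cnj_iff)
    qed
    have simple: "poly (pderiv ?P) z \<noteq> 0" if z: "poly ?P z = 0" for z
    proof
      assume d: "poly (pderiv ?P) z = 0"
      obtain x where x: "z = of_real x" using real[OF z] by (auto elim: Reals_cases)
      have "(\<Sum>n<Suc N. jac A B (?p z) n * poly (pderiv (jpoly A B n)) z - ?p z n * jac A B (\<lambda>n. poly (pderiv (jpoly A B n)) z) n) = 0"
        using z d by (subst jac_green) (simp_all del: jpoly.simps(3))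
      then have "(\<Sum>n<Suc N. - (?p z n)\<^sup>2) = 0"
        by (simp only: jac_jpoly[OF A] jac_pderiv_jpoly[OF A]) (simp add: algebra_simps power2_eq_square)
      then have "complex_of_real (\<Sum>n<Suc N. (poly (jpoly a b n) x)\<^sup>2) = 0"
        unfolding of_real_sum by (simp add: sum_negf ofr x del: sum.lessThan_Suc)
      then have "(\<Sum>n<Suc N. (poly (jpoly a b n) x)\<^sup>2) = 0"
        by (simp only: of_real_eq_0_iff)
      moreover have "(\<Sum>n<Suc N. (poly (jpoly a b n) x)\<^sup>2) > 0"
        using N by (intro sum_pos2[of _ 1]) auto
      ultimately show False by simp
    qed
    have "rsquarefree ?P"
      using degree_jpoly[OF A, where b = B and n = N] simple by (auto simp: rsquarefree_roots)
    then have c: "card {z. poly ?P z = 0} = N"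
      using degree_jpoly[OF A, where b = B and n = N] rsquarefree_card_degree[of ?P] by simp
    have "{z. poly ?P z = 0} = of_real ` {x. poly (jpoly a b (Suc N)) x = 0}"
      using real ofr[where n = "Suc N"] by (force elim!: Reals_cases)
    then show ?thesis using c by (simp add: card_image inj_on_def)
  qed simp
qed

unbundle no vec_syntax

section \<open>Spectral decomposition of a finite Jacobi block\<close>

locale jacobi_truncation =
  fixes N :: nat and a b :: "nat \<Rightarrow> real"
  assumes N: "N \<ge> 1" and a: "\<And>n. 1 \<le> n \<Longrightarrow> n < N \<Longrightarrow> a n > 0"
begin

definition a' :: "nat \<Rightarrow> real" where "a' n = (if 1 \<le> n \<and> n < N then a n else 1)"

definition p :: "real \<Rightarrow> nat \<Rightarrow> real" where "p x n = poly (jpoly a' b n) x"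

definition ev :: "real set" where "ev = {x. p x (Suc N) = 0}"

text \<open>The Christoffel number at \<open>x\<close>; at an eigenvalue it is the mass of the
  spectral measure.\<close>

definition wt :: "real \<Rightarrow> real" where "wt x = 1 / (\<Sum>n=1..N. (p x n)\<^sup>2)"

text \<open>The spectral transform: on \<open>ev\<close> it turns the block into multiplication by
  \<open>x\<close>.\<close>

definition hat :: "(nat \<Rightarrow> real) \<Rightarrow> real \<Rightarrow> real" where "hat \<phi> x = (\<Sum>n=1..N. \<phi> n * p x n)"

lemma a': "a' n \<noteq> 0"
  using a[of n] by (auto simp: a'_def)

lemma p_0 [simp]: "p x 0 = 0" and p_1 [simp]: "p x (Suc 0) = 1"
  by (simp_all add: p_def)

lemma jac_p: "jac a' b (p x) n = x * p x n"
  unfolding p_def by (rule jac_jpoly) (rule a')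

lemma card_ev: "card ev = N"
  unfolding ev_def p_def by (rule jpoly_real_roots) (rule a')

lemma finite_ev: "finite ev"
  using card_ev N by (metis card.infinite not_one_le_zero)

lemma norm_p_pos: "(\<Sum>n=1..N. (p x n)\<^sup>2) > 0"
  using N by (intro sum_pos2[of _ 1]) auto

lemma wt_pos: "wt x > 0"
  using norm_p_pos by (simp add: wt_def)

lemma sum_atLeast1: "f 0 = 0 \<Longrightarrow> (\<Sum>n<Suc N. f n) = (\<Sum>n=1..N. f n)" for f :: "nat \<Rightarrow> real"
  by (simp add: sum.lessThan_Suc_shift sum.atLeast1_atMost_eq lessThan_Suc_atMost[symmetric] del: sum.lessThan_Suc)

lemma p_orthogonal:
  assumes "x \<in> ev" "y \<in> ev" "x \<noteq> y"
  shows "(\<Sum>n=1..N. p x n * p y n) = 0"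
proof -
  have "(\<Sum>n<Suc N. jac a' b (p x) n * p y n - p x n * jac a' b (p y) n) = 0"
    using assms by (subst jac_green) (auto simp: ev_def)
  then have "(x - y) * (\<Sum>n<Suc N. p x n * p y n) = 0"
    by (simp only: jac_p sum_distrib_left) (simp add: algebra_simps)
  moreover have "(\<Sum>n<Suc N. p x n * p y n) = (\<Sum>n=1..N. p x n * p y n)"
    by (rule sum_atLeast1) simp
  ultimately show ?thesis using assms(3) by simp
qed

text \<open>The matrix with rows \<open>sqrt (wt x) * p x n\<close>, for \<open>x\<close> in
  \<open>ev\<close>, is square by \<open>card_ev\<close> and has orthonormal rows; so its columns
  are orthonormal as well.\<close>

lemma sum_ev_p:
  assumes "1 \<le> m" "m \<le> N" "1 \<le> n" "n \<le> N"
  shows "(\<Sum>x\<in>ev. wt x * p x m * p x n) = (if m = n then 1 else 0)"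
proof -
  obtain e where e: "bij_betw e {..<N} ev"
    using finite_ev card_ev by (metis bij_betw_from_nat_into_finite)
  define U where "U = Matrix.mat N N (\<lambda>(i, j). sqrt (wt (e i)) * p (e i) (Suc j))"
  have U: "U \<in> carrier_mat N N" "transpose_mat U \<in> carrier_mat N N" by (auto simp: U_def)
  have "U * transpose_mat U = 1\<^sub>m N"
  proof (rule eq_matI)
    fix i j assume ij: "i < dim_row (1\<^sub>m N)" "j < dim_col (1\<^sub>m N)"
    have "(U * transpose_mat U) $$ (i, j) =
        (\<Sum>k<N. sqrt (wt (e i)) * p (e i) (Suc k) * (sqrt (wt (e j)) * p (e j) (Suc k)))"
      using ij by (simp add: U_def scalar_prod_def lessThan_atLeast0)
    also have "\<dots> = sqrt (wt (e i)) * sqrt (wt (e j)) * (\<Sum>k<N. p (e i) (Suc k) * p (e j) (Suc k))"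
      by (simp add: sum_distrib_left mult_ac)
    also have "(\<Sum>k<N. p (e i) (Suc k) * p (e j) (Suc k)) = (\<Sum>n=1..N. p (e i) n * p (e j) n)"
      by (simp add: sum.atLeast1_atMost_eq)
    also have "sqrt (wt (e i)) * sqrt (wt (e j)) * \<dots> = 1\<^sub>m N $$ (i, j)"
    proof (cases "i = j")
      case True
      then show ?thesis using ij wt_pos[of "e i"] norm_p_pos[of "e i"]
        by (simp add: wt_def power2_eq_square[symmetric])
    next
      case False
      then have "e i \<noteq> e j" "e i \<in> ev" "e j \<in> ev"
        using ij e by (auto simp: bij_betw_def inj_on_def)
      then show ?thesis using p_orthogonal[of "e i" "e j"] False ij by simp
    qed
    finally show "(U * transpose_mat U) $$ (i, j) = 1\<^sub>m N $$ (i, j)" .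
  qed (auto simp: U_def)
  then have "transpose_mat U * U = 1\<^sub>m N"
    using U by (metis mat_mult_left_right_inverse)
  then have "(transpose_mat U * U) $$ (m - 1, n - 1) = 1\<^sub>m N $$ (m - 1, n - 1)" by simp
  moreover have "(transpose_mat U * U) $$ (m - 1, n - 1) =
      (\<Sum>k<N. sqrt (wt (e k)) * p (e k) m * (sqrt (wt (e k)) * p (e k) n))"
    using assms by (simp add: U_def scalar_prod_def lessThan_atLeast0)
  moreover have "\<dots> = (\<Sum>k<N. wt (e k) * p (e k) m * p (e k) n)"
  proof (rule sum.cong)
    fix k
    have "sqrt (wt (e k)) * sqrt (wt (e k)) = wt (e k)" using wt_pos[of "e k"] by simp
    moreover have "sqrt (wt (e k)) * p (e k) m * (sqrt (wt (e k)) * p (e k) n) =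
        (sqrt (wt (e k)) * sqrt (wt (e k))) * p (e k) m * p (e k) n"
      by (simp only: mult_ac)
    ultimately show "sqrt (wt (e k)) * p (e k) m * (sqrt (wt (e k)) * p (e k) n) = wt (e k) * p (e k) m * p (e k) n"
      by (simp only:)
  qed simp
  moreover have "\<dots> = (\<Sum>x\<in>ev. wt x * p x m * p x n)"
    by (rule sum.reindex_bij_betw[OF e])
  moreover have "m - 1 = n - 1 \<longleftrightarrow> m = n" using assms by arith
  ultimately show ?thesis using assms by auto
qed

lemma parseval: "(\<Sum>x\<in>ev. wt x * (hat \<phi> x * hat \<psi> x)) = (\<Sum>n=1..N. \<phi> n * \<psi> n)"
proof -
  have "(\<Sum>x\<in>ev. wt x * (hat \<phi> x * hat \<psi> x)) =
      (\<Sum>x\<in>ev. \<Sum>m=1..N. \<Sum>n=1..N. \<phi> m * \<psi> n * (wt x * p x m * p x n))"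
    unfolding hat_def sum_product by (intro sum.cong refl) (simp add: sum_distrib_left mult_ac)
  also have "\<dots> = (\<Sum>m=1..N. \<Sum>n=1..N. \<phi> m * \<psi> n * (\<Sum>x\<in>ev. wt x * p x m * p x n))"
    by (subst sum.swap, rule sum.cong, rule refl, subst sum.swap) (simp add: sum_distrib_left)
  also have "\<dots> = (\<Sum>m=1..N. \<Sum>n=1..N. \<phi> m * \<psi> n * (if m = n then 1 else 0))"
    by (intro sum.cong refl) (simp only: sum_ev_p atLeastAtMost_iff)
  also have "\<dots> = (\<Sum>n=1..N. \<phi> n * \<psi> n)"
    by (simp add: if_distrib cong: if_cong)
  finally show ?thesis .
qed

text \<open>Up to index \<open>N\<close>, the sequences \<open>a\<close> and \<open>a'\<close> can
  differ only at \<open>0\<close> and \<open>N\<close>, where they multiply \<open>\<phi> 0\<close>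
  and \<open>\<phi> (Suc N)\<close>.\<close>

lemma jac_a'_eq:
  assumes "\<phi> 0 = 0" "\<phi> (Suc N) = 0" "n \<le> N"
  shows "jac a' b \<phi> n = jac a b \<phi> n"
proof (cases n)
  case (Suc m)
  have "a' m * \<phi> m = a m * \<phi> m" using assms(1,3) Suc by (cases m) (auto simp: a'_def)
  moreover have "a' n * \<phi> (Suc n) = a n * \<phi> (Suc n)"
    using assms Suc by (cases "n = N") (auto simp: a'_def)
  ultimately show ?thesis by (simp only: Suc jac_Suc)
qed simp

text \<open>Both \<open>\<phi>\<close> and \<open>p x\<close> vanish at \<open>N + 1\<close>, so
  Green's formula has no boundary term.\<close>

lemma hat_jac:
  assumes "x \<in> ev" and \<phi>: "\<phi> 0 = 0" "\<phi> (Suc N) = 0"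
  shows "hat (jac a b \<phi>) x = x * hat \<phi> x"
proof -
  have "(\<Sum>n<Suc N. jac a' b \<phi> n * p x n - \<phi> n * jac a' b (p x) n) = 0"
    using assms by (subst jac_green) (auto simp: ev_def)
  then have "(\<Sum>n<Suc N. jac a' b \<phi> n * p x n) = x * (\<Sum>n<Suc N. \<phi> n * p x n)"
    by (simp only: jac_p sum_distrib_left sum_subtractf) (simp add: mult_ac)
  then have "(\<Sum>n=1..N. jac a' b \<phi> n * p x n) = x * hat \<phi> x"
    by (simp add: sum_atLeast1 hat_def del: sum.lessThan_Suc)
  moreover have "hat (jac a b \<phi>) x = (\<Sum>n=1..N. jac a' b \<phi> n * p x n)"
    unfolding hat_def using jac_a'_eq[of \<phi>] \<phi> by (intro sum.cong) auto
  ultimately show ?thesis by simp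
qed

lemma hat_e1: "hat (\<lambda>n. if n = 1 then 1 else 0) x = 1"
  using N by (simp add: hat_def if_distrib[of "\<lambda>c. c * _"] cong: if_cong)

lemma mult_block_vec:
  assumes "v \<in> carrier_vec N" "i < N"
  shows "(jacobi_block N a b *\<^sub>v v) $ i = jac a b (\<lambda>n. if 1 \<le> n \<and> n \<le> N then v $ (n - 1) else 0) (Suc i)"
proof -
  let ?\<phi> = "\<lambda>n. if 1 \<le> n \<and> n \<le> N then v $ (n - 1) else 0"
  have "(jacobi_block N a b *\<^sub>v v) $ i = (\<Sum>j<N. jacobi_entry a b (Suc i) (Suc j) * v $ j)"
    using assms by (simp add: jacobi_block_def scalar_prod_def lessThan_atLeast0)
  also have "\<dots> = (\<Sum>j<N. jacobi_entry a b (Suc i) (Suc j) * ?\<phi> (Suc j))"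
    by (intro sum.cong) auto
  also have "\<dots> = (\<Sum>n\<in>{1..N}. jacobi_entry a b (Suc i) n * ?\<phi> n)"
    by (simp only: sum.atLeast1_atMost_eq One_nat_def)
  also have "\<dots> = jac a b ?\<phi> (Suc i)"
    by (rule sum_jacobi_entry[where 'a = real, simplified of_real_eq_id id_apply]) auto
  finally show ?thesis .
qed

text \<open>The rows of the eigenvalue equation are the recurrence for \<open>p x\<close>, the last
  one being the condition that the solution vanishes at \<open>N + 1\<close>. The first component
  determines all others, so it cannot be zero.\<close>

lemma eigenvector_block_iff:
  "eigenvector (jacobi_block N a b) v x \<longleftrightarrow>
    x \<in> ev \<and> v \<in> carrier_vec N \<and> v $ 0 \<noteq> 0 \<and> (\<forall>i<N. v $ i = v $ 0 * p x (Suc i))"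
proof
  let ?J = "jacobi_block N a b"
  let ?\<phi> = "\<lambda>v n. if 1 \<le> n \<and> n \<le> N then v $ (n - 1) else 0 :: real"
  {
    assume "eigenvector ?J v x"
    then have v: "v \<in> carrier_vec N" "v \<noteq> 0\<^sub>v N" "?J *\<^sub>v v = x \<cdot>\<^sub>v v"
      by (auto simp: eigenvector_def jacobi_block_def)
    have rec: "jac a' b (?\<phi> v) (Suc i) = x * ?\<phi> v (Suc i)" if "i < N" for i
    proof -
      have "jac a b (?\<phi> v) (Suc i) = (?J *\<^sub>v v) $ i" using mult_block_vec[OF v(1) that] by simp
      also have "\<dots> = x * v $ i" using v that by (simp only: v(3)) simp
      finally show ?thesis using that by (subst jac_a'_eq) auto
    qed
    have eq: "?\<phi> v n = v $ 0 * p x n \<and> ?\<phi> v (Suc n) = v $ 0 * p x (Suc n)" if "n \<le> N" for n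
      using that
    proof (induction n)
      case 0
      then show ?case using N by simp
    next
      case (Suc n)
      have "a' (Suc n) * ?\<phi> v (Suc (Suc n)) = x * ?\<phi> v (Suc n) - b (Suc n) * ?\<phi> v (Suc n) - a' n * ?\<phi> v n"
        using rec[of n] Suc.prems by (simp add: jac_Suc)
      also have "\<dots> = v $ 0 * (x * p x (Suc n) - b (Suc n) * p x (Suc n) - a' n * p x n)"
        using Suc by (simp add: algebra_simps)
      also have "\<dots> = v $ 0 * (a' (Suc n) * p x (Suc (Suc n)))"
        using jac_p[of x "Suc n"] by (simp add: jac_Suc)
      finally have "a' (Suc n) * ?\<phi> v (Suc (Suc n)) = a' (Suc n) * (v $ 0 * p x (Suc (Suc n)))" by simp
      then have "?\<phi> v (Suc (Suc n)) = v $ 0 * p x (Suc (Suc n))" using a'[of "Suc n"] by simp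
      with Suc show ?case by simp
    qed
    have vi: "v $ i = v $ 0 * p x (Suc i)" if "i < N" for i using eq[of i] that by simp
    have v0: "v $ 0 \<noteq> 0"
    proof
      assume "v $ 0 = 0"
      then have "v = 0\<^sub>v N" using vi v(1) by (intro eq_vecI) auto
      with v(2) show False by simp
    qed
    have "x \<in> ev" using eq[of N] v0 by (simp add: ev_def)
    then show "x \<in> ev \<and> v \<in> carrier_vec N \<and> v $ 0 \<noteq> 0 \<and> (\<forall>i<N. v $ i = v $ 0 * p x (Suc i))"
      using v v0 vi by blast
  next
    assume *: "x \<in> ev \<and> v \<in> carrier_vec N \<and> v $ 0 \<noteq> 0 \<and> (\<forall>i<N. v $ i = v $ 0 * p x (Suc i))"
    define c where "c = v $ 0"
    have vi: "v $ i = c * p x (Suc i)" if "i < N" for i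
      using * that unfolding c_def by blast
    have xev: "x \<in> ev" and vc: "v \<in> carrier_vec N" and c: "c \<noteq> 0" using * unfolding c_def by blast+
    have \<phi>: "?\<phi> v n = c * p x n" if "n \<le> Suc N" for n
      using that xev vi[of "n - 1"] by (cases n) (auto simp: ev_def le_Suc_eq)
    have "?J *\<^sub>v v = x \<cdot>\<^sub>v v"
    proof (rule eq_vecI)
      fix i assume "i < dim_vec (x \<cdot>\<^sub>v v)"
      then have i: "i < N" using vc by auto
      have "(?J *\<^sub>v v) $ i = jac a b (?\<phi> v) (Suc i)"
        using mult_block_vec[OF vc i] .
      also have "\<dots> = jac a' b (?\<phi> v) (Suc i)"
        using i by (subst jac_a'_eq) auto
      also have "\<dots> = c * jac a' b (p x) (Suc i)"
      proof -
        have "i \<le> Suc N" "Suc i \<le> Suc N" "Suc (Suc i) \<le> Suc N" using i by auto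
        note this[THEN \<phi>]
        then show ?thesis unfolding jac_Suc by (simp only: distrib_left mult.left_commute)
      qed
      also have "\<dots> = (x \<cdot>\<^sub>v v) $ i" using i vc by (simp add: jac_p vi)
      finally show "(?J *\<^sub>v v) $ i = (x \<cdot>\<^sub>v v) $ i" .
    qed (use vc in \<open>auto simp: jacobi_block_def\<close>)
    moreover have "v \<noteq> 0\<^sub>v N" using c N by (auto simp: c_def)
    ultimately show "eigenvector ?J v x"
      using vc by (auto simp: eigenvector_def jacobi_block_def)
  }
qed

lemma eigenvalue_block: "{x. eigenvalue (jacobi_block N a b) x} = ev"
proof -
  have "eigenvector (jacobi_block N a b) (Matrix.vec N (\<lambda>i. p x (Suc i))) x" if "x \<in> ev" for x
    using that N by (auto simp: eigenvector_block_iff)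
  then show ?thesis unfolding eigenvalue_def using eigenvector_block_iff by blast
qed

lemma normalized_eigenvector_block:
  assumes "x \<in> ev"
  shows "normalized_eigenvector (jacobi_block N a b) x = Matrix.vec N (\<lambda>i. p x (Suc i))"
  unfolding normalized_eigenvector_def
proof (rule the_equality)
  show "eigenvector (jacobi_block N a b) (Matrix.vec N (\<lambda>i. p x (Suc i))) x \<and> Matrix.vec N (\<lambda>i. p x (Suc i)) $ 0 = 1"
    using assms N by (auto simp: eigenvector_block_iff)
  show "v = Matrix.vec N (\<lambda>i. p x (Suc i))" if "eigenvector (jacobi_block N a b) v x \<and> v $ 0 = 1" for v
    using that by (intro eq_vecI) (auto simp: eigenvector_block_iff)
qed

lemma integral_block_spectral_measure:
  fixes g :: "real \<Rightarrow> real"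
  assumes g: "g \<in> borel_measurable borel"
  shows "(LINT x|block_spectral_measure (jacobi_block N a b). g x) = (\<Sum>x\<in>ev. wt x * g x)"
proof -
  let ?w = "\<lambda>x. 1 / scalar_prod (normalized_eigenvector (jacobi_block N a b) x) (normalized_eigenvector (jacobi_block N a b) x)"
  have w: "?w x = wt x" if "x \<in> ev" for x
    unfolding normalized_eigenvector_block[OF that] wt_def
    by (simp add: scalar_prod_def sum.atLeast1_atMost_eq lessThan_atLeast0 power2_eq_square)
  have "(LINT x|block_spectral_measure (jacobi_block N a b). g x) = (LINT x|point_measure ev (\<lambda>x. ennreal (?w x)). g x)"
    unfolding block_spectral_measure_def eigenvalue_block
    by (rule integral_distr) (use g in auto)
  also have "\<dots> = (LINT x|point_measure ev (\<lambda>x. ennreal (wt x)). g x)"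
    by (intro arg_cong2[where f = "integral\<^sup>L"] refl)
      (auto simp: point_measure_def w intro!: density_cong AE_I2)
  also have "\<dots> = (\<Sum>x\<in>ev. wt x * g x)"
    using wt_pos finite_ev by (subst lebesgue_integral_point_measure_finite) (auto intro: less_imp_le)
  finally show ?thesis .
qed

end

section \<open>Moments through the vectors \<open>J\<^sup>k e\<^sub>1\<close>\<close>

fun jmom :: "(nat \<Rightarrow> real) \<Rightarrow> (nat \<Rightarrow> real) \<Rightarrow> nat \<Rightarrow> nat \<Rightarrow> real" where
  "jmom a b 0 = (\<lambda>n. if n = 1 then 1 else 0)"
| "jmom a b (Suc k) = jac a b (jmom a b k)"

lemma jmom_0 [simp]: "jmom a b k 0 = 0"
  by (cases k) auto

lemma jmom_outside:
  assumes "N \<ge> 1" "a N = 0" "n > N"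
  shows "jmom a b k n = 0"
  using assms(3)
proof (induction k arbitrary: n)
  case 0
  then show ?case using assms by simp
next
  case (Suc k)
  then obtain m where n: "n = Suc m" "m \<ge> N" by (cases n) auto
  have "a m * jmom a b k m = 0" using assms n Suc.IH[of m] by (cases "m = N") auto
  then show ?case using n Suc.IH[of n] Suc.IH[of "Suc n"] by (simp add: jac_Suc)
qed

text \<open>One application reaches one index further, so \<open>k\<close> applications read at
  \<open>n\<close> involve only entries with index below \<open>n + k\<close>. Hence each moment of
  the truncations is eventually constant in \<open>N\<close>.\<close>

lemma jmom_cong:
  assumes "\<And>m. 1 \<le> m \<Longrightarrow> m < K \<Longrightarrow> a m = a' m" "\<And>m. 1 \<le> m \<Longrightarrow> m < K \<Longrightarrow> b m = b' m"
    and "n + k \<le> K"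
  shows "jmom a b k n = jmom a' b' k n"
  using assms(3)
proof (induction k arbitrary: n)
  case (Suc k)
  show ?case
  proof (cases n)
    case (Suc m)
    have "a m * jmom a b k m = a' m * jmom a' b' k m"
      using Suc.IH[of m] Suc.prems Suc assms(1)[of m] by (cases "m = 0") auto
    then show ?thesis
      using Suc.IH[of n] Suc.IH[of "Suc n"] Suc.prems Suc assms(1,2)[of n] by (simp add: jac_Suc)
  qed simp
qed simp

context jacobi_truncation
begin

text \<open>With \<open>a N = 0\<close> the iterates of \<open>e\<^sub>1\<close> stay inside the
  block, so \<open>hat\<close> maps them to the powers of \<open>x\<close>.\<close>

lemma moment_block:
  assumes "a N = 0"
  shows "(\<Sum>x\<in>ev. wt x * x ^ k) = jmom a b k 1"
proof -
  have hat: "hat (jmom a b k) x = x ^ k" if "x \<in> ev" for k x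
  proof (induction k)
    case 0
    then show ?case using hat_e1 by simp
  next
    case (Suc k)
    then show ?case using that hat_jac[of x "jmom a b k"] jmom_outside[of N a "Suc N" b k] assms N by simp
  qed
  have "(\<Sum>x\<in>ev. wt x * x ^ k) = (\<Sum>x\<in>ev. wt x * (hat (jmom a b k) x * hat (jmom a b 0) x))"
    by (intro sum.cong) (auto simp only: hat power_0 mult_1_right)
  also have "\<dots> = (\<Sum>n=1..N. jmom a b k n * jmom a b 0 n)" by (rule parseval)
  also have "\<dots> = jmom a b k 1" using N by (simp add: if_distrib cong: if_cong)
  finally show ?thesis .
qed

end

section \<open>Moments along the Toda flow\<close>

lemma zero_deriv_within_atLeast_const:
  fixes f :: "real \<Rightarrow> real"
  assumes "\<And>t. t \<ge> 0 \<Longrightarrow> (f has_real_derivative 0) (at t within {0..})" "t \<ge> 0"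
  shows "f t = f 0"
proof -
  have "\<exists>c. \<forall>x\<in>{0..}. f x = c"
    by (rule has_field_derivative_zero_constant) (use assms in auto)
  then show ?thesis using assms(2) by auto
qed

lemma ex_antiderivative_atLeast:
  fixes f :: "real \<Rightarrow> real"
  assumes f: "continuous_on {0..} f"
  shows "\<exists>F. F 0 = 0 \<and> (\<forall>t\<ge>0. (F has_real_derivative f t) (at t within {0..}))"
proof -
  let ?F = "\<lambda>t. integral {0..t} f"
  have "(?F has_real_derivative f t) (at t within {0..})" if "t \<ge> 0" for t
  proof -
    \<comment> \<open>An interval reaching beyond \<open>t\<close> has the same relative
      neighbourhoods of \<open>t\<close> as the half-line, also for \<open>t = 0\<close>.\<close>
    have "continuous_on {0..t + 1} f" using f by (rule continuous_on_subset) auto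
    then have "(?F has_real_derivative f t) (at t within {0..t + 1})"
      using that by (intro integral_has_real_derivative) auto
    moreover have "at t within {0..t + 1} = at t within {0..}"
      using that by (intro at_within_nhd[where S = "{..<t + 1}"]) auto
    ultimately show ?thesis by simp
  qed
  then show ?thesis by (intro exI[of _ ?F]) auto
qed

text \<open>With the integrating factor \<open>exp (- C t)\<close> the solution becomes
  constant.\<close>

lemma linear_ode_sgn:
  fixes x c :: "real \<Rightarrow> real"
  assumes c: "continuous_on {0..} c"
    and x: "\<And>t. t \<ge> 0 \<Longrightarrow> (x has_real_derivative x t * c t) (at t within {0..})"
    and "x 0 > 0" "t \<ge> 0"
  shows "x t > 0"
proof -
  obtain C where C: "C 0 = 0" "\<And>t. t \<ge> 0 \<Longrightarrow> (C has_real_derivative c t) (at t within {0..})"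
    using ex_antiderivative_atLeast[OF c] by auto
  have "((\<lambda>t. x t * exp (- C t)) has_real_derivative 0) (at t within {0..})" if "t \<ge> 0" for t
    using x[OF that] C(2)[OF that] by (auto intro!: derivative_eq_intros simp: algebra_simps)
  then have "x t * exp (- C t) = x 0"
    using zero_deriv_within_atLeast_const[of "\<lambda>t. x t * exp (- C t)" t] \<open>t \<ge> 0\<close> C(1) by auto
  then show ?thesis using \<open>x 0 > 0\<close> by (metis exp_gt_zero zero_less_mult_pos2)
qed

text \<open>Iterating \<open>D\<^sub>k(t) = 2 \<integral>\<^sub>0\<^sup>t D\<^sub>k\<^sub>+\<^sub>1\<close> \<open>j\<close> times gives \<open>\<bar>D\<^sub>k(t)\<bar> \<le> K C\<^sup>k (2 C t)\<^sup>j / j!\<close>.\<close>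

lemma derivative_chain_zero:
  fixes D :: "nat \<Rightarrow> real \<Rightarrow> real"
  assumes D: "\<And>k t. t \<ge> 0 \<Longrightarrow> (D k has_real_derivative 2 * D (Suc k) t) (at t within {0..})"
    and D0: "\<And>k. D k 0 = 0"
    and bound: "\<And>k t. 0 \<le> t \<Longrightarrow> t \<le> T \<Longrightarrow> \<bar>D k t\<bar> \<le> K * C ^ k"
    and "C \<ge> 0" "0 \<le> t" "t \<le> T"
  shows "D k t = 0"
proof -
  have step: "\<bar>D k t\<bar> \<le> K * C ^ k * ((2 * C * t) ^ j / fact j)" if "0 \<le> t" "t \<le> T" for j k t
    using that
  proof (induction j arbitrary: k t)
    case 0
    then show ?case using bound by simp
  next
    case (Suc j)
    define g where "g s = K * C ^ k * ((2 * C * s) ^ Suc j / fact (Suc j))" for s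
    have g: "(g has_real_derivative 2 * (K * C ^ Suc k * ((2 * C * s) ^ j / fact j))) (at s)" for s
    proof -
      have "(g has_real_derivative K * C ^ k * (real (Suc j) * (2 * C) * (2 * C * s) ^ j / fact (Suc j))) (at s)"
        unfolding g_def by (rule derivative_eq_intros refl | simp)+
      also have "K * C ^ k * (real (Suc j) * (2 * C) * (2 * C * s) ^ j / fact (Suc j)) =
          2 * (K * C ^ Suc k * ((2 * C * s) ^ j / fact j))"
        by (simp add: field_simps del: of_nat_Suc)
      finally show ?thesis .
    qed
    have cont: "continuous_on {0..t} (D k)"
      unfolding continuous_on_eq_continuous_within
    proof
      fix s assume "s \<in> {0..t}"
      then have "continuous (at s within {0..}) (D k)" using D[of s k] by (intro DERIV_continuous) auto
      then show "continuous (at s within {0..t}) (D k)" by (rule continuous_within_subset) auto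
    qed
    have der: "(D k has_real_derivative 2 * D (Suc k) s) (at s)" if "0 < s" for s
    proof -
      have "(D k has_real_derivative 2 * D (Suc k) s) (at s within {0..})" using D that by simp
      moreover have "at s within {0..} = at s" using that by (intro at_within_interior) auto
      ultimately show ?thesis by simp
    qed
    have gcont: "continuous_on {0..t} g"
      using g by (meson DERIV_continuous_on has_field_derivative_at_within)
    have "g 0 = 0" by (simp add: g_def)
    \<comment> \<open>The induction hypothesis bounds \<open>\<bar>D (Suc k) s\<bar>\<close> by half
      the derivative of \<open>g\<close>, so \<open>g - D k\<close> and \<open>g + D k\<close> both
      increase from \<open>0\<close>.\<close>
    have "(g 0 - D k 0) \<le> (g t - D k t)"
    proof (rule DERIV_nonneg_imp_increasing_open[of 0 t "\<lambda>s. g s - D k s"])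
      show "continuous_on {0..t} (\<lambda>s. g s - D k s)"
        using gcont cont by (rule continuous_on_diff)
      fix s assume s: "0 < s" "s < t"
      have "\<bar>D (Suc k) s\<bar> \<le> K * C ^ Suc k * ((2 * C * s) ^ j / fact j)"
        using Suc.IH[of s "Suc k"] s Suc.prems by simp
      then show "\<exists>y. ((\<lambda>s. g s - D k s) has_real_derivative y) (at s) \<and> 0 \<le> y"
        using DERIV_diff[OF g[of s] der[OF s(1)]] by (intro exI conjI) auto
    qed (use Suc.prems in auto)
    moreover have "(g 0 + D k 0) \<le> (g t + D k t)"
    proof (rule DERIV_nonneg_imp_increasing_open[of 0 t "\<lambda>s. g s + D k s"])
      show "continuous_on {0..t} (\<lambda>s. g s + D k s)"
        using gcont cont by (rule continuous_on_add)
      fix s assume s: "0 < s" "s < t"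
      have "\<bar>D (Suc k) s\<bar> \<le> K * C ^ Suc k * ((2 * C * s) ^ j / fact j)"
        using Suc.IH[of s "Suc k"] s Suc.prems by simp
      then show "\<exists>y. ((\<lambda>s. g s + D k s) has_real_derivative y) (at s) \<and> 0 \<le> y"
        using DERIV_add[OF g[of s] der[OF s(1)]] by (intro exI conjI) auto
    qed (use Suc.prems in auto)
    ultimately show ?case using D0 \<open>g 0 = 0\<close> by (simp add: g_def abs_le_iff)
  qed
  have "(\<lambda>j. (2 * C * t) ^ j / fact j) \<longlonglongrightarrow> 0"
    using summable_LIMSEQ_zero[OF summable_exp, of "2 * C * t"] by (simp add: field_simps)
  then have "(\<lambda>j. K * C ^ k * ((2 * C * t) ^ j / fact j)) \<longlonglongrightarrow> K * C ^ k * 0"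
    by (intro tendsto_mult tendsto_const)
  then have "\<bar>D k t\<bar> \<le> K * C ^ k * 0"
    by (rule tendsto_lowerbound) (use step assms in auto)
  then show ?thesis by simp
qed

text \<open>Three summands per row, each with a coefficient of size at most \<open>K\<close>,
  account for the factor \<open>3 * K\<close>.\<close>

lemma abs_jmom_le:
  assumes "\<And>n. n \<le> N \<Longrightarrow> \<bar>a n\<bar> \<le> K" "\<And>n. 1 \<le> n \<Longrightarrow> n \<le> N \<Longrightarrow> \<bar>b n\<bar> \<le> K" "a N = 0" "N \<ge> 1" "K \<ge> 0"
  shows "\<bar>jmom a b k n\<bar> \<le> (3 * K) ^ k"
proof (induction k arbitrary: n)
  case 0
  then show ?case by simp
next
  case (Suc k)
  have nn: "0 \<le> (3 * K) ^ k" using \<open>K \<ge> 0\<close> by simp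
  show ?case
  proof (cases "1 \<le> n \<and> n \<le> N")
    case True
    then obtain m where n: "n = Suc m" by (cases n) auto
    have "\<bar>a m * jmom a b k m\<bar> \<le> K * (3 * K) ^ k"
      "\<bar>b n * jmom a b k n\<bar> \<le> K * (3 * K) ^ k"
      "\<bar>a n * jmom a b k (Suc n)\<bar> \<le> K * (3 * K) ^ k"
      unfolding abs_mult using Suc.IH True n assms nn by (auto intro!: mult_mono)
    then have "\<bar>jmom a b (Suc k) n\<bar> \<le> 3 * (K * (3 * K) ^ k)"
      unfolding n jmom.simps jac_Suc by linarith
    then show ?thesis by simp
  next
    case False
    then have "jmom a b (Suc k) n = 0"
      using jmom_outside[of N a n b "Suc k"] assms by (cases "n = 0") (auto simp del: jmom.simps)
    moreover have "0 \<le> (3 * K) ^ Suc k" using \<open>K \<ge> 0\<close> by simp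
    ultimately show ?thesis by (simp del: jmom.simps)
  qed
qed

text \<open>This is the Lax equation \<open>J' = B J - J B\<close> with \<open>(B f)\<^sub>n =
  a\<^sub>n f\<^sub>n\<^sub>+\<^sub>1 - a\<^sub>n\<^sub>-\<^sub>1 f\<^sub>n\<^sub>-\<^sub>1\<close>.
  Since \<open>B e\<^sub>1 = b\<^sub>1 e\<^sub>1 - J e\<^sub>1\<close>, the derivative of
  \<open>J\<^sup>k e\<^sub>1\<close> is \<open>B J\<^sup>k e\<^sub>1 + J\<^sup>k\<^sup>+\<^sup>1
  e\<^sub>1 - b\<^sub>1 J\<^sup>k e\<^sub>1\<close>. The induction verifies this in
  coordinates.\<close>

lemma toda_jmom_derivative:
  assumes toda: "finite_toda N a0 b0 a b" and t: "t \<ge> 0" and n: "1 \<le> n" "n \<le> N"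
  defines "w \<equiv> \<lambda>s. jmom (\<lambda>n. a n s) (\<lambda>n. b n s)"
  shows "((\<lambda>s. w s k n) has_real_derivative
    a n t * w t k (Suc n) - a (n - 1) t * w t k (n - 1) + w t (Suc k) n - b 1 t * w t k n) (at t within {0..})"
  using n
proof (induction k arbitrary: n)
  case 0
  have a0: "a 0 t = 0" using toda t by (simp add: finite_toda_def)
  have "n = 1 \<or> n = 2 \<or> n > 2" using 0 by linarith
  then show ?case using a0 by (auto simp: w_def jac_def numeral_2_eq_2)
next
  case (Suc k)
  have N: "N \<ge> 1" using Suc.prems by simp
  have out: "w s j n = 0" if "n > N" "s \<ge> 0" for s j n
    unfolding w_def using that toda N by (intro jmom_outside[of N]) (auto simp: finite_toda_def)
  have w0: "w s j 0 = 0" for s j by (simp add: w_def)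
  let ?F = "at t within {0..}"
  have ev: "\<forall>\<^sub>F s in ?F. s \<ge> 0" by (auto simp: eventually_at_filter)
  \<comment> \<open>The lattice has no differential equation for the two boundary entries; vanishing
    on the half-line, they satisfy the same formula with both sides zero.\<close>
  have za: "(a i has_real_derivative 0) ?F" "a i t = 0" if "i = 0 \<or> i = N" for i
  proof -
    have z: "a i s = 0" if "s \<ge> 0" for s using toda that \<open>i = 0 \<or> i = N\<close> by (auto simp: finite_toda_def)
    then show "a i t = 0" using t by simp
    have "((\<lambda>s. 0) has_real_derivative 0) ?F" by simp
    then show "(a i has_real_derivative 0) ?F"
      using z t by (subst has_field_derivative_cong_eventually[where g = "\<lambda>s. 0"]) (auto simp: eventually_at_filter)
  qed
  have da: "(a i has_real_derivative a i t * (b (i + 1) t - b i t)) ?F" if "i \<le> N" for i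
    using that toda t za[of i] by (cases "i = 0 \<or> i = N") (auto simp: finite_toda_def)
  have db: "(b i has_real_derivative 2 * ((a i t)\<^sup>2 - (a (i - 1) t)\<^sup>2)) ?F" if "1 \<le> i" "i \<le> N" for i
    using that toda t by (auto simp: finite_toda_def)
  define d where "d n = a n t * w t k (Suc n) - a (n - 1) t * w t k (n - 1) + w t (Suc k) n - b 1 t * w t k n" for n
  have nN: "1 \<le> n" "n \<le> N" using Suc.prems by auto
  then obtain m where n: "n = Suc m" by (cases n) auto
  have dw: "((\<lambda>s. w s k i) has_real_derivative d i) ?F" if "1 \<le> i" "i \<le> N" for i
    using Suc.IH[of i] that unfolding d_def by auto
  have 1: "((\<lambda>s. a m s * w s k m) has_real_derivative a m t * (b n t - b m t) * w t k m + a m t * d m) ?F"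
  proof (cases "m = 0")
    case True
    then show ?thesis using za[of 0] by (simp add: w0)
  next
    case False
    then show ?thesis
      using DERIV_mult'[OF da[of m] dw[of m]] False nN n by (simp add: algebra_simps)
  qed
  have 2: "((\<lambda>s. b n s * w s k n) has_real_derivative 2 * ((a n t)\<^sup>2 - (a m t)\<^sup>2) * w t k n + b n t * d n) ?F"
    using DERIV_mult'[OF db[of n] dw[of n]] nN n by (simp add: algebra_simps)
  have 3: "((\<lambda>s. a n s * w s k (Suc n)) has_real_derivative
      a n t * (b (Suc n) t - b n t) * w t k (Suc n) + a n t * d (Suc n)) ?F"
  proof (cases "n = N")
    case True
    have "((\<lambda>s. 0) has_real_derivative 0) ?F" by simp
    then have "((\<lambda>s. a n s * w s k (Suc n)) has_real_derivative 0) ?F"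
      using True out t by (subst has_field_derivative_cong_eventually[where g = "\<lambda>s. 0"])
        (auto simp: eventually_at_filter)
    then show ?thesis using True za[of N] by simp
  next
    case False
    then show ?thesis
      using DERIV_mult'[OF da[of n] dw[of "Suc n"]] False nN by (simp add: algebra_simps)
  qed
  have e: "(\<lambda>s. w s (Suc k) n) = (\<lambda>s. a m s * w s k m + b n s * w s k n + a n s * w s k (Suc n))"
    by (simp add: w_def n jac_Suc)
  have wS: "w t (Suc j) (Suc i) = a i t * w t j i + b (Suc i) t * w t j (Suc i) + a (Suc i) t * w t j (Suc (Suc i))" for j i
    by (simp add: w_def jac_Suc)
  define A where "A = a m t * (b n t - b m t) * w t k m + a m t * d m
    + (2 * ((a n t)\<^sup>2 - (a m t)\<^sup>2) * w t k n + b n t * d n)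
    + (a n t * (b (Suc n) t - b n t) * w t k (Suc n) + a n t * d (Suc n))"
  have "((\<lambda>s. w s (Suc k) n) has_real_derivative A) ?F"
    unfolding e A_def using 1 2 3 by (intro DERIV_add)
  moreover have "A = a n t * w t (Suc k) (Suc n) - a (n - 1) t * w t (Suc k) (n - 1) + w t (Suc (Suc k)) n - b 1 t * w t (Suc k) n"
  proof (cases m)
    case 0
    have "a m t = 0" using za[of 0] 0 by simp
    then show ?thesis
      unfolding A_def d_def n by (simp add: wS w0 0 power2_eq_square algebra_simps)
  next
    case (Suc l)
    show ?thesis
      unfolding A_def d_def n Suc by (simp add: wS power2_eq_square algebra_simps)
  qed
  ultimately show ?case by simp
qed

lemma finite_toda_continuous:
  assumes "finite_toda N a0 b0 a b"
  shows "n \<le> N \<Longrightarrow> continuous_on {0..} (a n)" "1 \<le> n \<Longrightarrow> n \<le> N \<Longrightarrow> continuous_on {0..} (b n)"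
proof -
  show "continuous_on {0..} (a n)" if "n \<le> N"
  proof (cases "n = 0 \<or> n = N")
    case True
    then have "a n t = 0" if "t \<in> {0..}" for t using assms that by (auto simp: finite_toda_def)
    then show ?thesis
      using continuous_on_eq[OF continuous_on_const, of "{0..}" 0 "a n"] by auto
  next
    case False
    then show ?thesis
      using assms that by (intro DERIV_continuous_on[of _ _ "\<lambda>t. a n t * (b (n + 1) t - b n t)"])
        (auto simp: finite_toda_def)
  qed
  show "continuous_on {0..} (b n)" if "1 \<le> n" "n \<le> N"
    using assms that by (intro DERIV_continuous_on[of _ _ "\<lambda>t. 2 * ((a n t)\<^sup>2 - (a (n - 1) t)\<^sup>2)"])
      (auto simp: finite_toda_def)
qed

lemma finite_toda_pos:
  assumes toda: "finite_toda N a0 b0 a b" and a0: "\<And>n. 1 \<le> n \<Longrightarrow> n < N \<Longrightarrow> a0 n > 0"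
    and n: "1 \<le> n" "n < N" and t: "t \<ge> 0"
  shows "a n t > 0"
proof (rule linear_ode_sgn[where x = "a n" and c = "\<lambda>t. b (n + 1) t - b n t"])
  show "continuous_on {0..} (\<lambda>t. b (n + 1) t - b n t)"
    using n by (intro continuous_on_diff finite_toda_continuous[OF toda]) auto
qed (use assms in \<open>auto simp: finite_toda_def\<close>)

lemma finite_toda_bounded:
  assumes toda: "finite_toda N a0 b0 a b"
  shows "\<exists>K\<ge>0. \<forall>t\<in>{0..T}. \<forall>n\<le>N. \<bar>a n t\<bar> \<le> K \<and> (1 \<le> n \<longrightarrow> \<bar>b n t\<bar> \<le> K)"
proof -
  have bd: "\<exists>K. \<forall>t\<in>{0..T}. \<bar>f t\<bar> \<le> K" if "continuous_on {0..} f" for f :: "real \<Rightarrow> real"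
  proof -
    have "compact (f ` {0..T})"
      using that by (intro compact_continuous_image compact_Icc) (auto intro: continuous_on_subset)
    then show ?thesis
      using compact_imp_bounded bounded_iff[of "f ` {0..T}"] by auto
  qed
  have "\<exists>K. n \<le> N \<longrightarrow> (\<forall>t\<in>{0..T}. \<bar>a n t\<bar> \<le> K \<and> (1 \<le> n \<longrightarrow> \<bar>b n t\<bar> \<le> K))" for n
  proof (cases "n \<le> N")
    case True
    obtain K1 where K1: "\<forall>t\<in>{0..T}. \<bar>a n t\<bar> \<le> K1"
      using bd finite_toda_continuous(1)[OF toda True] by blast
    show ?thesis
    proof (cases "1 \<le> n")
      case n: True
      obtain K2 where "\<forall>t\<in>{0..T}. \<bar>b n t\<bar> \<le> K2"
        using bd finite_toda_continuous(2)[OF toda n True] by blast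
      then show ?thesis using K1 by (intro exI[of _ "max K1 K2"]) (auto simp: le_max_iff_disj)
    qed (use K1 in auto)
  qed simp
  then obtain K where K: "\<And>n. n \<le> N \<Longrightarrow> \<forall>t\<in>{0..T}. \<bar>a n t\<bar> \<le> K n \<and> (1 \<le> n \<longrightarrow> \<bar>b n t\<bar> \<le> K n)"
    by metis
  have le: "K n \<le> (\<Sum>n\<le>N. \<bar>K n\<bar>)" if "n \<le> N" for n
    using member_le_sum[of n "{..N}" "\<lambda>n. \<bar>K n\<bar>"] that by auto
  show ?thesis
  proof (intro exI conjI ballI allI impI)
    show "0 \<le> (\<Sum>n\<le>N. \<bar>K n\<bar>)" by (intro sum_nonneg) auto
    fix t n assume t: "t \<in> {0..T}" and n: "n \<le> N"
    show "\<bar>a n t\<bar> \<le> (\<Sum>n\<le>N. \<bar>K n\<bar>)"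
      using bspec[OF K[OF n] t] le[OF n] by linarith
    assume "1 \<le> n"
    then show "\<bar>b n t\<bar> \<le> (\<Sum>n\<le>N. \<bar>K n\<bar>)"
      using bspec[OF K[OF n] t] le[OF n] by linarith
  qed
qed

text \<open>Both \<open>S\<^sub>k = jmom k 1 * exp (2 \<integral> b\<^sub>1)\<close> and the exponential moments \<open>M\<^sub>k\<close> of the initial
  measure solve the infinite linear system \<open>x\<^sub>k' = 2 x\<^sub>k\<^sub>+\<^sub>1\<close> with the same initial values.\<close>

lemma finite_toda_moments:
  assumes toda: "finite_toda N a0 b0 a b" and a0: "\<And>n. 1 \<le> n \<Longrightarrow> n < N \<Longrightarrow> a0 n > 0"
    and N: "N \<ge> 1" and T: "T \<ge> 0"
  defines "\<rho> \<equiv> block_spectral_measure (jacobi_block N a0 b0)"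
  shows "(LINT x|block_spectral_measure (jacobi_block N (\<lambda>n. a n T) (\<lambda>n. b n T)). x ^ k) =
    (LINT x|\<rho>. x ^ k * exp (2 * x * T)) / (LINT x|\<rho>. exp (2 * x * T))"
proof -
  have J: "jacobi_truncation N (\<lambda>n. a n t)" if "t \<ge> 0" for t
    using finite_toda_pos[OF toda a0 _ _ that] N by unfold_locales auto
  define w where "w t k = jmom (\<lambda>n. a n t) (\<lambda>n. b n t) k" for t k
  have aN: "a N t = 0" "a 0 t = 0" if "t \<ge> 0" for t using toda that by (auto simp: finite_toda_def)
  have mom: "(LINT x|block_spectral_measure (jacobi_block N (\<lambda>n. a n t) (\<lambda>n. b n t)). x ^ k) = w t k 1"
    if "t \<ge> 0" for t k
    unfolding w_def
    by (subst jacobi_truncation.integral_block_spectral_measure[OF J[OF that]], simp,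
        rule jacobi_truncation.moment_block[OF J[OF that]]) (use aN that in auto)
  have J0: "jacobi_block N a0 b0 = jacobi_block N (\<lambda>n. a n 0) (\<lambda>n. b n 0)"
  proof -
    have "a n 0 = a0 n" if "1 \<le> n" "n < N" for n using toda that by (simp add: finite_toda_def)
    moreover have "b n 0 = b0 n" if "1 \<le> n" "n \<le> N" for n using toda that by (simp add: finite_toda_def)
    ultimately show ?thesis
      unfolding jacobi_block_def by (intro eq_matI) (simp_all add: jacobi_entry_def)
  qed
  interpret J0: jacobi_truncation N "\<lambda>n. a n 0" "\<lambda>n. b n 0" by (rule J) simp
  define M where "M k t = (\<Sum>x\<in>J0.ev. J0.wt x * (x ^ k * exp (2 * x * t)))" for k t
  have M: "M k t = (LINT x|\<rho>. x ^ k * exp (2 * x * t))" for k t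
    unfolding \<rho>_def J0 M_def by (rule J0.integral_block_spectral_measure[symmetric]) measurable
  have dM: "(M k has_real_derivative 2 * M (Suc k) t) (at t within {0..})" for k t
    unfolding M_def sum_distrib_left
    by (rule derivative_eq_intros refl | simp add: mult_ac)+
  \<comment> \<open>The factor \<open>exp (2 * B t)\<close> cancels the term with
    \<open>b 1 t\<close> in the equation for the moments.\<close>
  obtain B where B: "B 0 = 0" "\<And>t. t \<ge> 0 \<Longrightarrow> (B has_real_derivative b 1 t) (at t within {0..})"
    using ex_antiderivative_atLeast[OF finite_toda_continuous(2)[OF toda, of 1]] N by auto
  define S where "S k t = w t k 1 * exp (2 * B t)" for k t
  have dS: "(S k has_real_derivative 2 * S (Suc k) t) (at t within {0..})" if t: "t \<ge> 0" for k t
  proof -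
    \<comment> \<open>The first row of the matrix eliminates the second component brought in by the
      Lax equation.\<close>
    have w1: "w t (Suc k) 1 = b 1 t * w t k 1 + a 1 t * w t k 2"
      by (simp add: w_def jac_def numeral_2_eq_2)
    have "((\<lambda>s. w s k 1) has_real_derivative
        a 1 t * w t k (Suc 1) - a (1 - 1) t * w t k (1 - 1) + w t (Suc k) 1 - b 1 t * w t k 1) (at t within {0..})"
      unfolding w_def by (rule toda_jmom_derivative[OF toda t]) (use N in auto)
    then have "((\<lambda>s. w s k 1) has_real_derivative 2 * w t (Suc k) 1 - 2 * b 1 t * w t k 1) (at t within {0..})"
      using aN[OF t] w1 by (simp add: numeral_2_eq_2[symmetric] algebra_simps)
    then show ?thesis
      unfolding S_def using B(2)[OF t] by (auto intro!: derivative_eq_intros simp: algebra_simps)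
  qed
  obtain K where K: "K \<ge> 0" "\<And>t n. 0 \<le> t \<Longrightarrow> t \<le> T \<Longrightarrow> n \<le> N \<Longrightarrow> \<bar>a n t\<bar> \<le> K"
    "\<And>t n. 0 \<le> t \<Longrightarrow> t \<le> T \<Longrightarrow> 1 \<le> n \<Longrightarrow> n \<le> N \<Longrightarrow> \<bar>b n t\<bar> \<le> K"
    using finite_toda_bounded[OF toda, of T] by fastforce
  have "continuous_on {0..} B" using B(2) by (intro DERIV_continuous_on[of _ _ "b 1"]) auto
  then have "continuous_on {0..T} B" by (rule continuous_on_subset) auto
  then have "compact ((\<lambda>t. exp (2 * B t)) ` {0..T})"
    by (intro compact_continuous_image compact_Icc continuous_intros)
  then obtain C where C': "\<forall>y\<in>(\<lambda>t. exp (2 * B t)) ` {0..T}. norm y \<le> C"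
    using compact_imp_bounded bounded_iff by metis
  have C: "exp (2 * B t) \<le> C" if "0 \<le> t" "t \<le> T" for t
    using bspec[OF C', of "exp (2 * B t)"] that by simp
  define R where "R = (\<Sum>x\<in>J0.ev. \<bar>x\<bar>)"
  have R: "\<bar>x\<bar> \<le> R" if "x \<in> J0.ev" for x
    unfolding R_def using that J0.finite_ev by (intro member_le_sum) auto
  define W where "W = (\<Sum>x\<in>J0.ev. J0.wt x * exp (2 * R * T))"
  have Mb: "\<bar>M k t\<bar> \<le> W * R ^ k" if t: "0 \<le> t" "t \<le> T" for k t
  proof -
    have "\<bar>M k t\<bar> \<le> (\<Sum>x\<in>J0.ev. \<bar>J0.wt x * (x ^ k * exp (2 * x * t))\<bar>)"
      unfolding M_def by (rule sum_abs)
    also have "\<dots> \<le> (\<Sum>x\<in>J0.ev. J0.wt x * exp (2 * R * T) * R ^ k)"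
    proof (rule sum_mono)
      fix x assume x: "x \<in> J0.ev"
      have "x * t \<le> R * T" using R[OF x] t by (intro order.trans[OF mult_right_mono[of x R t]] mult_left_mono) auto
      then have "\<bar>x\<bar> ^ k * exp (2 * x * t) \<le> R ^ k * exp (2 * R * T)"
        using R[OF x] by (intro mult_mono power_mono) auto
      then show "\<bar>J0.wt x * (x ^ k * exp (2 * x * t))\<bar> \<le> J0.wt x * exp (2 * R * T) * R ^ k"
        using J0.wt_pos[of x] by (simp add: abs_mult power_abs mult_ac)
    qed
    finally show ?thesis by (simp add: W_def sum_distrib_right)
  qed
  have Sb: "\<bar>S k t\<bar> \<le> C * (3 * K) ^ k" if t: "0 \<le> t" "t \<le> T" for k t
  proof -
    have "\<bar>w t k 1\<bar> \<le> (3 * K) ^ k"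
      unfolding w_def using K t aN N by (intro abs_jmom_le[of N]) auto
    then have "\<bar>w t k 1\<bar> * exp (2 * B t) \<le> (3 * K) ^ k * C"
      using C[OF t] K(1) by (intro mult_mono) auto
    then show ?thesis by (simp add: S_def abs_mult mult.commute)
  qed
  \<comment> \<open>The difference needs one geometric bound, so the ratio is the larger of
    \<open>3 * K\<close>, from the matrix entries, and \<open>R\<close>, from the initial
    eigenvalues.\<close>
  have eq: "S k T - M k T = 0" for k
  proof (rule derivative_chain_zero[where D = "\<lambda>k t. S k t - M k t" and T = T and K = "C + W" and C = "max (3 * K) R"])
    show "((\<lambda>t. S k t - M k t) has_real_derivative 2 * (S (Suc k) t - M (Suc k) t)) (at t within {0..})"
      if "t \<ge> 0" for k t
      using DERIV_diff[OF dS[OF that] dM] by (simp add: algebra_simps)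
    show "S k 0 - M k 0 = 0" for k
      using J0.moment_block[of k] aN by (simp add: S_def M_def B(1) w_def)
    show "\<bar>S k t - M k t\<bar> \<le> (C + W) * max (3 * K) R ^ k" if t: "0 \<le> t" "t \<le> T" for k t
    proof -
      have "R \<ge> 0" unfolding R_def by (intro sum_nonneg) auto
      have "C \<ge> 0" using C[OF t] by (meson exp_ge_zero order.trans)
      have "W \<ge> 0" unfolding W_def using J0.wt_pos by (intro sum_nonneg mult_nonneg_nonneg) (auto intro: less_imp_le)
      have "C * (3 * K) ^ k \<le> C * max (3 * K) R ^ k"
        using K(1) \<open>C \<ge> 0\<close> by (intro mult_left_mono power_mono) auto
      moreover have "W * R ^ k \<le> W * max (3 * K) R ^ k"
        using \<open>R \<ge> 0\<close> \<open>W \<ge> 0\<close> by (intro mult_left_mono power_mono) auto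
      ultimately show ?thesis using Sb[OF t, of k] Mb[OF t, of k] by (simp add: distrib_right)
    qed
  qed (use K(1) T in auto)
  \<comment> \<open>The zeroth moment of the current matrix is \<open>1\<close>; hence the unknown
    factor \<open>exp (2 * B T)\<close> equals the normalizing integral.\<close>
  have "M 0 T = exp (2 * B T)" using eq[of 0] by (simp add: S_def w_def)
  moreover have "M k T = w T k 1 * exp (2 * B T)" using eq[of k] by (simp add: S_def)
  ultimately have "w T k 1 = M k T / M 0 T" by simp
  then show ?thesis using mom[OF T, of k] M[of k T] M[of 0 T] by simp
qed

section \<open>Jacobi operators in square-summable sequences\<close>

lemma l2_iff: "f \<in> l2 \<longleftrightarrow> f 0 = 0 \<and> summable (\<lambda>n. (cmod (f n))\<^sup>2)"
  by (simp add: l2_def)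

lemma l2_zero [simp]: "(\<lambda>n. 0) \<in> l2"
  by (simp add: l2_iff)

lemma l2_scale: "f \<in> l2 \<Longrightarrow> (\<lambda>n. c * f n) \<in> l2"
  by (simp add: l2_iff norm_mult power_mult_distrib)

lemma l2_add:
  assumes "f \<in> l2" "g \<in> l2"
  shows "(\<lambda>n. f n + g n) \<in> l2"
proof -
  have "summable (\<lambda>n. 2 * (cmod (f n))\<^sup>2 + 2 * (cmod (g n))\<^sup>2)"
    using assms by (intro summable_add summable_mult) (auto simp: l2_iff)
  moreover have "norm ((cmod (f n + g n))\<^sup>2) \<le> 2 * (cmod (f n))\<^sup>2 + 2 * (cmod (g n))\<^sup>2" for n
  proof -
    have "(cmod (f n + g n))\<^sup>2 \<le> (cmod (f n) + cmod (g n))\<^sup>2"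
      by (intro power_mono norm_triangle_ineq) auto
    also have "\<dots> \<le> 2 * (cmod (f n))\<^sup>2 + 2 * (cmod (g n))\<^sup>2"
      using sum_squares_bound[of "cmod (f n)" "cmod (g n)"] unfolding power2_sum by linarith
    finally show ?thesis by simp
  qed
  ultimately have "summable (\<lambda>n. (cmod (f n + g n))\<^sup>2)"
    by (rule summable_comparison_test'[where N = 0])
  then show ?thesis using assms by (simp add: l2_iff)
qed

lemma l2_lin: "f \<in> l2 \<Longrightarrow> g \<in> l2 \<Longrightarrow> (\<lambda>n. f n + c * g n) \<in> l2"
  using l2_add[of f "\<lambda>n. c * g n"] l2_scale by simp

lemma l2_diff: "f \<in> l2 \<Longrightarrow> g \<in> l2 \<Longrightarrow> (\<lambda>n. f n - g n) \<in> l2"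
  using l2_lin[of f g "-1"] by simp

lemma finite_sequences_l2: "f \<in> finite_sequences \<Longrightarrow> f \<in> l2"
  unfolding finite_sequences_def l2_def by (auto intro!: summable_finite[of "{n. f n \<noteq> 0}"])

lemma l2_inner_summable:
  assumes "f \<in> l2" "g \<in> l2"
  shows "summable (\<lambda>n. f n * cnj (g n))"
proof (rule summable_norm_cancel, rule summable_comparison_test'[where N = 0])
  show "summable (\<lambda>n. (cmod (f n))\<^sup>2 + (cmod (g n))\<^sup>2)"
    using assms by (intro summable_add) (auto simp: l2_iff)
  fix n
  have "2 * (cmod (f n) * cmod (g n)) \<le> (cmod (f n))\<^sup>2 + (cmod (g n))\<^sup>2" "0 \<le> cmod (f n) * cmod (g n)"
    using sum_squares_bound[of "cmod (f n)" "cmod (g n)"] by auto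
  then show "norm (norm (f n * cnj (g n))) \<le> (cmod (f n))\<^sup>2 + (cmod (g n))\<^sup>2"
    unfolding norm_mult complex_mod_cnj real_norm_def abs_mult abs_norm_cancel by linarith
qed

lemma l2_inner_lin_left:
  assumes "f \<in> l2" "g \<in> l2" "h \<in> l2"
  shows "l2_inner (\<lambda>n. f n + c * g n) h = l2_inner f h + c * l2_inner g h"
  using suminf_add[OF l2_inner_summable[OF assms(1,3)] summable_mult[OF l2_inner_summable[OF assms(2,3)], of c]]
    suminf_mult[OF l2_inner_summable[OF assms(2,3)], of c]
  by (simp add: l2_inner_def algebra_simps)

lemma l2_inner_scale_left:
  assumes "f \<in> l2" "h \<in> l2"
  shows "l2_inner (\<lambda>n. c * f n) h = c * l2_inner f h"
  using l2_inner_lin_left[OF l2_zero assms, of c] by (simp add: l2_inner_def[of "\<lambda>n. 0"])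

lemma l2_inner_cnj:
  assumes "f \<in> l2" "g \<in> l2"
  shows "l2_inner g f = cnj (l2_inner f g)"
proof -
  have "(\<lambda>n. cnj (f n * cnj (g n))) sums cnj (l2_inner f g)"
    unfolding l2_inner_def sums_cnj by (rule summable_sums[OF l2_inner_summable[OF assms]])
  then have "(\<lambda>n. g n * cnj (f n)) sums cnj (l2_inner f g)" by (simp add: mult.commute)
  then show ?thesis by (simp add: l2_inner_def sums_iff)
qed

lemma l2_inner_self:
  assumes "f \<in> l2"
  shows "l2_inner f f = complex_of_real (\<Sum>n. (cmod (f n))\<^sup>2)"
proof -
  have "(\<lambda>n. complex_of_real ((cmod (f n))\<^sup>2)) sums complex_of_real (\<Sum>n. (cmod (f n))\<^sup>2)"
    using assms by (intro sums_of_real summable_sums) (auto simp: l2_iff)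
  then show ?thesis by (simp only: complex_norm_square l2_inner_def sums_iff)
qed

lemma l2_coord_le:
  assumes "f \<in> l2"
  shows "cmod (f n) \<le> l2_norm f"
proof -
  have "(\<Sum>i\<in>{n}. (cmod (f i))\<^sup>2) \<le> (\<Sum>n. (cmod (f n))\<^sup>2)"
    using assms by (intro sum_le_suminf) (auto simp: l2_iff)
  then show ?thesis unfolding l2_norm_def by (intro real_le_rsqrt) simp
qed

text \<open>A separate type lets the sequences instantiate \<open>real_inner\<close>, with the real
  part of \<open>l2_inner\<close> as inner product.\<close>

typedef ell2 = l2 morphisms coord Abs_ell2
  by (rule exI[of _ "\<lambda>n. 0"]) simp

setup_lifting type_definition_ell2

lemma coord_l2 [simp]: "coord x \<in> l2"
  by (rule coord)

lemma coord_0_index [simp]: "coord x 0 = 0"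
  using coord_l2[of x] by (simp add: l2_iff)

instantiation ell2 :: real_inner
begin

lift_definition zero_ell2 :: ell2 is "\<lambda>n. 0" by simp
lift_definition plus_ell2 :: "ell2 \<Rightarrow> ell2 \<Rightarrow> ell2" is "\<lambda>f g n. f n + g n" by (rule l2_add)
lift_definition minus_ell2 :: "ell2 \<Rightarrow> ell2 \<Rightarrow> ell2" is "\<lambda>f g n. f n - g n" by (rule l2_diff)
lift_definition uminus_ell2 :: "ell2 \<Rightarrow> ell2" is "\<lambda>f n. - f n" by (simp add: l2_iff)
lift_definition scaleR_ell2 :: "real \<Rightarrow> ell2 \<Rightarrow> ell2" is "\<lambda>c f n. complex_of_real c * f n" by (rule l2_scale)
lift_definition norm_ell2 :: "ell2 \<Rightarrow> real" is l2_norm .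
lift_definition inner_ell2 :: "ell2 \<Rightarrow> ell2 \<Rightarrow> real" is "\<lambda>f g. Re (l2_inner f g)" .

definition dist_ell2 :: "ell2 \<Rightarrow> ell2 \<Rightarrow> real" where "dist_ell2 x y = norm (x - y)"
definition sgn_ell2 :: "ell2 \<Rightarrow> ell2" where "sgn_ell2 x = inverse (norm x) *\<^sub>R x"
definition uniformity_ell2 :: "(ell2 \<times> ell2) filter" where
  "uniformity_ell2 = (INF e\<in>{0<..}. principal {(x, y). dist x y < e})"
definition open_ell2 :: "ell2 set \<Rightarrow> bool" where
  "open_ell2 U \<longleftrightarrow> (\<forall>x\<in>U. eventually (\<lambda>(x', y). x' = x \<longrightarrow> y \<in> U) uniformity)"

instance
proof
  fix x y z :: ell2 and r s :: real
  show "x + y + z = x + (y + z)"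
    by transfer (simp add: fun_eq_iff algebra_simps)
  show "x + y = y + x"
    by transfer (simp add: fun_eq_iff algebra_simps)
  show "0 + x = x"
    by transfer (simp add: fun_eq_iff algebra_simps)
  show "- x + x = 0"
    by transfer (simp add: fun_eq_iff algebra_simps)
  show "x - y = x + - y"
    by transfer (simp add: fun_eq_iff algebra_simps)
  show "r *\<^sub>R (x + y) = r *\<^sub>R x + r *\<^sub>R y"
    by transfer (simp add: fun_eq_iff algebra_simps)
  show "(r + s) *\<^sub>R x = r *\<^sub>R x + s *\<^sub>R x"
    by transfer (simp add: fun_eq_iff algebra_simps)
  show "r *\<^sub>R s *\<^sub>R x = (r * s) *\<^sub>R x"
    by transfer (simp add: fun_eq_iff mult.assoc)
  show "1 *\<^sub>R x = x"
    by transfer simp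
  show "inner x y = inner y x"
    by transfer (subst l2_inner_cnj, assumption+, simp)
  show "inner (x + y) z = inner x z + inner y z"
    by transfer (use l2_inner_lin_left[where c = 1] in simp)
  show "inner (r *\<^sub>R x) y = r * inner x y"
    by transfer (simp add: l2_inner_scale_left)
  show "0 \<le> inner x x"
    by transfer (simp add: l2_inner_self suminf_nonneg l2_iff)
  show "inner x x = 0 \<longleftrightarrow> x = 0"
    by transfer (auto simp: l2_inner_self l2_iff suminf_eq_zero_iff fun_eq_iff)
  show "norm x = sqrt (inner x x)"
    by transfer (simp add: l2_inner_self l2_norm_def)
qed (simp_all add: dist_ell2_def sgn_ell2_def uniformity_ell2_def open_ell2_def)

end

lemma coord_add: "coord (x + y) = (\<lambda>n. coord x n + coord y n)" by (rule plus_ell2.rep_eq)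
lemma coord_diff: "coord (x - y) = (\<lambda>n. coord x n - coord y n)" by (rule minus_ell2.rep_eq)
lemma coord_scaleR: "coord (r *\<^sub>R x) = (\<lambda>n. complex_of_real r * coord x n)" by (rule scaleR_ell2.rep_eq)
lemma coord_zero: "coord 0 = (\<lambda>n. 0)" by (rule zero_ell2.rep_eq)
lemma coord_sum: "coord (\<Sum>i\<in>S. f i) = (\<lambda>n. \<Sum>i\<in>S. coord (f i) n)"
  by (induction S rule: infinite_finite_induct) (auto simp: coord_zero coord_add)

lemma coord_Abs [simp]: "f \<in> l2 \<Longrightarrow> coord (Abs_ell2 f) = f"
  by (rule Abs_ell2_inverse)

lemma Abs_coord [simp]: "Abs_ell2 (coord x) = x"
  by (rule coord_inverse)

lemma l2_norm_triangle:
  assumes "f \<in> l2" "g \<in> l2"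
  shows "l2_norm (\<lambda>n. f n + g n) \<le> l2_norm f + l2_norm g"
  using norm_triangle_ineq[of "Abs_ell2 f" "Abs_ell2 g"] assms by (simp add: norm_ell2.rep_eq coord_add)

lemma l2_norm_scale:
  assumes "f \<in> l2"
  shows "l2_norm (\<lambda>n. c * f n) = cmod c * l2_norm f"
  using assms suminf_mult[of "\<lambda>n. (cmod (f n))\<^sup>2" "(cmod c)\<^sup>2"]
  by (simp add: l2_norm_def norm_mult power_mult_distrib l2_iff real_sqrt_mult)

lemma l2_norm_nonneg: "f \<in> l2 \<Longrightarrow> 0 \<le> l2_norm f"
  using norm_ge_zero[of "Abs_ell2 f"] by (simp add: norm_ell2.rep_eq)

lemma l2_norm_lin:
  assumes "f \<in> l2" "g \<in> l2"
  shows "l2_norm (\<lambda>n. f n + c * g n) \<le> l2_norm f + cmod c * l2_norm g"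
  using l2_norm_triangle[OF assms(1) l2_scale[OF assms(2)], of c] l2_norm_scale[OF assms(2), of c] by simp

lemma inner_ell2_single:
  assumes "\<And>n. n \<noteq> m \<Longrightarrow> coord e n = 0" "coord e m = 1"
  shows "inner x e = Re (coord x m)"
proof -
  have "(\<lambda>n. coord x n * cnj (coord e n)) sums (\<Sum>n\<in>{m}. coord x n * cnj (coord e n))"
    using assms by (intro sums_finite) auto
  then show ?thesis using assms by (simp add: inner_ell2.rep_eq l2_inner_def sums_iff)
qed

text \<open>The second assumption makes \<open>[T f, f]\<close> real on \<open>f + i f'\<close>, which forces \<open>T\<close> to be symmetric.\<close>

lemma spectral_operator_ell2:
  assumes E: "spectral_resolution E T"
    and T_l2: "\<And>f g. (f, g) \<in> T \<Longrightarrow> f \<in> l2 \<and> g \<in> l2"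
    and T_lin: "\<And>f g f' g' c. (f, g) \<in> T \<Longrightarrow> (f', g') \<in> T \<Longrightarrow> (\<lambda>n. f n + c * f' n, \<lambda>n. g n + c * g' n) \<in> T"
    and T_unit: "\<And>m. m \<ge> 1 \<Longrightarrow> (\<lambda>n. if n = m then 1 else 0) \<in> Domain T"
  shows "spectral_operator {(x, y). (coord x, coord y) \<in> T} (\<lambda>B x. Abs_ell2 (E B (coord x)))" (is ?thesis1)
    and "vector_measure_of (\<lambda>B x. Abs_ell2 (E B (coord x))) x = scalar_spectral_measure E (coord x)" (is ?thesis2)
proof -
  define S where "S = {(x, y). (coord x, coord y) \<in> T}"
  define P where "P B x = Abs_ell2 (E B (coord x))" for B x
  have pvm: "projection_valued_measure E" using E by (simp add: spectral_resolution_def)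
  note pvm' = pvm[unfolded projection_valued_measure_def]
  note El2 = pvm'[THEN conjunct1, rule_format, THEN conjunct1]
  note Elin = pvm'[THEN conjunct2, THEN conjunct1, rule_format]
  note Esym = pvm'[THEN conjunct2, THEN conjunct2, THEN conjunct1, rule_format]
  note EUNIV = pvm'[THEN conjunct2, THEN conjunct2, THEN conjunct2, THEN conjunct1, rule_format]
  note EInt = pvm'[THEN conjunct2, THEN conjunct2, THEN conjunct2, THEN conjunct2, THEN conjunct1, rule_format]
  note Esums = pvm'[THEN conjunct2, THEN conjunct2, THEN conjunct2, THEN conjunct2, THEN conjunct2, rule_format]
  have coordP: "coord (P B x) = E B (coord x)" if "B \<in> sets borel" for B x
    using El2[OF that coord_l2] by (simp add: P_def)
  have meas: "vector_measure_of P x = scalar_spectral_measure E (coord x)" for x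
    unfolding vector_measure_of_def scalar_spectral_measure_def
  proof (rule measure_of_eq)
    fix B :: "real set" assume "B \<in> sigma_sets UNIV (sets borel)"
    then have "B \<in> sets borel" using sets.sigma_sets_eq[of "borel :: real measure"] by simp
    then show "ennreal (inner (P B x) x) = ennreal (Re (l2_inner (E B (coord x)) (coord x)))"
      by (simp add: inner_ell2.rep_eq coordP)
  qed simp
  then show ?thesis2 by (simp add: P_def[abs_def])
  have T_quad: "l2_inner g f = complex_of_real (LINT x|scalar_spectral_measure E f. x)" if "(f, g) \<in> T" for f g
    using E that by (auto simp: spectral_resolution_def)
  have T_0: "(\<lambda>n. 0, \<lambda>n. 0) \<in> T"
  proof -
    obtain f g where fg: "(f, g) \<in> T" using T_unit[of 1] by auto
    from T_lin[OF this this, of "-1"] show ?thesis by simp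
  qed
  have "spectral_operator S P"
  proof (rule spectral_operator.intro)
    show "subspace S"
    proof (rule subspaceI)
      show "0 \<in> S" using T_0 by (simp add: S_def zero_prod_def coord_zero)
      show "x + y \<in> S" if "x \<in> S" "y \<in> S" for x y
        using that T_lin[of "coord (fst x)" "coord (snd x)" "coord (fst y)" "coord (snd y)" 1]
        by (auto simp: S_def coord_add)
      show "c *\<^sub>R x \<in> S" if "x \<in> S" for c x
        using that T_lin[OF T_0, of "coord (fst x)" "coord (snd x)" "complex_of_real c"]
        by (auto simp: S_def coord_scaleR)
    qed
    fix f h f' h' assume f: "(f, h) \<in> S" and f': "(f', h') \<in> S"
    define F where "F = (\<lambda>n. coord f n + \<i> * coord f' n)"
    define H where "H = (\<lambda>n. coord h n + \<i> * coord h' n)"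
    have "(F, H) \<in> T" unfolding F_def H_def using f f' by (intro T_lin) (auto simp: S_def)
    then have "Im (l2_inner H F) = 0" using T_quad by simp
    moreover have FH: "F \<in> l2" "H \<in> l2" unfolding F_def H_def by (intro l2_lin; simp)+
    moreover have H: "l2_inner H F = l2_inner (coord h) F + \<i> * l2_inner (coord h') F"
      unfolding H_def by (rule l2_inner_lin_left) (auto simp: FH)
    moreover have "l2_inner x F = cnj (l2_inner (coord f) x + \<i> * l2_inner (coord f') x)" if "x \<in> l2" for x
      using l2_inner_cnj[OF FH(1) that] that unfolding F_def by (subst l2_inner_lin_left[symmetric]) auto
    moreover have "Im (l2_inner (coord h) (coord f)) = 0" "Im (l2_inner (coord h') (coord f')) = 0"
      using T_quad[of "coord f" "coord h"] T_quad[of "coord f'" "coord h'"] f f' by (auto simp: S_def)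
    moreover have "l2_inner (coord f) (coord h) = cnj (l2_inner (coord h) (coord f))"
      "l2_inner (coord f') (coord h') = cnj (l2_inner (coord h') (coord f'))"
      by (intro l2_inner_cnj coord_l2)+
    ultimately have "Re (l2_inner (coord f') (coord h)) = Re (l2_inner (coord f) (coord h'))"
      by simp
    then show "inner h f' = inner f h'"
      by (subst inner_commute) (simp add: inner_ell2.rep_eq)
  next
    fix g assume g: "\<And>f h. (f, h) \<in> S \<Longrightarrow> inner f g = 0"
    \<comment> \<open>Orthogonality for the real inner product is tested on the multiples of a unit
      vector by \<open>1\<close> and by \<open>\<i>\<close>, which reaches both parts of the
      coordinate.\<close>
    have 0: "coord g m = 0" if m: "m \<ge> 1" for m
    proof -
      let ?e = "\<lambda>n. if n = m then 1 else 0 :: complex"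
      obtain h where h: "(?e, h) \<in> T" using T_unit[OF m] by auto
      have ei: "inner (Abs_ell2 (\<lambda>n. c * ?e n)) g = 0" for c
      proof -
        have "(\<lambda>n. c * ?e n, \<lambda>n. c * h n) \<in> T" using T_lin[OF T_0 h, of c] by simp
        with T_l2[OF this] show ?thesis by (intro g[of _ "Abs_ell2 (\<lambda>n. c * h n)"]) (auto simp: S_def)
      qed
      have el2: "?e \<in> l2" using T_l2[OF h] by simp
      have "l2_inner (\<lambda>n. c * ?e n) (coord g) = c * cnj (coord g m)" for c
      proof -
        have "(\<lambda>n. c * ?e n * cnj (coord g n)) sums (\<Sum>n\<in>{m}. c * ?e n * cnj (coord g n))"
          by (rule sums_finite) auto
        then show ?thesis by (simp add: l2_inner_def sums_iff)
      qed
      then have "Re (c * cnj (coord g m)) = 0" for c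
        using ei[of c] l2_scale[OF el2, of c] by (simp add: inner_ell2.rep_eq)
      from this[of 1] this[of \<i>] show ?thesis by (simp add: complex_eq_iff)
    qed
    have "coord g n = coord 0 n" for n using 0[of n] by (cases "n = 0") (auto simp: coord_zero)
    then have "coord g = coord 0" by (rule ext)
    then show "g = 0" by (simp only: coord_inject)
  next
    fix B :: "real set" assume B: "B \<in> sets borel"
    have E0: "E B (\<lambda>n. 0) = (\<lambda>n. 0)" using Elin[OF B l2_zero l2_zero, of 1] by (simp add: fun_eq_iff)
    show "linear (P B)"
    proof (rule linearI)
      show "P B (x + y) = P B x + P B y" for x y
        using Elin[OF B coord_l2 coord_l2, of x 1 y]
        by (simp add: coord_inject[symmetric] coordP[OF B] coord_add)
      show "P B (r *\<^sub>R x) = r *\<^sub>R P B x" for r x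
        using Elin[OF B l2_zero coord_l2, of "complex_of_real r" x]
        by (simp add: coord_inject[symmetric] coordP[OF B] coord_scaleR E0)
    qed
  next
    fix B :: "real set" and f g :: ell2 assume B: "B \<in> sets borel"
    show "inner (P B f) g = inner f (P B g)"
      using Esym[OF B coord_l2 coord_l2, of f g] by (simp add: inner_ell2.rep_eq coordP[OF B])
  next
    fix A B :: "real set" and f :: ell2 assume A: "A \<in> sets borel" and B: "B \<in> sets borel"
    show "P (A \<inter> B) f = P A (P B f)"
      using EInt[OF A B coord_l2, of f] A B by (simp add: coord_inject[symmetric] coordP)
  next
    show "P UNIV f = f" for f
      using EUNIV[OF coord_l2, of f] by (simp add: P_def)
  next
    fix Q :: "nat \<Rightarrow> real set" and f
    assume Q: "range Q \<subseteq> sets borel" "disjoint_family Q"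
    have UQ: "(\<Union>i. Q i) \<in> sets borel" using Q by (intro sets.countable_UN) auto
    have QB: "Q i \<in> sets borel" for i using Q by auto
    have "l2_tendsto (\<lambda>k n. \<Sum>i<k. E (Q i) (coord f) n) (E (\<Union>i. Q i) (coord f))"
      by (rule Esums[OF Q coord_l2])
    moreover have "l2_norm (\<lambda>n. (\<Sum>i<k. E (Q i) (coord f) n) - E (\<Union>i. Q i) (coord f) n) =
        norm ((\<Sum>i<k. P (Q i) f) - P (\<Union>i. Q i) f)" for k
      by (simp add: norm_ell2.rep_eq coord_diff coord_sum coordP QB UQ)
    ultimately have "(\<lambda>k. norm ((\<Sum>i<k. P (Q i) f) - P (\<Union>i. Q i) f)) \<longlonglongrightarrow> 0"
      by (simp add: l2_tendsto_def)
    then show "(\<lambda>i. P (Q i) f) sums P (\<Union>i. Q i) f"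
      unfolding sums_def by (intro LIM_zero_cancel[where l = "P (\<Union>i. Q i) f"]) (rule tendsto_norm_zero_cancel)
  next
    have "f \<in> Domain S \<longleftrightarrow> coord f \<in> Domain T" for f
    proof
      assume "coord f \<in> Domain T"
      then obtain g where "(coord f, g) \<in> T" by auto
      then have "(f, Abs_ell2 g) \<in> S" using T_l2 by (auto simp: S_def)
      then show "f \<in> Domain S" by auto
    qed (auto simp: S_def)
    then show "Domain S = {f. integrable (vector_measure_of P f) (\<lambda>x. x\<^sup>2)}"
      using E by (auto simp: meas spectral_resolution_def)
  next
    show "inner h f = (LINT x|vector_measure_of P f. x)" if "(f, h) \<in> S" for f h
      using T_quad[of "coord f" "coord h"] that by (simp add: S_def meas inner_ell2.rep_eq)
  qed
  then show ?thesis1 by (simp add: S_def P_def[abs_def])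
qed

section \<open>The Jacobi operator, its closure and its adjoint\<close>

definition cjac :: "(nat \<Rightarrow> real) \<Rightarrow> (nat \<Rightarrow> real) \<Rightarrow> (nat \<Rightarrow> complex) \<Rightarrow> nat \<Rightarrow> complex" where
  "cjac a b = jac (\<lambda>n. complex_of_real (a n)) (\<lambda>n. complex_of_real (b n))"

lemma jac_lin: "jac a b (\<lambda>n. f n + c * g n) n = jac a b f n + c * jac a b g n"
  by (simp add: jac_def algebra_simps)

lemma cjac_lin: "cjac a b (\<lambda>n. f n + c * g n) = (\<lambda>n. cjac a b f n + c * cjac a b g n)"
  by (simp add: cjac_def jac_lin fun_eq_iff)

lemma cjac_0 [simp]: "cjac a b f 0 = 0"
  by (simp add: cjac_def)

lemma cnj_cjac: "cnj (cjac a b f n) = cjac a b (\<lambda>n. cnj (f n)) n"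
  by (simp add: cjac_def jac_def)

lemma finite_sequences_iff: "f \<in> finite_sequences \<longleftrightarrow> f 0 = 0 \<and> (\<exists>K. \<forall>n>K. f n = 0)"
proof -
  have "finite {n. f n \<noteq> 0} \<longleftrightarrow> (\<exists>K. \<forall>n>K. f n = 0)"
    unfolding finite_nat_set_iff_bounded_le by (metis (mono_tags, lifting) linorder_not_less mem_Collect_eq)
  then show ?thesis by (simp add: finite_sequences_def)
qed

lemma finite_sequences_truncated: "f 0 = 0 \<Longrightarrow> (\<And>n. n > N \<Longrightarrow> f n = 0) \<Longrightarrow> f \<in> finite_sequences"
  by (auto simp: finite_sequences_iff)

lemma finite_sequences_lin:
  assumes "f \<in> finite_sequences" "g \<in> finite_sequences"
  shows "(\<lambda>n. f n + c * g n) \<in> finite_sequences"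
proof -
  obtain K L where "\<forall>n>K. f n = 0" "\<forall>n>L. g n = 0" using assms by (auto simp: finite_sequences_iff)
  then show ?thesis using assms by (intro finite_sequences_truncated[of _ "max K L"]) (auto simp: finite_sequences_iff)
qed

lemma finite_sequences_cjac:
  assumes "f \<in> finite_sequences"
  shows "cjac a b f \<in> finite_sequences"
proof -
  obtain K where K: "\<forall>n>K. f n = 0" using assms by (auto simp: finite_sequences_iff)
  have "cjac a b f n = 0" if "n > Suc K" for n
    using K[rule_format, of "n - 1"] K[rule_format, of n] K[rule_format, of "Suc n"] that
    by (auto simp: cjac_def jac_def)
  then show ?thesis by (rule finite_sequences_truncated[where N = "Suc K", rotated]) auto
qed

lemma jacobi_op_iff: "(f, h) \<in> jacobi_op a b \<longleftrightarrow> f \<in> finite_sequences \<and> h = cjac a b f"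
proof -
  have "(\<lambda>m. if m = 0 then 0 else \<Sum>n | f n \<noteq> 0. complex_of_real (jacobi_entry a b m n) * f n) = cjac a b f"
    if "f \<in> finite_sequences"
  proof
    fix m
    have f: "f 0 = 0" "finite {n. f n \<noteq> 0}" using that by (auto simp: finite_sequences_def)
    have "(\<Sum>n | f n \<noteq> 0. complex_of_real (jacobi_entry a b m n) * f n) = cjac a b f m" if "m \<noteq> 0"
      unfolding cjac_def by (rule sum_jacobi_entry) (use f that in auto)
    then show "(if m = 0 then 0 else \<Sum>n | f n \<noteq> 0. complex_of_real (jacobi_entry a b m n) * f n) = cjac a b f m"
      by (cases "m = 0") (simp_all only: if_True if_False cjac_0 simp_thms)
  qed
  then show ?thesis by (auto simp: jacobi_op_def)
qed

text \<open>Since \<open>f\<close> vanishes beyond \<open>K\<close>, Green's formula up to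
  \<open>K + 1\<close> has no boundary term; \<open>g\<close> may be any sequence with
  \<open>g 0 = 0\<close>.\<close>

lemma cjac_sym:
  assumes f: "f \<in> finite_sequences" and g: "g 0 = 0"
  shows "l2_inner (cjac a b f) g = l2_inner f (cjac a b g)"
proof -
  obtain K where K: "\<forall>n>K. f n = 0" using f by (auto simp: finite_sequences_iff)
  have z: "cjac a b f n = 0" "f n = 0" if "n \<notin> {..<Suc (Suc K)}" for n
    using K[rule_format, of "n - 1"] K[rule_format, of n] K[rule_format, of "Suc n"] that
    by (auto simp: cjac_def jac_def)
  have "l2_inner (cjac a b f) g = (\<Sum>n<Suc (Suc K). cjac a b f n * cnj (g n))"
    unfolding l2_inner_def by (rule suminf_finite) (use z in auto)
  moreover have "l2_inner f (cjac a b g) = (\<Sum>n<Suc (Suc K). f n * cjac a b (\<lambda>n. cnj (g n)) n)"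
    unfolding l2_inner_def cnj_cjac by (rule suminf_finite) (use z in auto)
  moreover have "(\<Sum>n<Suc (Suc K). cjac a b f n * cnj (g n) - f n * cjac a b (\<lambda>n. cnj (g n)) n) = 0"
    unfolding cjac_def by (subst jac_green) (use K f g in \<open>auto simp: finite_sequences_iff\<close>)
  ultimately show ?thesis unfolding sum_subtractf by simp
qed

text \<open>Testing against unit vectors forces \<open>h\<close> to be the difference expression of
  \<open>g\<close>. The adjoint is thus the maximal operator, free of any condition at
  infinity.\<close>

lemma op_adjoint_jacobi_op_iff:
  "(g, h) \<in> op_adjoint (jacobi_op a b) \<longleftrightarrow> g \<in> l2 \<and> h \<in> l2 \<and> h = cjac a b g"
proof
  assume L: "(g, h) \<in> op_adjoint (jacobi_op a b)"
  then have gh: "g \<in> l2" "h \<in> l2" by (auto simp: op_adjoint_def)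
  have "h m = cjac a b g m" for m
  proof (cases "m = 0")
    case True
    then show ?thesis using gh by (simp add: l2_iff)
  next
    case False
    let ?e = "\<lambda>n. if n = m then 1 else 0 :: complex"
    have e: "?e \<in> finite_sequences" using False by (intro finite_sequences_truncated[of _ m]) auto
    have single: "l2_inner ?e x = cnj (x m)" for x
    proof -
      have "l2_inner ?e x = (\<Sum>n\<in>{m}. ?e n * cnj (x n))"
        unfolding l2_inner_def by (rule suminf_finite) auto
      then show ?thesis by simp
    qed
    have "l2_inner (cjac a b ?e) g = l2_inner ?e h"
      using L e jacobi_op_iff[of ?e "cjac a b ?e" a b] by (auto simp: op_adjoint_def)
    moreover have "l2_inner (cjac a b ?e) g = l2_inner ?e (cjac a b g)"
      using e gh by (intro cjac_sym) (auto simp: l2_iff)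
    ultimately show ?thesis by (simp add: single)
  qed
  then show "g \<in> l2 \<and> h \<in> l2 \<and> h = cjac a b g" using gh by auto
next
  assume "g \<in> l2 \<and> h \<in> l2 \<and> h = cjac a b g"
  then show "(g, h) \<in> op_adjoint (jacobi_op a b)"
    by (auto simp: op_adjoint_def jacobi_op_iff l2_iff intro: cjac_sym)
qed

lemma l2_tendsto_coord:
  assumes "l2_tendsto F f" "\<And>k. F k \<in> l2" "f \<in> l2"
  shows "(\<lambda>k. F k n) \<longlonglongrightarrow> f n"
proof -
  have "(\<lambda>k. F k n - f n) \<longlonglongrightarrow> 0"
  proof (rule Lim_null_comparison)
    show "\<forall>\<^sub>F k in sequentially. norm (F k n - f n) \<le> l2_norm (\<lambda>n. F k n - f n)"
      using l2_coord_le[OF l2_diff[OF assms(2,3)], of _ n] by (intro always_eventually) auto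
  qed (use assms(1) in \<open>simp add: l2_tendsto_def\<close>)
  then show ?thesis by (rule LIM_zero_cancel)
qed

text \<open>Convergence in norm implies convergence of coordinates, and a coordinate of
  \<open>cjac\<close> depends on at most three of them.\<close>

lemma op_closure_jacobi_op_cjac:
  assumes "(f, g) \<in> op_closure (jacobi_op a b)"
  shows "g = cjac a b f"
proof
  fix n
  obtain F G where FG: "\<And>k. (F k, G k) \<in> jacobi_op a b" "l2_tendsto F f" "l2_tendsto G g"
    and l: "f \<in> l2" "g \<in> l2" using assms by (auto simp: op_closure_def)
  have G: "G k = cjac a b (F k)" "F k \<in> finite_sequences" for k using FG(1)[of k] by (auto simp: jacobi_op_iff)
  have Fl: "F k \<in> l2" "G k \<in> l2" for k
    using G finite_sequences_l2 finite_sequences_cjac by auto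
  have "(\<lambda>k. cjac a b (F k) n) \<longlonglongrightarrow> cjac a b f n"
    unfolding cjac_def jac_def
    by (cases "n = 0") (auto intro!: tendsto_intros l2_tendsto_coord[OF FG(2) Fl(1) l(1)])
  then show "g n = cjac a b f n"
    using l2_tendsto_coord[OF FG(3) Fl(2) l(2), of n] G(1) LIMSEQ_unique by force
qed

lemma op_closure_jacobi_op_lin:
  assumes "(f, g) \<in> op_closure (jacobi_op a b)" "(f', g') \<in> op_closure (jacobi_op a b)"
  shows "(\<lambda>n. f n + c * f' n, \<lambda>n. g n + c * g' n) \<in> op_closure (jacobi_op a b)"
proof -
  obtain F G where FG: "\<And>k. (F k, G k) \<in> jacobi_op a b" "l2_tendsto F f" "l2_tendsto G g"
    and l: "f \<in> l2" "g \<in> l2" using assms(1) by (auto simp: op_closure_def)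
  obtain F' G' where FG': "\<And>k. (F' k, G' k) \<in> jacobi_op a b" "l2_tendsto F' f'" "l2_tendsto G' g'"
    and l': "f' \<in> l2" "g' \<in> l2" using assms(2) by (auto simp: op_closure_def)
  have lim: "l2_tendsto (\<lambda>k n. X k n + c * Y k n) (\<lambda>n. x n + c * y n)"
    if "l2_tendsto X x" "l2_tendsto Y y" "\<And>k. X k \<in> l2" "\<And>k. Y k \<in> l2" "x \<in> l2" "y \<in> l2" for X x Y y
    unfolding l2_tendsto_def
  proof (rule Lim_null_comparison)
    show "(\<lambda>k. l2_norm (\<lambda>n. X k n - x n) + cmod c * l2_norm (\<lambda>n. Y k n - y n)) \<longlonglongrightarrow> 0"
      using that(1,2) unfolding l2_tendsto_def by (auto intro!: tendsto_eq_intros)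
    have "norm (l2_norm (\<lambda>n. X k n + c * Y k n - (x n + c * y n))) \<le>
        l2_norm (\<lambda>n. X k n - x n) + cmod c * l2_norm (\<lambda>n. Y k n - y n)" for k
    proof -
      have d: "(\<lambda>n. X k n - x n) \<in> l2" "(\<lambda>n. Y k n - y n) \<in> l2" using that by (auto intro: l2_diff)
      have e: "(\<lambda>n. X k n + c * Y k n - (x n + c * y n)) = (\<lambda>n. (X k n - x n) + c * (Y k n - y n))"
        by (simp add: algebra_simps)
      show ?thesis
        unfolding e using l2_norm_lin[OF d, of c] l2_norm_nonneg[OF l2_lin[OF d, of c]] by simp
    qed
    then show "\<forall>\<^sub>F k in sequentially. norm (l2_norm (\<lambda>n. X k n + c * Y k n - (x n + c * y n))) \<le>
        l2_norm (\<lambda>n. X k n - x n) + cmod c * l2_norm (\<lambda>n. Y k n - y n)"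
      by (rule always_eventually[OF allI])
  qed
  have m: "F k \<in> finite_sequences" "G k = cjac a b (F k)" "F' k \<in> finite_sequences" "G' k = cjac a b (F' k)" for k
    using FG(1)[of k] FG'(1)[of k] by (auto simp: jacobi_op_iff)
  have ml: "F k \<in> l2" "G k \<in> l2" "F' k \<in> l2" "G' k \<in> l2" for k
    using m finite_sequences_l2 finite_sequences_cjac by auto
  have "(\<lambda>n. F k n + c * F' k n, \<lambda>n. G k n + c * G' k n) \<in> jacobi_op a b" for k
    using m by (auto simp: jacobi_op_iff finite_sequences_lin cjac_lin)
  then have "\<exists>X Y. (\<forall>k. (X k, Y k) \<in> jacobi_op a b) \<and> l2_tendsto X (\<lambda>n. f n + c * f' n) \<and> l2_tendsto Y (\<lambda>n. g n + c * g' n)"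
    by (rule_tac exI[of _ "\<lambda>k n. F k n + c * F' k n"], rule_tac exI[of _ "\<lambda>k n. G k n + c * G' k n"])
      (intro conjI allI lim[OF FG(2) FG'(2) ml(1,3) l(1) l'(1)] lim[OF FG(3) FG'(3) ml(2,4) l(2) l'(2)])
  then show ?thesis
    unfolding op_closure_def using l2_lin[OF l(1) l'(1), of c] l2_lin[OF l(2) l'(2), of c] by simp
qed

lemma jacobi_op_subset_closure: "jacobi_op a b \<subseteq> op_closure (jacobi_op a b)"
proof -
  have "(f, cjac a b f) \<in> op_closure (jacobi_op a b)" if "f \<in> finite_sequences" for f
  proof -
    have "\<exists>F G. (\<forall>k. (F k, G k) \<in> jacobi_op a b) \<and> l2_tendsto F f \<and> l2_tendsto G (cjac a b f)"
      by (rule exI[of _ "\<lambda>k. f"], rule exI[of _ "\<lambda>k. cjac a b f"])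
        (use that in \<open>simp add: jacobi_op_iff l2_tendsto_def l2_norm_def\<close>)
    then show ?thesis
      using finite_sequences_l2[OF that] finite_sequences_l2[OF finite_sequences_cjac[OF that]]
      unfolding op_closure_def by simp
  qed
  then show ?thesis by (auto simp: jacobi_op_iff)
qed

lemma op_closure_subset_adjoint: "op_closure (jacobi_op a b) \<subseteq> op_adjoint (jacobi_op a b)"
proof
  fix x assume x: "x \<in> op_closure (jacobi_op a b)"
  obtain f g where "x = (f, g)" by (cases x)
  then show "x \<in> op_adjoint (jacobi_op a b)"
    using x op_closure_jacobi_op_cjac[of f g a b] by (auto simp: op_adjoint_jacobi_op_iff op_closure_def)
qed

lemma jacobi_realization_subset_adjoint: "jacobi_realization a b \<alpha> \<subseteq> op_adjoint (jacobi_op a b)"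
  using op_closure_subset_adjoint by (auto simp: jacobi_realization_def op_restrict_def)

lemma jacobi_op_subset_realization: "jacobi_op a b \<subseteq> jacobi_realization a b \<alpha>"
proof (cases "limit_point a b")
  case False
  have "(f, h) \<in> jacobi_realization a b \<alpha>" if "(f, h) \<in> jacobi_op a b" for f h
  proof -
    have c: "(f, h) \<in> op_closure (jacobi_op a b)" using that jacobi_op_subset_closure by auto
    then have "(f, h) \<in> op_adjoint (jacobi_op a b)" using op_closure_subset_adjoint by auto
    moreover have "f \<in> {(\<lambda>n. f n + c * boundary_vector a b \<alpha> n) | f c. f \<in> Domain (op_closure (jacobi_op a b))}"
      using c by (auto intro!: exI[of _ f] exI[of _ 0])
    ultimately show ?thesis using False by (simp add: jacobi_realization_def op_restrict_def)
  qed
  then show ?thesis by auto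
qed (simp add: jacobi_realization_def jacobi_op_subset_closure)

lemma jacobi_realization_lin:
  assumes "(f, g) \<in> jacobi_realization a b \<alpha>" "(f', g') \<in> jacobi_realization a b \<alpha>"
  shows "(\<lambda>n. f n + c * f' n, \<lambda>n. g n + c * g' n) \<in> jacobi_realization a b \<alpha>"
proof (cases "limit_point a b")
  case True
  then show ?thesis using assms op_closure_jacobi_op_lin by (simp add: jacobi_realization_def)
next
  case False
  let ?v = "boundary_vector a b \<alpha>"
  let ?D = "{(\<lambda>n. f n + c * ?v n) | f c. f \<in> Domain (op_closure (jacobi_op a b))}"
  have r: "(x, y) \<in> jacobi_realization a b \<alpha> \<longleftrightarrow> (x, y) \<in> op_adjoint (jacobi_op a b) \<and> x \<in> ?D" for x y
    using False by (simp add: jacobi_realization_def op_restrict_def)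
  obtain f1 d1 g1 where 1: "f = (\<lambda>n. f1 n + d1 * ?v n)" "(f1, g1) \<in> op_closure (jacobi_op a b)"
    using assms(1) unfolding r by auto
  obtain f2 d2 g2 where 2: "f' = (\<lambda>n. f2 n + d2 * ?v n)" "(f2, g2) \<in> op_closure (jacobi_op a b)"
    using assms(2) unfolding r by auto
  have "(\<lambda>n. f1 n + c * f2 n, \<lambda>n. g1 n + c * g2 n) \<in> op_closure (jacobi_op a b)"
    using 1(2) 2(2) by (rule op_closure_jacobi_op_lin)
  moreover have "(\<lambda>n. f n + c * f' n) = (\<lambda>n. (f1 n + c * f2 n) + (d1 + c * d2) * ?v n)"
    unfolding 1(1) 2(1) by (simp add: algebra_simps)
  ultimately have "\<exists>x d. (\<lambda>n. f n + c * f' n) = (\<lambda>n. x n + d * ?v n) \<and> x \<in> Domain (op_closure (jacobi_op a b))"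
    by (intro exI conjI DomainI)
  then have "(\<lambda>n. f n + c * f' n) \<in> ?D" by simp
  moreover have "(\<lambda>n. f n + c * f' n, \<lambda>n. g n + c * g' n) \<in> op_adjoint (jacobi_op a b)"
    using assms unfolding r op_adjoint_jacobi_op_iff by (auto simp: l2_lin cjac_lin)
  ultimately show ?thesis unfolding r by simp
qed

section \<open>Approximation by truncations\<close>

text \<open>The solution of \<open>J \<phi> = z \<phi> + d e\<^sub>1\<close> with \<open>\<phi>\<^sub>1 = s\<close>; \<open>(s, d) = (1, 0)\<close> gives \<open>p(z)\<close> and
  \<open>(s, d) = (0, 1)\<close> gives \<open>q(z)\<close>.\<close>

fun csol :: "(nat \<Rightarrow> real) \<Rightarrow> (nat \<Rightarrow> real) \<Rightarrow> complex \<Rightarrow> complex \<Rightarrow> complex \<Rightarrow> nat \<Rightarrow> complex" where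
  "csol a b z s d 0 = 0"
| "csol a b z s d (Suc 0) = s"
| "csol a b z s d (Suc (Suc 0)) = ((z - of_real (b 1)) * s + d) / of_real (a 1)"
| "csol a b z s d (Suc (Suc (Suc n))) =
     ((z - of_real (b (n + 2))) * csol a b z s d (Suc (Suc n)) - of_real (a (n + 1)) * csol a b z s d (Suc n)) / of_real (a (n + 2))"

lemma csol_p: "csol a b (of_real x) 1 0 n = of_real (jacobi_p a b x n)"
  by (induction a b x n rule: jacobi_p.induct) auto

lemma csol_q: "csol a b (of_real x) 0 1 n = of_real (jacobi_q a b x n)"
  by (induction a b x n rule: jacobi_q.induct) auto

lemma cnj_csol: "cnj (csol a b z s d n) = csol a b (cnj z) (cnj s) (cnj d) n"
  by (induction a b z s d n rule: csol.induct) auto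

lemma csol_lin: "csol a b z (s + c * s') (d + c * d') n = csol a b z s d n + c * csol a b z s' d' n"
proof (induction a b z s d n rule: csol.induct)
  case (4 a b z s d n)
  show ?case by (simp only: csol.simps 4) (simp add: algebra_simps add_divide_distrib diff_divide_distrib)
qed (simp_all add: algebra_simps add_divide_distrib diff_divide_distrib)

section \<open>Weyl theory of the recurrence\<close>

locale jacobi_sequence =
  fixes a b :: "nat \<Rightarrow> real"
  assumes a_pos: "\<And>n. n \<ge> 1 \<Longrightarrow> a n > 0"
begin

lemma cjac_csol:
  "cjac a b (csol a b z s d) n = z * csol a b z s d n + (if n = 1 then d else 0)"
proof -
  have nz: "complex_of_real (a (Suc n)) \<noteq> 0" for n using a_pos[of "Suc n"] by simp
  consider "n = 0" | "n = 1" | k where "n = Suc (Suc k)" by (metis One_nat_def not0_implies_Suc)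
  then show ?thesis
  proof cases
    case 2
    then show ?thesis using nz[of 0] by (simp add: cjac_def jac_def numeral_2_eq_2) (simp add: algebra_simps)
  next
    case 3
    then show ?thesis using nz[of "Suc k"]
      by (simp add: cjac_def jac_def) (simp add: algebra_simps)
  qed simp
qed

lemma csol_unique:
  assumes f0: "f 0 = 0" and f: "\<And>n. n \<ge> 1 \<Longrightarrow> cjac a b f n = z * f n"
  shows "f n = csol a b z (f 1) 0 n"
proof -
  let ?u = "csol a b z (f 1) 0"
  have "f n = ?u n \<and> f (Suc n) = ?u (Suc n)" for n
  proof (induction n)
    case 0
    then show ?case using f0 by simp
  next
    case (Suc n)
    have next_term: "of_real (a (Suc n)) * g (Suc (Suc n)) = z * g (Suc n) - of_real (a n) * g n - of_real (b (Suc n)) * g (Suc n)"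
      if "cjac a b g (Suc n) = z * g (Suc n)" for g
      using that unfolding cjac_def jac_Suc by (simp add: algebra_simps)
    have "of_real (a (Suc n)) * f (Suc (Suc n)) = complex_of_real (a (Suc n)) * ?u (Suc (Suc n))"
      using next_term[of f] next_term[of ?u] f[of "Suc n"] Suc by (simp add: cjac_csol del: csol.simps)
    then show ?case using Suc a_pos[of "Suc n"] by (simp del: csol.simps)
  qed
  then show ?thesis by blast
qed

text \<open>Green's formula for two solutions; the inhomogeneities at index \<open>1\<close>
  contribute \<open>d * s' - s * d'\<close>.\<close>

lemma green_csol:
  assumes "K \<ge> 1"
  shows "of_real (a K) * (csol a b z s d (Suc K) * csol a b z' s' d' K - csol a b z s d K * csol a b z' s' d' (Suc K)) =
    (z - z') * (\<Sum>n<Suc K. csol a b z s d n * csol a b z' s' d' n) + d * s' - s * d'"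
proof -
  let ?f = "csol a b z s d" and ?g = "csol a b z' s' d'"
  have "of_real (a K) * (?f (Suc K) * ?g K - ?f K * ?g (Suc K)) =
      (\<Sum>n<Suc K. cjac a b ?f n * ?g n - ?f n * cjac a b ?g n)"
    unfolding cjac_def by (rule jac_green[symmetric]) auto
  also have "\<dots> = (\<Sum>n<Suc K. (z - z') * (?f n * ?g n) + (if n = 1 then d * s' - s * d' else 0))"
    by (intro sum.cong) (auto simp: cjac_csol algebra_simps)
  also have "\<dots> = (z - z') * (\<Sum>n<Suc K. ?f n * ?g n) + (\<Sum>n<Suc K. if n = 1 then d * s' - s * d' else 0)"
    by (simp only: sum.distrib sum_distrib_left)
  also have "(\<Sum>n<Suc K. if n = 1 then d * s' - s * d' else 0) = d * s' - s * d'"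
    using assms by (simp del: sum.lessThan_Suc)
  finally show ?thesis by simp
qed

text \<open>A zero at \<open>N + 1\<close> would remove the boundary term in Green's formula for
  \<open>p(\<i>)\<close> and its conjugate, leaving \<open>2 * \<i>\<close> times a positive sum
  equal to zero.\<close>

lemma csol_p_nonzero:
  assumes "N \<ge> 1"
  shows "csol a b \<i> 1 0 (Suc N) \<noteq> 0"
proof
  let ?p = "csol a b \<i> 1 0"
  have c: "csol a b (- \<i>) 1 0 n = cnj (?p n)" for n by (simp add: cnj_csol)
  assume "?p (Suc N) = 0"
  then have "(\<i> - - \<i>) * (\<Sum>n<Suc N. ?p n * cnj (?p n)) = 0"
    using green_csol[OF assms, of \<i> 1 0 "- \<i>" 1 0] unfolding c by (simp del: csol.simps sum.lessThan_Suc)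
  then have "(\<Sum>n<Suc N. ?p n * cnj (?p n)) = 0" by (simp del: sum.lessThan_Suc)
  then have "complex_of_real (\<Sum>n<Suc N. (cmod (?p n))\<^sup>2) = 0"
    unfolding of_real_sum by (simp only: complex_norm_square)
  then have "(\<Sum>n<Suc N. (cmod (?p n))\<^sup>2) = 0" by (simp only: of_real_eq_0_iff)
  moreover have "(\<Sum>n<Suc N. (cmod (?p n))\<^sup>2) > 0"
    using assms by (intro sum_pos2[of _ 1]) auto
  ultimately show False by simp
qed

text \<open>Weyl's nested discs: \<open>q + m\<^sub>N p\<close> with \<open>m\<^sub>N = - q\<^sub>N\<^sub>+\<^sub>1 / p\<^sub>N\<^sub>+\<^sub>1\<close> is the truncated resolvent applied to
  \<open>e\<^sub>1\<close> at \<open>z = \<i>\<close>, so it has norm at most \<open>1\<close>.\<close>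

lemma l2_csol_q_ii:
  assumes p: "csol a b \<i> 1 0 \<in> l2"
  shows "csol a b \<i> 0 1 \<in> l2"
proof -
  let ?p = "csol a b \<i> 1 0" and ?q = "csol a b \<i> 0 1"
  define C where "C = (\<Sum>n. (cmod (?p n))\<^sup>2)"
  have pC: "(\<Sum>n<K. (cmod (?p n))\<^sup>2) \<le> C" for K
    using p unfolding C_def l2_iff by (intro sum_le_suminf) auto
  have B: "(\<Sum>n<Suc N. (cmod (?q n))\<^sup>2) \<le> 2 + 2 * C" if N: "N \<ge> 1" for N
  proof -
    define m where "m = - (?q (Suc N) / ?p (Suc N))"
    define f where "f = csol a b \<i> m 1"
    have f: "f n = ?q n + m * ?p n" for n
      using csol_lin[of a b \<i> 0 m 1 1 0 n] by (simp add: f_def)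
    have f0: "f (Suc N) = 0" using csol_p_nonzero[OF N] by (simp add: f m_def del: csol.simps)
    have f1: "f 1 = m" by (simp add: f_def)
    have c: "csol a b (- \<i>) (cnj m) 1 n = cnj (f n)" for n by (simp add: f_def cnj_csol)
    define S where "S = (\<Sum>n<Suc N. (cmod (f n))\<^sup>2)"
    have S: "(\<Sum>n<Suc N. f n * cnj (f n)) = of_real S"
      unfolding S_def of_real_sum by (simp only: complex_norm_square)
    have "0 = (\<i> - - \<i>) * (\<Sum>n<Suc N. f n * cnj (f n)) + 1 * cnj m - m * 1"
      using green_csol[OF N, of \<i> m 1 "- \<i>" "cnj m" 1] f0 unfolding c f_def[symmetric]
      by (simp del: csol.simps sum.lessThan_Suc)
    then have "2 * \<i> * of_real S = m - cnj m" unfolding S by (simp add: algebra_simps)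
    \<comment> \<open>Together with \<open>(cmod m)\<^sup>2 \<le> S\<close>, which comes from the
      first component, this bounds both \<open>cmod m\<close> and \<open>S\<close> by
      \<open>1\<close>.\<close>
    then have "S = Im m" by (simp add: complex_eq_iff)
    then have Sm: "S \<le> cmod m" using abs_Im_le_cmod[of m] by linarith
    have "(cmod (f 1))\<^sup>2 \<le> S" unfolding S_def using N by (intro member_le_sum) auto
    then have "cmod m * cmod m \<le> 1 * cmod m" using Sm f1 by (simp add: power2_eq_square)
    then have m1: "cmod m \<le> 1" by (cases "m = 0") auto
    have "(cmod (?q n))\<^sup>2 \<le> 2 * (cmod (f n))\<^sup>2 + 2 * (cmod (?p n))\<^sup>2" for n
    proof -
      have "?q n = f n - m * ?p n" by (simp add: f)
      then have "cmod (?q n) \<le> cmod (f n) + cmod m * cmod (?p n)"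
        by (metis norm_mult norm_triangle_ineq4)
      also have "\<dots> \<le> cmod (f n) + 1 * cmod (?p n)" using m1 by (intro add_left_mono mult_right_mono) auto
      finally have "(cmod (?q n))\<^sup>2 \<le> (cmod (f n) + cmod (?p n))\<^sup>2" by (intro power_mono) auto
      also have "\<dots> \<le> 2 * (cmod (f n))\<^sup>2 + 2 * (cmod (?p n))\<^sup>2"
        using sum_squares_bound[of "cmod (f n)" "cmod (?p n)"] unfolding power2_sum by linarith
      finally show ?thesis .
    qed
    then have "(\<Sum>n<Suc N. (cmod (?q n))\<^sup>2) \<le> (\<Sum>n<Suc N. 2 * (cmod (f n))\<^sup>2 + 2 * (cmod (?p n))\<^sup>2)"
      by (rule sum_mono)
    also have "\<dots> = 2 * S + 2 * (\<Sum>n<Suc N. (cmod (?p n))\<^sup>2)"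
      by (simp only: sum.distrib sum_distrib_left S_def)
    also have "\<dots> \<le> 2 + 2 * C" using Sm m1 pC[of "Suc N"] by linarith
    finally show ?thesis .
  qed
  have b: "(\<Sum>n<Suc (Suc N). (cmod (?q n))\<^sup>2) \<le> 2 + 2 * C" for N
    using B[of "Suc N"] by (simp del: sum.lessThan_Suc csol.simps)
  have "summable (\<lambda>n. (cmod (?q n))\<^sup>2)"
  proof (rule bounded_imp_summable[of _ "2 + 2 * C"])
    fix n
    have "(\<Sum>k\<le>n. (cmod (?q k))\<^sup>2) \<le> (\<Sum>k<Suc (Suc n). (cmod (?q k))\<^sup>2)"
      by (intro sum_mono2) auto
    then show "(\<Sum>k\<le>n. (cmod (?q k))\<^sup>2) \<le> 2 + 2 * C" using b[of n] by linarith
  qed auto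
  then show ?thesis by (simp add: l2_iff)
qed

text \<open>Variation of constants relative to \<open>p(\<i>)\<close> and \<open>q(\<i>)\<close>: the coefficients \<open>X\<close>, \<open>Y\<close> of a
  solution at \<open>0\<close> grow at most by the factors \<open>1 + w\<^sub>n\<^sup>2\<close>, whose product converges.\<close>

lemma l2_csol_zero:
  assumes p: "csol a b \<i> 1 0 \<in> l2"
  shows "csol a b 0 s d \<in> l2"
proof -
  let ?p = "csol a b \<i> 1 0" and ?q = "csol a b \<i> 0 1" and ?u = "csol a b 0 s d"
  have q: "?q \<in> l2" by (rule l2_csol_q_ii[OF p])
  \<comment> \<open>\<open>X\<close> and \<open>Y\<close> are the Wronskians of \<open>u\<close>
    with \<open>p(\<i>)\<close> and \<open>q(\<i>)\<close>; by Green's formula they vary with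
    \<open>K\<close> only because the spectral parameters \<open>0\<close> and \<open>\<i>\<close>
    differ.\<close>
  define X where "X K = d - \<i> * (\<Sum>n<Suc K. ?u n * ?p n)" for K
  define Y where "Y K = - s - \<i> * (\<Sum>n<Suc K. ?u n * ?q n)" for K
  define w where "w n = cmod (?p n) + cmod (?q n)" for n
  have gX: "of_real (a K) * (?u (Suc K) * ?p K - ?u K * ?p (Suc K)) = X K" if "K \<ge> 1" for K
    using green_csol[OF that, of 0 s d \<i> 1 0] by (simp add: X_def del: csol.simps sum.lessThan_Suc)
  have gY: "of_real (a K) * (?u (Suc K) * ?q K - ?u K * ?q (Suc K)) = Y K" if "K \<ge> 1" for K
    using green_csol[OF that, of 0 s d \<i> 0 1] by (simp add: Y_def del: csol.simps sum.lessThan_Suc)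
  have wr: "of_real (a K) * (?p (Suc K) * ?q K - ?p K * ?q (Suc K)) = - 1" if "K \<ge> 1" for K
    using green_csol[OF that, of \<i> 1 0 \<i> 0 1] by (simp del: csol.simps sum.lessThan_Suc)
  have u0: "?u K = X K * ?q K - Y K * ?p K" if "K \<ge> 1" for K
  proof -
    have "X K * ?q K - Y K * ?p K = - ?u K * (of_real (a K) * (?p (Suc K) * ?q K - ?p K * ?q (Suc K)))"
      unfolding gX[OF that, symmetric] gY[OF that, symmetric] by (simp add: algebra_simps del: csol.simps)
    then show ?thesis by (simp add: wr[OF that] del: csol.simps)
  qed
  have step: "X (Suc K) = X K - \<i> * (?u (Suc K) * ?p (Suc K))" "Y (Suc K) = Y K - \<i> * (?u (Suc K) * ?q (Suc K))" for K
    unfolding X_def Y_def sum.lessThan_Suc[of _ "Suc K"] by (simp_all add: algebra_simps del: csol.simps sum.lessThan_Suc)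
  \<comment> \<open>The increments of \<open>X\<close> and \<open>Y\<close> cancel in this
    combination, so the coefficients at \<open>K\<close> already represent the next term. This makes
    the estimate for \<open>R\<close> recursive.\<close>
  have u: "?u (Suc K) = X K * ?q (Suc K) - Y K * ?p (Suc K)" for K
    using u0[of "Suc K"] unfolding step by (simp add: algebra_simps del: csol.simps)
  define R where "R K = cmod (X K) + cmod (Y K)" for K
  have ub: "cmod (?u (Suc K)) \<le> R K * w (Suc K)" for K
  proof -
    have "cmod (?u (Suc K)) \<le> cmod (X K) * cmod (?q (Suc K)) + cmod (Y K) * cmod (?p (Suc K))"
      unfolding u norm_mult[symmetric] by (rule norm_triangle_ineq4)
    also have "\<dots> \<le> R K * w (Suc K)"
      unfolding R_def w_def by (simp add: algebra_simps del: csol.simps)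
    finally show ?thesis .
  qed
  have Rstep: "R (Suc K) \<le> R K * (1 + (w (Suc K))\<^sup>2)" for K
  proof -
    have "cmod (X (Suc K)) \<le> cmod (X K) + cmod (?u (Suc K)) * cmod (?p (Suc K))"
      unfolding step using norm_triangle_ineq4[of "X K" "\<i> * (?u (Suc K) * ?p (Suc K))"] by (simp add: norm_mult del: csol.simps)
    moreover have "cmod (Y (Suc K)) \<le> cmod (Y K) + cmod (?u (Suc K)) * cmod (?q (Suc K))"
      unfolding step using norm_triangle_ineq4[of "Y K" "\<i> * (?u (Suc K) * ?q (Suc K))"] by (simp add: norm_mult del: csol.simps)
    ultimately have "R (Suc K) \<le> R K + cmod (?u (Suc K)) * w (Suc K)"
      unfolding R_def w_def by (simp add: distrib_left del: csol.simps)
    also have "\<dots> \<le> R K + R K * w (Suc K) * w (Suc K)"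
      using ub[of K] by (intro add_left_mono mult_right_mono) (auto simp: w_def)
    finally show ?thesis by (simp add: algebra_simps power2_eq_square)
  qed
  have sw: "summable (\<lambda>n. (w n)\<^sup>2)"
  proof (rule summable_comparison_test'[where N = 0])
    show "summable (\<lambda>n. 2 * (cmod (?p n))\<^sup>2 + 2 * (cmod (?q n))\<^sup>2)"
      using p q by (intro summable_add summable_mult) (auto simp: l2_iff)
    show "norm ((w n)\<^sup>2) \<le> 2 * (cmod (?p n))\<^sup>2 + 2 * (cmod (?q n))\<^sup>2" for n
      using sum_squares_bound[of "cmod (?p n)" "cmod (?q n)"] unfolding w_def power2_sum by simp
  qed
  have Rb: "R K \<le> R 0 * exp (\<Sum>n<Suc K. (w n)\<^sup>2)" for K
  proof (induction K)
    case 0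
    have "0 \<le> R 0" by (simp add: R_def)
    then show ?case by (simp add: mult_le_cancel_left1 w_def)
  next
    case (Suc K)
    have "R (Suc K) \<le> R K * (1 + (w (Suc K))\<^sup>2)" by (rule Rstep)
    also have "\<dots> \<le> (R 0 * exp (\<Sum>n<Suc K. (w n)\<^sup>2)) * exp ((w (Suc K))\<^sup>2)"
      using Suc exp_ge_add_one_self[of "(w (Suc K))\<^sup>2"] by (intro mult_mono) (auto simp: R_def)
    also have "\<dots> = R 0 * exp (\<Sum>n<Suc (Suc K). (w n)\<^sup>2)"
      by (simp add: exp_add)
    finally show ?case .
  qed
  define C where "C = R 0 * exp (\<Sum>n. (w n)\<^sup>2)"
  have RC: "R K \<le> C" for K
  proof -
    have "(\<Sum>n<Suc K. (w n)\<^sup>2) \<le> (\<Sum>n. (w n)\<^sup>2)" using sw by (intro sum_le_suminf) auto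
    then have "R 0 * exp (\<Sum>n<Suc K. (w n)\<^sup>2) \<le> C"
      unfolding C_def by (intro mult_left_mono) (auto simp: R_def)
    then show ?thesis using Rb[of K] by linarith
  qed
  have "summable (\<lambda>n. (cmod (?u n))\<^sup>2)"
  proof (rule summable_comparison_test'[where N = 1])
    show "summable (\<lambda>n. C\<^sup>2 * (w n)\<^sup>2)" using sw by (rule summable_mult)
    fix n :: nat assume "1 \<le> n"
    then obtain K where n: "n = Suc K" by (cases n) auto
    have "cmod (?u n) \<le> C * w n"
      using ub[of K] mult_right_mono[OF RC[of K], of "w n"] unfolding n by (force simp: w_def simp del: csol.simps)
    then have "(cmod (?u n))\<^sup>2 \<le> (C * w n)\<^sup>2" by (intro power_mono) auto
    then show "norm ((cmod (?u n))\<^sup>2) \<le> C\<^sup>2 * (w n)\<^sup>2" by (simp add: power_mult_distrib)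
  qed
  then show ?thesis by (simp add: l2_iff)
qed

end

lemma csol_0_0 [simp]: "csol a b z 0 0 n = 0"
  by (induction a b z "0::complex" "0::complex" n rule: csol.induct) auto

lemma csol_scale: "csol a b z c 0 n = c * csol a b z 1 0 n"
  using csol_lin[of a b z 0 c 1 0 0 n] by simp

lemma has_dimension_0: "has_dimension {\<lambda>n. 0} 0"
  by (auto simp: has_dimension_def)

lemma has_dimension_1:
  assumes "v m \<noteq> 0"
  shows "has_dimension {(\<lambda>n. c * v n) | c. True} 1"
proof -
  have s: "(\<Sum>i<(1::nat). c i * v n) = c 0 * v n" for c :: "nat \<Rightarrow> complex" and n by simp
  have "{(\<lambda>n. c * v n) | c. True} = {(\<lambda>n. c 0 * v n) | c :: nat \<Rightarrow> complex. True}"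
  proof (intro Set.set_eqI iffI)
    fix f assume "f \<in> {(\<lambda>n. c * v n) | c. True}"
    then obtain c where "f = (\<lambda>n. c * v n)" by auto
    then show "f \<in> {(\<lambda>n. c 0 * v n) | c :: nat \<Rightarrow> complex. True}"
      by (auto intro!: exI[of _ "\<lambda>_. c"])
  qed auto
  moreover have "\<forall>c :: nat \<Rightarrow> complex. (\<forall>n. c 0 * v n = 0) \<longrightarrow> (\<forall>i<1. c i = 0)"
    using assms by auto
  ultimately show ?thesis
    unfolding has_dimension_def by (intro exI[of _ "\<lambda>_. v"]) (simp only: s)
qed

context jacobi_sequence
begin

text \<open>The recurrence leaves \<open>f 1\<close> as the only free parameter, so the dimension
  depends just on whether \<open>p(z)\<close> is square-summable.\<close>

lemma eigenspace_adjoint: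
  "eigenspace (op_adjoint (jacobi_op a b)) z =
    (if csol a b z 1 0 \<in> l2 then {(\<lambda>n. c * csol a b z 1 0 n) | c. True} else {\<lambda>n. 0})"
proof -
  have e: "f \<in> eigenspace (op_adjoint (jacobi_op a b)) z \<longleftrightarrow> f \<in> l2 \<and> (\<lambda>n. z * f n) = cjac a b f" for f
    using l2_scale[of f z] by (auto simp: eigenspace_def op_adjoint_jacobi_op_iff)
  have 1: "f = (\<lambda>n. f 1 * csol a b z 1 0 n)" if "f \<in> eigenspace (op_adjoint (jacobi_op a b)) z" for f
  proof
    fix n
    have "f 0 = 0" using that by (simp add: e l2_iff)
    moreover have "cjac a b f n = z * f n" for n using that unfolding e by (metis)
    ultimately have "f n = csol a b z (f 1) 0 n" by (rule csol_unique)
    then show "f n = f 1 * csol a b z 1 0 n" by (simp only: csol_scale[of a b z "f 1"])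
  qed
  have 2: "(\<lambda>n. c * csol a b z 1 0 n) \<in> eigenspace (op_adjoint (jacobi_op a b)) z" if "csol a b z 1 0 \<in> l2" for c
  proof -
    have "cjac a b (\<lambda>n. c * csol a b z 1 0 n) = (\<lambda>n. z * (c * csol a b z 1 0 n))"
    proof
      fix n
      have "cjac a b (\<lambda>n. 0) n = 0" by (simp add: cjac_def jac_def)
      then show "cjac a b (\<lambda>n. c * csol a b z 1 0 n) n = z * (c * csol a b z 1 0 n)"
        using fun_cong[OF cjac_lin[of a b "\<lambda>n. 0" c "csol a b z 1 0"], of n] by (simp add: cjac_csol)
    qed
    then show ?thesis unfolding e using that by (simp add: l2_scale)
  qed
  show ?thesis
  proof (cases "csol a b z 1 0 \<in> l2")
    case True
    then show ?thesis using 1 2 by auto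
  next
    case False
    have "f = (\<lambda>n. 0)" if f: "f \<in> eigenspace (op_adjoint (jacobi_op a b)) z" for f
    proof -
      have "f 1 = 0"
      proof (rule ccontr)
        assume "f 1 \<noteq> 0"
        have "(\<lambda>n. inverse (f 1) * f n) \<in> l2" using f by (simp add: e l2_scale)
        moreover have "(\<lambda>n. inverse (f 1) * f n) = csol a b z 1 0"
        proof
          fix n
          show "inverse (f 1) * f n = csol a b z 1 0 n"
            using fun_cong[OF 1[OF f], of n] \<open>f 1 \<noteq> 0\<close> by (simp add: field_simps)
        qed
        ultimately show False using False by simp
      qed
      then show ?thesis using 1[OF f] by simp
    qed
    moreover have "(\<lambda>n. 0) \<in> eigenspace (op_adjoint (jacobi_op a b)) z"
      by (simp add: e cjac_def jac_def fun_eq_iff)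
    ultimately have "eigenspace (op_adjoint (jacobi_op a b)) z = {\<lambda>n. 0}" by blast
    then show ?thesis by (simp only: False if_False)
  qed
qed

lemma l2_csol_minus_ii: "csol a b (- \<i>) 1 0 \<in> l2 \<longleftrightarrow> csol a b \<i> 1 0 \<in> l2"
proof -
  have "cmod (csol a b (- \<i>) 1 0 n) = cmod (csol a b \<i> 1 0 n)" for n
    using arg_cong[OF cnj_csol[of a b \<i> 1 0 n], of cmod] by simp
  then show ?thesis by (simp add: l2_iff)
qed

text \<open>Conjugation identifies the conditions at \<open>\<i>\<close> and \<open>- \<i>\<close>,
  so the deficiency indices are \<open>(0, 0)\<close> or \<open>(1, 1)\<close>.\<close>

lemma limit_circle_alternative:
  assumes "\<not> limit_point a b"
  shows "csol a b \<i> 1 0 \<in> l2" "limit_circle a b"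
proof -
  show p: "csol a b \<i> 1 0 \<in> l2"
  proof (rule ccontr)
    assume "csol a b \<i> 1 0 \<notin> l2"
    then have "limit_point a b"
      by (simp add: limit_point_def deficiency_indices_def eigenspace_adjoint l2_csol_minus_ii has_dimension_0)
    with assms show False ..
  qed
  have "has_dimension {(\<lambda>n. c * csol a b z 1 0 n) | c. True} 1" for z
    by (rule has_dimension_1[of _ 1]) simp
  then show "limit_circle a b"
    using p by (simp add: limit_circle_def deficiency_indices_def eigenspace_adjoint l2_csol_minus_ii)
qed

end

section \<open>Convergence of graphs\<close>

definition truncate :: "nat \<Rightarrow> (nat \<Rightarrow> complex) \<Rightarrow> nat \<Rightarrow> complex" where
  "truncate N f = (\<lambda>n. if n \<le> N then f n else 0)"

lemma truncate_l2: "f \<in> l2 \<Longrightarrow> truncate N f \<in> l2"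
  by (intro finite_sequences_l2 finite_sequences_truncated[of _ N]) (auto simp: truncate_def l2_iff)

lemma truncate_lin: "truncate N (\<lambda>n. f n + c * g n) = (\<lambda>n. truncate N f n + c * truncate N g n)"
  by (auto simp: truncate_def)

lemma l2_norm_truncate_le:
  assumes "f \<in> l2"
  shows "l2_norm (truncate N f) \<le> l2_norm f"
proof -
  have "(\<Sum>n. (cmod (truncate N f n))\<^sup>2) \<le> (\<Sum>n. (cmod (f n))\<^sup>2)"
    using assms truncate_l2[OF assms, of N] by (intro suminf_le) (auto simp: l2_iff truncate_def)
  then show ?thesis by (simp add: l2_norm_def)
qed

lemma l2_tendsto_truncate:
  assumes "f \<in> l2"
  shows "l2_tendsto (\<lambda>N. truncate N f) f"
proof -
  have s: "summable (\<lambda>n. (cmod (f n))\<^sup>2)" using assms by (simp add: l2_iff)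
  have eq: "(\<Sum>n. (cmod (truncate N f n - f n))\<^sup>2) = (\<Sum>n. (cmod (f n))\<^sup>2) - (\<Sum>n<Suc N. (cmod (f n))\<^sup>2)" for N
  proof -
    have "(\<lambda>n. if n \<in> {..<Suc N} then (cmod (f n))\<^sup>2 else 0) sums (\<Sum>n<Suc N. (cmod (f n))\<^sup>2)"
      by (rule sums_If_finite_set) simp
    then have "(\<lambda>n. (cmod (f n))\<^sup>2 - (if n \<in> {..<Suc N} then (cmod (f n))\<^sup>2 else 0)) sums
        ((\<Sum>n. (cmod (f n))\<^sup>2) - (\<Sum>n<Suc N. (cmod (f n))\<^sup>2))"
      by (intro sums_diff summable_sums s)
    moreover have "(cmod (f n))\<^sup>2 - (if n \<in> {..<Suc N} then (cmod (f n))\<^sup>2 else 0) = (cmod (truncate N f n - f n))\<^sup>2" for n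
      by (auto simp: truncate_def)
    ultimately show ?thesis by (simp add: sums_iff)
  qed
  have "(\<lambda>N. (\<Sum>n<Suc N. (cmod (f n))\<^sup>2)) \<longlonglongrightarrow> (\<Sum>n. (cmod (f n))\<^sup>2)"
    using summable_LIMSEQ[OF s] by (rule LIMSEQ_Suc)
  then have "(\<lambda>N. sqrt ((\<Sum>n. (cmod (f n))\<^sup>2) - (\<Sum>n<Suc N. (cmod (f n))\<^sup>2))) \<longlonglongrightarrow> sqrt ((\<Sum>n. (cmod (f n))\<^sup>2) - (\<Sum>n. (cmod (f n))\<^sup>2))"
    by (intro tendsto_intros)
  then show ?thesis unfolding l2_tendsto_def l2_norm_def eq by simp
qed

text \<open>Graph convergence of the truncations at \<open>(f, h)\<close>: for \<open>\<phi>\<close>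
  supported in the first \<open>N\<close> indices, \<open>truncate N (cjac a b \<phi>)\<close> is
  the \<open>N\<close>-th block applied to \<open>\<phi>\<close>. Quantifying over \<open>e\<close>
  instead of fixing a sequence suits closures and linear combinations.\<close>

definition approximable :: "(nat \<Rightarrow> real) \<Rightarrow> (nat \<Rightarrow> real) \<Rightarrow> (nat \<Rightarrow> complex) \<Rightarrow> (nat \<Rightarrow> complex) \<Rightarrow> bool" where
  "approximable a b f h \<longleftrightarrow> (\<forall>e>0. \<forall>\<^sub>F N in sequentially. \<exists>\<phi>. \<phi> 0 = 0 \<and> truncate N \<phi> = \<phi> \<and>
     l2_norm (\<lambda>n. \<phi> n - f n) < e \<and> l2_norm (\<lambda>n. truncate N (cjac a b \<phi>) n - h n) < e)"

lemma truncate_finite: "f 0 = 0 \<Longrightarrow> truncate N f \<in> finite_sequences"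
  by (rule finite_sequences_truncated[of _ N]) (auto simp: truncate_def)

lemma approximable_lin:
  assumes fh: "approximable a b f h" "f \<in> l2" "h \<in> l2"
    and fh': "approximable a b f' h'" "f' \<in> l2" "h' \<in> l2"
  shows "approximable a b (\<lambda>n. f n + c * f' n) (\<lambda>n. h n + c * h' n)"
  unfolding approximable_def
proof (intro allI impI)
  fix e :: real assume "e > 0"
  define d where "d = e / (1 + cmod c)"
  have d: "d > 0" using \<open>e > 0\<close> by (simp add: d_def add_pos_nonneg)
  have de: "d + cmod c * d = e"
  proof -
    have "d * (1 + cmod c) = e" unfolding d_def by (simp add: add_pos_nonneg order.strict_implies_not_eq[symmetric])
    then show ?thesis by (simp add: algebra_simps)
  qed
  from fh(1)[unfolded approximable_def, rule_format, OF d] fh'(1)[unfolded approximable_def, rule_format, OF d]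
  show "\<forall>\<^sub>F N in sequentially. \<exists>\<phi>. \<phi> 0 = 0 \<and> truncate N \<phi> = \<phi> \<and>
     l2_norm (\<lambda>n. \<phi> n - (f n + c * f' n)) < e \<and>
     l2_norm (\<lambda>n. truncate N (cjac a b \<phi>) n - (h n + c * h' n)) < e"
  proof eventually_elim
    case (elim N)
    then obtain \<phi> \<psi> where \<phi>: "\<phi> 0 = 0" "truncate N \<phi> = \<phi>" "l2_norm (\<lambda>n. \<phi> n - f n) < d"
        "l2_norm (\<lambda>n. truncate N (cjac a b \<phi>) n - h n) < d"
      and \<psi>: "\<psi> 0 = 0" "truncate N \<psi> = \<psi>" "l2_norm (\<lambda>n. \<psi> n - f' n) < d"
        "l2_norm (\<lambda>n. truncate N (cjac a b \<psi>) n - h' n) < d" by blast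
    have comb: "l2_norm (\<lambda>n. x n + c * y n - (x' n + c * y' n)) < e"
      if "l2_norm (\<lambda>n. x n - x' n) < d" "l2_norm (\<lambda>n. y n - y' n) < d"
        "x \<in> l2" "x' \<in> l2" "y \<in> l2" "y' \<in> l2" for x y x' y'
    proof -
      have "(\<lambda>n. x n + c * y n - (x' n + c * y' n)) = (\<lambda>n. (x n - x' n) + c * (y n - y' n))"
        by (simp add: algebra_simps)
      then have "l2_norm (\<lambda>n. x n + c * y n - (x' n + c * y' n)) \<le>
          l2_norm (\<lambda>n. x n - x' n) + cmod c * l2_norm (\<lambda>n. y n - y' n)"
        using l2_norm_lin[OF l2_diff[OF that(3,4)] l2_diff[OF that(5,6)], of c] by simp
      also have "\<dots> < d + cmod c * d"
        using that(1,2) by (intro add_less_le_mono mult_left_mono) auto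
      finally show ?thesis unfolding de .
    qed
    have fin: "truncate N x \<in> l2" if "x 0 = 0" for x
      using that by (intro finite_sequences_l2 truncate_finite)
    have l: "\<phi> \<in> l2" "\<psi> \<in> l2" using fin[of \<phi>] fin[of \<psi>] \<phi>(1,2) \<psi>(1,2) by auto
    let ?\<chi> = "\<lambda>n. \<phi> n + c * \<psi> n"
    have "truncate N ?\<chi> = ?\<chi>" unfolding truncate_lin \<phi>(2) \<psi>(2) ..
    moreover have "l2_norm (\<lambda>n. ?\<chi> n - (f n + c * f' n)) < e"
      by (rule comb[OF \<phi>(3) \<psi>(3) l(1) fh(2) l(2) fh'(2)])
    moreover have "l2_norm (\<lambda>n. truncate N (cjac a b ?\<chi>) n - (h n + c * h' n)) < e"
      unfolding cjac_lin truncate_lin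
      by (rule comb[OF \<phi>(4) \<psi>(4) fin fh(3) fin fh'(3)]) simp_all
    ultimately show ?case using \<phi>(1) \<psi>(1) by (intro exI[of _ ?\<chi>]) simp
  qed
qed

text \<open>A finitely supported element near \<open>f\<close> is its own truncation as soon as
  \<open>N\<close> exceeds its support and that of its image.\<close>

lemma approximable_closure:
  assumes "(f, h) \<in> op_closure (jacobi_op a b)"
  shows "approximable a b f h"
  unfolding approximable_def
proof (intro allI impI)
  fix e :: real assume e: "e > 0"
  obtain F G where FG: "\<And>k. (F k, G k) \<in> jacobi_op a b" "l2_tendsto F f" "l2_tendsto G h"
    using assms by (auto simp: op_closure_def)
  have "\<forall>\<^sub>F k in sequentially. l2_norm (\<lambda>n. F k n - f n) < e \<and> l2_norm (\<lambda>n. G k n - h n) < e"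
    using order_tendstoD(2)[OF FG(2)[unfolded l2_tendsto_def] e] order_tendstoD(2)[OF FG(3)[unfolded l2_tendsto_def] e]
    by (rule eventually_conj)
  then obtain k where k: "l2_norm (\<lambda>n. F k n - f n) < e" "l2_norm (\<lambda>n. G k n - h n) < e"
    by (auto simp: eventually_sequentially)
  have G: "G k = cjac a b (F k)" "F k \<in> finite_sequences" using FG(1)[of k] by (auto simp: jacobi_op_iff)
  have "G k \<in> finite_sequences" using G finite_sequences_cjac by auto
  with G obtain K L where K: "\<forall>n>K. F k n = 0" and L: "\<forall>n>L. G k n = 0" and F0: "F k 0 = 0"
    by (auto simp: finite_sequences_iff)
  show "\<forall>\<^sub>F N in sequentially. \<exists>\<phi>. \<phi> 0 = 0 \<and> truncate N \<phi> = \<phi> \<and> l2_norm (\<lambda>n. \<phi> n - f n) < e \<and>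
      l2_norm (\<lambda>n. truncate N (cjac a b \<phi>) n - h n) < e"
    using eventually_ge_at_top[of "max K L"]
  proof eventually_elim
    case (elim N)
    have "truncate N (F k) = F k" using K elim by (auto simp: truncate_def fun_eq_iff)
    moreover have "truncate N (cjac a b (F k)) = G k"
      unfolding G(1)[symmetric] using L elim by (auto simp: truncate_def fun_eq_iff)
    ultimately show ?case using k F0 by (intro exI[of _ "F k"]) simp
  qed
qed

lemma l2_norm_single: "l2_norm (\<lambda>n. if n = m then c else 0) = cmod c"
proof -
  have "(\<Sum>n. (cmod (if n = m then c else 0))\<^sup>2) = (\<Sum>n\<in>{m}. (cmod (if n = m then c else 0))\<^sup>2)"
    by (rule suminf_finite) auto
  then show ?thesis by (simp add: l2_norm_def)
qed

context jacobi_sequence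
begin

text \<open>Cutting a solution off after \<open>N\<close> disturbs row \<open>N\<close> unless the
  solution vanishes at \<open>N + 1\<close>. The solutions with parameters \<open>s N\<close>,
  \<open>d N\<close> do vanish there, and they converge in norm because every solution at
  \<open>0\<close> is square-summable.\<close>

lemma approximable_csol:
  assumes p: "csol a b \<i> 1 0 \<in> l2"
    and s: "s \<longlonglongrightarrow> s0" and d: "d \<longlonglongrightarrow> d0"
    and z: "\<forall>\<^sub>F N in sequentially. csol a b 0 (s N) (d N) (Suc N) = 0"
  shows "approximable a b (csol a b 0 s0 d0) (\<lambda>n. if n = 1 then d0 else 0)"
  unfolding approximable_def
proof (intro allI impI)
  fix e :: real assume e: "e > 0"
  note l2 = l2_csol_zero[OF p]
  let ?v = "csol a b 0 s0 d0" and ?P = "csol a b 0 1 0" and ?Q = "csol a b 0 0 1"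
  have lim: "(\<lambda>N. cmod (s N - s0) * l2_norm ?P + cmod (d N - d0) * l2_norm ?Q + l2_norm (\<lambda>n. truncate N ?v n - ?v n)) \<longlonglongrightarrow> 0"
    using l2_tendsto_truncate[OF l2[of s0 d0]] s d unfolding l2_tendsto_def
    by (auto intro!: tendsto_eq_intros)
  have dlim: "(\<lambda>N. cmod (d N - d0)) \<longlonglongrightarrow> 0" using d by (auto intro!: tendsto_eq_intros)
  show "\<forall>\<^sub>F N in sequentially. \<exists>\<phi>. \<phi> 0 = 0 \<and> truncate N \<phi> = \<phi> \<and> l2_norm (\<lambda>n. \<phi> n - ?v n) < e \<and>
      l2_norm (\<lambda>n. truncate N (cjac a b \<phi>) n - (if n = 1 then d0 else 0)) < e"
    using order_tendstoD(2)[OF lim e] order_tendstoD(2)[OF dlim e] z eventually_ge_at_top[of 1]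
  proof eventually_elim
    case (elim N)
    let ?g = "csol a b 0 (s N) (d N)" and ?\<phi> = "truncate N (csol a b 0 (s N) (d N))"
    have "?g n = ?v n + (s N - s0) * ?P n + (d N - d0) * ?Q n" for n
      using csol_lin[of a b 0 s0 "s N - s0" 1 d0 0 n] csol_lin[of a b 0 "s N" "d N - d0" 0 d0 1 n] by simp
    then have "(\<lambda>n. ?g n - ?v n) = (\<lambda>n. (s N - s0) * ?P n + (d N - d0) * ?Q n)" by simp
    then have gv: "l2_norm (\<lambda>n. ?g n - ?v n) \<le> cmod (s N - s0) * l2_norm ?P + cmod (d N - d0) * l2_norm ?Q"
      using l2_norm_lin[OF l2_scale[OF l2] l2, of "s N - s0" 1 0 "d N - d0" 0 1] l2_norm_scale[OF l2, of "s N - s0" 1 0] by simp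
    have e1: "(\<lambda>n. ?\<phi> n - ?v n) = (\<lambda>n. truncate N (\<lambda>n. ?g n - ?v n) n + (truncate N ?v n - ?v n))"
      by (auto simp: truncate_def)
    have "l2_norm (\<lambda>n. ?\<phi> n - ?v n) \<le> l2_norm (truncate N (\<lambda>n. ?g n - ?v n)) + l2_norm (\<lambda>n. truncate N ?v n - ?v n)"
      unfolding e1 by (intro l2_norm_triangle truncate_l2 l2_diff l2)
    also have "\<dots> \<le> l2_norm (\<lambda>n. ?g n - ?v n) + l2_norm (\<lambda>n. truncate N ?v n - ?v n)"
      by (intro add_right_mono l2_norm_truncate_le l2_diff l2)
    also have "\<dots> < e" using gv elim(1) by linarith
    finally have "l2_norm (\<lambda>n. ?\<phi> n - ?v n) < e" .
    moreover have "l2_norm (\<lambda>n. truncate N (cjac a b ?\<phi>) n - (if n = 1 then d0 else 0)) < e"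
    proof -
      have "cjac a b ?\<phi> n = cjac a b ?g n" if "n \<le> N" for n
        using that elim(3) unfolding cjac_def jac_def truncate_def by (cases "n = N") auto
      then have "(\<lambda>n. truncate N (cjac a b ?\<phi>) n - (if n = 1 then d0 else 0)) = (\<lambda>n. if n = 1 then d N - d0 else 0)"
        using elim(4) by (auto simp: truncate_def cjac_csol)
      then show ?thesis using elim(2) by (simp add: l2_norm_single)
    qed
    moreover have "?\<phi> 0 = 0" "truncate N ?\<phi> = ?\<phi>" by (auto simp: truncate_def)
    ultimately show ?case by blast
  qed
qed

text \<open>The sequence \<open>s\<^sub>N\<close>, \<open>d\<^sub>N\<close> of \<open>approximable_csol\<close> that makes the solution vanish at \<open>N + 1\<close> is
  \<open>(- q\<^sub>N\<^sub>+\<^sub>1(0) / p\<^sub>N\<^sub>+\<^sub>1(0), 1)\<close> for \<open>\<alpha> \<in> \<real>\<close> and \<open>(1, - p\<^sub>N\<^sub>+\<^sub>1(0) / q\<^sub>N\<^sub>+\<^sub>1(0))\<close> for \<open>\<alpha> = \<infinity>\<close>.\<close>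

lemma approximable_boundary_vector:
  assumes p: "csol a b \<i> 1 0 \<in> l2" and \<alpha>: "is_boundary_parameter a b \<alpha>"
  shows "boundary_vector a b \<alpha> \<in> l2"
    and "approximable a b (boundary_vector a b \<alpha>) (cjac a b (boundary_vector a b \<alpha>))"
proof -
  let ?p = "jacobi_p a b 0" and ?q = "jacobi_q a b 0"
  let ?m = "\<lambda>n. if ?p n = 0 then None else Some (- (?q n / ?p n))"
  have sol: "csol a b 0 s d n = d * of_real (?q n) + s * of_real (?p n)" for s d n
    using csol_lin[of a b 0 0 s 1 d 0 n] csol_lin[of a b 0 0 d 0 0 1 n] csol_p[of a b 0 n] csol_q[of a b 0 n] by simp
  have lim: "limitin (Alexandroff_compactification euclideanreal) ?m \<alpha> sequentially"
    using \<alpha> by (simp add: is_boundary_parameter_def)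
  have pq: "?p (Suc N) \<noteq> 0 \<or> ?q (Suc N) \<noteq> 0" for N
  proof (cases "N = 0")
    case False
    then show ?thesis
      using green_csol[of N 0 1 0 0 0 1] csol_p[of a b 0 "Suc N"] csol_q[of a b 0 "Suc N"]
      by (auto simp del: csol.simps jacobi_p.simps jacobi_q.simps)
  qed simp
  have "boundary_vector a b \<alpha> \<in> l2 \<and> approximable a b (boundary_vector a b \<alpha>) (cjac a b (boundary_vector a b \<alpha>))"
  proof (cases \<alpha>)
    case (Some r)
    have v: "boundary_vector a b \<alpha> = csol a b 0 (of_real r) 1"
      by (simp add: Some boundary_vector_def sol fun_eq_iff del: csol.simps)
    \<comment> \<open>A finite limit has neighbourhoods avoiding \<open>None\<close>, so
      \<open>?p n\<close> is eventually nonzero.\<close>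
    have ev: "\<forall>\<^sub>F n in sequentially. ?p n \<noteq> 0 \<and> - (?q n / ?p n) \<in> U" if "open U" "r \<in> U" for U
    proof -
      have "openin (Alexandroff_compactification euclideanreal) (Some ` U)"
        using that by (auto simp: openin_Alexandroff_compactification)
      then have "\<forall>\<^sub>F n in sequentially. ?m n \<in> Some ` U"
        using lim that by (auto simp: limitin_def Some)
      then show ?thesis by eventually_elim (auto split: if_splits)
    qed
    define s where "s N = complex_of_real (- (?q (Suc N) / ?p (Suc N)))" for N
    have "(\<lambda>n. - (?q n / ?p n)) \<longlonglongrightarrow> r"
    proof (rule topological_tendstoI)
      fix U assume "open U" "r \<in> U"
      then show "\<forall>\<^sub>F n in sequentially. - (?q n / ?p n) \<in> U"
        using ev[of U] by (simp add: eventually_conj_iff)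
    qed
    then have "s \<longlonglongrightarrow> of_real r"
      unfolding s_def by (intro tendsto_of_real LIMSEQ_Suc)
    moreover have "\<forall>\<^sub>F N in sequentially. csol a b 0 (s N) 1 (Suc N) = 0"
    proof -
      have "\<forall>\<^sub>F n in sequentially. ?p (Suc n) \<noteq> 0"
        using ev[of UNIV] by (subst eventually_sequentially_Suc) simp
      then show ?thesis by eventually_elim (simp add: sol s_def del: csol.simps jacobi_p.simps jacobi_q.simps)
    qed
    ultimately have "approximable a b (csol a b 0 (of_real r) 1) (\<lambda>n. if n = 1 then 1 else 0)"
      by (intro approximable_csol[OF p]) auto
    moreover have "cjac a b (csol a b 0 (of_real r) 1) = (\<lambda>n. if n = 1 then 1 else 0)"
      by (simp add: cjac_csol fun_eq_iff)
    ultimately show ?thesis using l2_csol_zero[OF p] by (simp add: v)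
  next
    case None
    have v: "boundary_vector a b \<alpha> = csol a b 0 1 0"
      by (simp add: None boundary_vector_def sol fun_eq_iff del: csol.simps)
    \<comment> \<open>Complements of compact intervals, with \<open>None\<close> added, are the
      neighbourhoods of infinity; a zero of \<open>?p n\<close> counts as the value
      infinity.\<close>
    have ev: "\<forall>\<^sub>F n in sequentially. ?p n = 0 \<or> K < \<bar>?q n / ?p n\<bar>" for K
    proof -
      have "openin (Alexandroff_compactification euclideanreal) (insert None (Some ` (UNIV - {-K..K})))"
        unfolding openin_Alexandroff_compactification by (rule disjI2, rule exI[of _ "{-K..K}"]) auto
      then have "\<forall>\<^sub>F n in sequentially. ?m n \<in> insert None (Some ` (UNIV - {-K..K}))"
        using lim unfolding limitin_def None by blast
      then show ?thesis by eventually_elim (auto simp: abs_if split: if_splits)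
    qed
    define d where "d N = complex_of_real (- (?p (Suc N) / ?q (Suc N)))" for N
    have "(\<lambda>N. ?p (Suc N) / ?q (Suc N)) \<longlonglongrightarrow> 0"
    proof (rule tendstoI)
      fix e :: real assume e: "e > 0"
      have "\<forall>\<^sub>F N in sequentially. ?p (Suc N) = 0 \<or> 1 / e < \<bar>?q (Suc N) / ?p (Suc N)\<bar>"
        using ev[of "1 / e"] by (subst eventually_sequentially_Suc)
      then show "\<forall>\<^sub>F N in sequentially. dist (?p (Suc N) / ?q (Suc N)) 0 < e"
      proof eventually_elim
        case (elim N)
        show ?case
        proof (cases "?p (Suc N) = 0")
          case False
          then have *: "1 / e < \<bar>?q (Suc N) / ?p (Suc N)\<bar>" using elim by simp
          have "inverse \<bar>?q (Suc N) / ?p (Suc N)\<bar> < inverse (1 / e)"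
            using * e by (intro less_imp_inverse_less) auto
          then show ?thesis by (simp add: dist_real_def abs_divide del: jacobi_p.simps jacobi_q.simps)
        qed (use e in simp)
      qed
    qed
    then have "d \<longlonglongrightarrow> of_real (- 0)"
      unfolding d_def by (intro tendsto_of_real tendsto_minus)
    then have "d \<longlonglongrightarrow> 0" by simp
    moreover have "\<forall>\<^sub>F N in sequentially. csol a b 0 1 (d N) (Suc N) = 0"
    proof -
      have "\<forall>\<^sub>F N in sequentially. ?p (Suc N) = 0 \<or> 0 < \<bar>?q (Suc N) / ?p (Suc N)\<bar>"
        using ev[of 0] by (subst eventually_sequentially_Suc)
      then show ?thesis
      proof eventually_elim
        case (elim N)
        then have "?q (Suc N) \<noteq> 0" using pq[of N] by (auto simp del: jacobi_p.simps jacobi_q.simps)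
        then show ?case by (simp add: sol d_def del: csol.simps jacobi_p.simps jacobi_q.simps)
      qed
    qed
    ultimately have "approximable a b (csol a b 0 1 0) (\<lambda>n. if n = 1 then 0 else 0)"
      by (intro approximable_csol[OF p]) auto
    moreover have "cjac a b (csol a b 0 1 0) = (\<lambda>n. if n = 1 then 0 else 0)"
      by (simp add: cjac_csol fun_eq_iff)
    ultimately show ?thesis using l2_csol_zero[OF p] by (simp add: v)
  qed
  then show "boundary_vector a b \<alpha> \<in> l2"
    "approximable a b (boundary_vector a b \<alpha>) (cjac a b (boundary_vector a b \<alpha>))" by auto
qed

text \<open>In the limit circle case every domain element is one from the closure plus a multiple of
  the boundary vector, and graph convergence is linear.\<close>

lemma approximable_realization:
  assumes \<alpha>: "limit_circle a b \<Longrightarrow> is_boundary_parameter a b \<alpha>"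
    and fh: "(f, h) \<in> jacobi_realization a b \<alpha>"
  shows "approximable a b f h"
proof (cases "limit_point a b")
  case True
  then show ?thesis using fh approximable_closure by (simp add: jacobi_realization_def)
next
  case False
  let ?v = "boundary_vector a b \<alpha>"
  have p: "csol a b \<i> 1 0 \<in> l2" and bp: "is_boundary_parameter a b \<alpha>"
    using limit_circle_alternative[OF False] \<alpha> by auto
  note v = approximable_boundary_vector[OF p bp]
  have h: "h = cjac a b f"
    using fh jacobi_realization_subset_adjoint[of a b \<alpha>] op_adjoint_jacobi_op_iff by blast
  obtain f' c g' where f: "f = (\<lambda>n. f' n + c * ?v n)" and fg: "(f', g') \<in> op_closure (jacobi_op a b)"
    using fh False by (auto simp: jacobi_realization_def op_restrict_def)
  have g': "f' \<in> l2" "g' \<in> l2" "g' = cjac a b f'"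
    using fg op_closure_jacobi_op_cjac[OF fg] by (auto simp: op_closure_def)
  have cv: "cjac a b ?v \<in> l2"
  proof -
    have "\<exists>s d. ?v = csol a b 0 s d"
    proof (cases \<alpha>)
      case None
      then show ?thesis using csol_p[of a b 0] by (intro exI[of _ 1] exI[of _ 0]) (auto simp: boundary_vector_def)
    next
      case (Some r)
      have "?v n = csol a b 0 (of_real r) 1 n" for n
        using csol_lin[of a b 0 0 "of_real r" 1 1 0 n] csol_p[of a b 0 n] csol_q[of a b 0 n]
        by (simp add: boundary_vector_def Some)
      then show ?thesis by blast
    qed
    then obtain s d where sd: "?v = csol a b 0 s d" by blast
    have "cjac a b ?v = (\<lambda>n. if n = 1 then d else 0)" by (simp add: sd cjac_csol fun_eq_iff)
    then show ?thesis by (auto intro!: finite_sequences_l2 finite_sequences_truncated[of _ 1])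
  qed
  show ?thesis
    using approximable_lin[OF approximable_closure[OF fg] g'(1,2) v(2) v(1) cv, of c]
    by (simp add: h f cjac_lin g'(3))
qed

end

section \<open>Resolvent powers of a truncation\<close>

context jacobi_truncation
begin

lemma sum_wt: "(\<Sum>x\<in>ev. wt x) = 1"
  using sum_ev_p[of 1 1] N by simp

text \<open>\<open>r\<^sub>0 = e\<^sub>1\<close> and \<open>r\<^sub>j\<^sub>+\<^sub>1\<close> is nearly the resolvent at \<open>M + 1\<close> applied to \<open>r\<^sub>j\<close>; in the spectral
  representation this says that \<open>hat (r\<^sub>j)\<close> is nearly \<open>(M + 1 - x)\<^sup>-\<^sup>j\<close>.\<close>

lemma resolvent_power_approx:
  assumes M: "\<And>x. x \<in> ev \<Longrightarrow> x \<le> M"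
    and r: "\<And>j. r j 0 = 0" "\<And>j n. n > N \<Longrightarrow> r j n = 0" "r 0 = (\<lambda>n. if n = 1 then 1 else 0)"
    and \<eta>: "\<eta> \<ge> 0"
    and near: "\<And>j. j < J \<Longrightarrow> (\<Sum>n=1..N. ((M + 1) * r (Suc j) n - jac a b (r (Suc j)) n - r j n)\<^sup>2) \<le> \<eta>\<^sup>2"
    and "j \<le> J"
  shows "\<bar>(\<Sum>x\<in>ev. wt x * (1 / (M + 1 - x)) ^ j) - r j 1\<bar> \<le> real j * \<eta>"
proof -
  \<comment> \<open>The norm of the square-integrable functions for the spectral measure of the
    block; by Parseval it agrees with the Euclidean norm.\<close>
  define nrm where "nrm G = L2_set (\<lambda>x. sqrt (wt x) * G x) ev" for G
  define y where "y x = 1 / (M + 1 - x)" for x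
  have y: "0 \<le> y x" "y x \<le> 1" if "x \<in> ev" for x using M[OF that] by (auto simp: y_def divide_le_eq)
  have nrm_hat: "nrm (hat \<phi>) = sqrt (\<Sum>n=1..N. (\<phi> n)\<^sup>2)" for \<phi>
  proof -
    have "(\<Sum>x\<in>ev. (sqrt (wt x) * hat \<phi> x)\<^sup>2) = (\<Sum>x\<in>ev. wt x * (hat \<phi> x * hat \<phi> x))"
      using wt_pos by (intro sum.cong) (auto simp: power_mult_distrib power2_eq_square[of "hat \<phi> _"] less_imp_le)
    then show ?thesis unfolding nrm_def L2_set_def parseval by (simp add: power2_eq_square)
  qed
  have D: "nrm (\<lambda>x. hat (r j) x - y x ^ j) \<le> real j * \<eta>" if "j \<le> J" for j
    using that
  proof (induction j)
    case 0
    have "(\<lambda>x. hat (r 0) x - y x ^ 0) = (\<lambda>x. 0)" using hat_e1 by (simp add: r(3))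
    then show ?case by (simp add: nrm_def L2_set_def)
  next
    case (Suc j)
    let ?g = "\<lambda>n. (M + 1) * r (Suc j) n - jac a b (r (Suc j)) n - r j n"
    have hg: "hat ?g x = (M + 1 - x) * hat (r (Suc j)) x - hat (r j) x" if "x \<in> ev" for x
    proof -
      have "hat ?g x = (M + 1) * hat (r (Suc j)) x - hat (jac a b (r (Suc j))) x - hat (r j) x"
        unfolding hat_def sum_distrib_left sum_subtractf[symmetric] left_diff_distrib by (simp only: mult.assoc)
      also have "hat (jac a b (r (Suc j))) x = x * hat (r (Suc j)) x"
        using that r by (intro hat_jac) auto
      finally show ?thesis by (simp add: algebra_simps)
    qed
    \<comment> \<open>Multiplication by \<open>y\<close>, with values in \<open>[0, 1]\<close> on
      the spectrum, is a contraction; so every step adds at most \<open>\<eta>\<close> to the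
      error.\<close>
    have eq: "hat (r (Suc j)) x - y x ^ Suc j = y x * (hat ?g x + (hat (r j) x - y x ^ j))" if "x \<in> ev" for x
    proof -
      have "y x * (M + 1 - x) = 1" using M[OF that] by (simp add: y_def)
      then have "y x * ((M + 1 - x) * hat (r (Suc j)) x) = hat (r (Suc j)) x"
        by (metis mult.assoc mult_1)
      then show ?thesis unfolding hg[OF that] by (simp add: algebra_simps)
    qed
    have "nrm (\<lambda>x. hat (r (Suc j)) x - y x ^ Suc j) =
        nrm (\<lambda>x. y x * (hat ?g x + (hat (r j) x - y x ^ j)))"
      unfolding nrm_def by (intro L2_set_cong refl) (simp only: eq)
    also have "\<dots> \<le> nrm (\<lambda>x. hat ?g x + (hat (r j) x - y x ^ j))"
      unfolding nrm_def L2_set_def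
    proof (intro real_sqrt_le_mono sum_mono)
      fix x assume x: "x \<in> ev"
      have "\<bar>y x * (hat ?g x + (hat (r j) x - y x ^ j))\<bar> \<le> 1 * \<bar>hat ?g x + (hat (r j) x - y x ^ j)\<bar>"
        unfolding abs_mult using y[OF x] by (intro mult_right_mono) auto
      then have "(y x * (hat ?g x + (hat (r j) x - y x ^ j)))\<^sup>2 \<le> (hat ?g x + (hat (r j) x - y x ^ j))\<^sup>2"
        by (simp add: abs_le_square_iff)
      then show "(sqrt (wt x) * (y x * (hat ?g x + (hat (r j) x - y x ^ j))))\<^sup>2
          \<le> (sqrt (wt x) * (hat ?g x + (hat (r j) x - y x ^ j)))\<^sup>2"
        unfolding power_mult_distrib[of "sqrt (wt x)"] by (intro mult_left_mono) auto
    qed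
    also have "\<dots> \<le> nrm (hat ?g) + nrm (\<lambda>x. hat (r j) x - y x ^ j)"
      unfolding nrm_def distrib_left by (rule L2_set_triangle_ineq)
    also have "\<dots> \<le> \<eta> + real j * \<eta>"
    proof (rule add_mono)
      have "sqrt (\<Sum>n=1..N. (?g n)\<^sup>2) \<le> sqrt (\<eta>\<^sup>2)" using near[of j] Suc.prems by (intro real_sqrt_le_mono) auto
      then show "nrm (hat ?g) \<le> \<eta>" using \<eta> by (simp only: nrm_hat) simp
      show "nrm (\<lambda>x. hat (r j) x - y x ^ j) \<le> real j * \<eta>" using Suc by simp
    qed
    finally show ?case by (simp add: algebra_simps)
  qed
  have "r j 1 = (\<Sum>n=1..N. r j n * r 0 n)"
    using N by (simp add: r(3) if_distrib cong: if_cong)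
  also have "\<dots> = (\<Sum>x\<in>ev. wt x * (hat (r j) x * hat (r 0) x))" by (rule parseval[symmetric])
  also have "\<dots> = (\<Sum>x\<in>ev. wt x * hat (r j) x)" unfolding r(3) hat_e1 by simp
  finally have "\<bar>(\<Sum>x\<in>ev. wt x * y x ^ j) - r j 1\<bar> = \<bar>\<Sum>x\<in>ev. wt x * (hat (r j) x - y x ^ j)\<bar>"
    by (simp add: right_diff_distrib sum_subtractf abs_minus_commute)
  also have "\<dots> \<le> (\<Sum>x\<in>ev. \<bar>sqrt (wt x)\<bar> * \<bar>sqrt (wt x) * (hat (r j) x - y x ^ j)\<bar>)"
  proof -
    have "\<bar>wt x * (hat (r j) x - y x ^ j)\<bar> = \<bar>sqrt (wt x)\<bar> * \<bar>sqrt (wt x) * (hat (r j) x - y x ^ j)\<bar>" for x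
    proof -
      have "\<bar>sqrt (wt x)\<bar> * \<bar>sqrt (wt x)\<bar> = \<bar>wt x\<bar>" using wt_pos[of x] by simp
      then show ?thesis unfolding abs_mult by (metis mult.assoc)
    qed
    then show ?thesis using sum_abs[of "\<lambda>x. wt x * (hat (r j) x - y x ^ j)" ev] by (simp only:)
  qed
  \<comment> \<open>Cauchy-Schwarz against the constant \<open>1\<close>, whose norm is
    \<open>1\<close> since the weights add up to one.\<close>
  also have "\<dots> \<le> L2_set (\<lambda>x. sqrt (wt x)) ev * nrm (\<lambda>x. hat (r j) x - y x ^ j)"
    unfolding nrm_def by (rule L2_set_mult_ineq)
  also have "L2_set (\<lambda>x. sqrt (wt x)) ev = 1"
    using sum_wt wt_pos by (simp add: L2_set_def less_imp_le)
  finally show ?thesis using D[OF \<open>j \<le> J\<close>] by (simp add: y_def)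
qed

end

context spectral_operator
begin

text \<open>The spectral measure of \<open>f\<close> is carried by values below \<open>M\<close>, so
  its first moment is at most \<open>M\<close> times its mass.\<close>

lemma T_form_le:
  assumes M: "P {M..} f = 0" and f: "(f, h) \<in> T"
  shows "inner h f \<le> M * (norm f)\<^sup>2"
proof -
  have "emeasure (mu f) {M..} = 0" using M by (simp add: emeasure_mu)
  then have "AE x in mu f. x < M" by (intro AE_I[of _ _ "{M..}"]) auto
  then have "(LINT x|mu f. x) \<le> (LINT x|mu f. M)"
    using f by (intro integral_mono_AE Domain_integrable finite_measure.integrable_const[OF finite_measure_mu]) auto
  then show ?thesis using T_quad[OF f] by (simp add: measure_mu_UNIV mult.commute)
qed

end

text \<open>Each point outside the support has an open null neighbourhood, and by Lindelof's theorem
  countably many of these cover \<open>C\<close>.\<close>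

lemma measure_support_null:
  assumes sets: "sets \<mu> = sets borel" and S: "measure_support \<mu> \<inter> C = {}" and C: "C \<in> sets borel"
  shows "emeasure \<mu> C = 0"
proof -
  define F where "F = {U. open U \<and> emeasure \<mu> U = 0}"
  have "\<And>U. U \<in> F \<Longrightarrow> open U" by (auto simp: F_def)
  then obtain F' where F': "F' \<subseteq> F" "countable F'" "\<Union>F' = \<Union>F" by (rule Lindelof) auto
  have "(\<Union>U\<in>F'. U) \<in> null_sets \<mu>"
    using F' sets by (intro null_sets_UN') (auto simp: F_def null_sets_def)
  moreover have "C \<subseteq> (\<Union>U\<in>F'. U)"
  proof
    fix x assume "x \<in> C"
    then have "x \<notin> measure_support \<mu>" using S by auto
    then obtain U where "open U" "x \<in> U" "\<not> emeasure \<mu> U > 0" by (auto simp: measure_support_def)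
    then have "U \<in> F" by (auto simp: F_def not_gr_zero)
    with \<open>x \<in> U\<close> F'(3) show "x \<in> (\<Union>U\<in>F'. U)" by auto
  qed
  ultimately have "C \<in> null_sets \<mu>" using C sets by (metis null_sets_subset)
  then show ?thesis by auto
qed

section \<open>Convergence of the exponential moments\<close>

text \<open>The maximum covers both signs of \<open>v\<close>: the measure may extend to minus
  infinity, so \<open>v = 2 * x * h\<close> is unbounded even for small \<open>h\<close>.\<close>

lemma abs_exp_remainder_le: "\<bar>exp v - 1 - v\<bar> \<le> v\<^sup>2 * max 1 (exp v)" for v :: real
proof -
  have "0 \<le> exp v - 1 - v" using exp_ge_add_one_self[of v] by linarith
  moreover have "exp v - 1 - v \<le> v * (exp v - 1)"
  proof -
    have "(1 - v) * exp v \<le> exp (- v) * exp v"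
      using exp_ge_add_one_self[of "- v"] by (intro mult_right_mono) auto
    then show ?thesis by (simp add: exp_minus algebra_simps)
  qed
  moreover have "v * (exp v - 1) \<le> v\<^sup>2 * max 1 (exp v)"
  proof (cases "v \<ge> 0")
    case True
    have "(1 - v) * exp v \<le> exp (- v) * exp v"
      using exp_ge_add_one_self[of "- v"] by (intro mult_right_mono) auto
    then have "exp v - 1 \<le> v * exp v" by (simp add: exp_minus algebra_simps)
    then have "v * (exp v - 1) \<le> v * (v * exp v)" using True by (rule mult_left_mono)
    also have "\<dots> = v\<^sup>2 * max 1 (exp v)" using True by (simp add: power2_eq_square max_def)
    finally show ?thesis .
  next
    case False
    have "(- v) * (1 - exp v) \<le> (- v) * (- v)"
    proof (rule mult_left_mono)
      show "1 - exp v \<le> - v" using exp_ge_add_one_self[of v] by linarith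
    qed (use False in simp)
    then have "v * (exp v - 1) \<le> v\<^sup>2" by (simp add: power2_eq_square algebra_simps)
    also have "\<dots> = v\<^sup>2 * max 1 (exp v)" using False by (simp add: max_def)
    finally show ?thesis .
  qed
  ultimately show ?thesis by linarith
qed

section \<open>Exponential moments of a measure on a half-line\<close>

locale half_line_measure =
  fixes \<rho> :: "real measure" and M :: real
  assumes sets_\<rho> [measurable_cong]: "sets \<rho> = sets borel"
    and moments: "\<And>k. integrable \<rho> (\<lambda>x. x ^ k)"
    and below: "AE x in \<rho>. x < M"
begin

definition F :: "nat \<Rightarrow> real \<Rightarrow> real" where "F k t = (LINT x|\<rho>. x ^ k * exp (2 * x * t))"

lemma measurable_\<rho>: "f \<in> borel_measurable borel \<Longrightarrow> f \<in> borel_measurable \<rho>" for f :: "real \<Rightarrow> real"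
  using measurable_cong_sets[OF sets_\<rho> refl] by blast

lemma exp_bound: "x < M \<Longrightarrow> 0 \<le> s \<Longrightarrow> s \<le> T \<Longrightarrow> exp (2 * x * s) \<le> exp (2 * \<bar>M\<bar> * T)"
proof -
  assume "x < M" "0 \<le> s" "s \<le> T"
  then have "x * s \<le> \<bar>M\<bar> * s" "\<bar>M\<bar> * s \<le> \<bar>M\<bar> * T" by (auto intro!: mult_right_mono mult_left_mono)
  then show ?thesis by simp
qed

lemma integrable_F:
  assumes "t \<ge> 0"
  shows "integrable \<rho> (\<lambda>x. x ^ k * exp (2 * x * t))"
proof (rule Bochner_Integration.integrable_bound)
  show "integrable \<rho> (\<lambda>x. \<bar>x ^ k\<bar> * exp (2 * \<bar>M\<bar> * t))"
    using moments[of k] by (intro integrable_mult_left integrable_abs)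
  show "(\<lambda>x. x ^ k * exp (2 * x * t)) \<in> borel_measurable \<rho>"
    by (rule measurable_\<rho>) measurable
  show "AE x in \<rho>. norm (x ^ k * exp (2 * x * t)) \<le> norm (\<bar>x ^ k\<bar> * exp (2 * \<bar>M\<bar> * t))"
    using below
  proof eventually_elim
    case (elim x)
    then show ?case using exp_bound[of x t t] assms by (auto simp: abs_mult intro!: mult_left_mono)
  qed
qed

text \<open>Differentiation under the integral with an explicit second-order remainder. The moment
  of order \<open>k + 2\<close> dominates it, since the exponentials are bounded on
  \<open>x < M\<close>.\<close>

lemma F_derivative:
  assumes t: "t > 0"
  shows "(F k has_real_derivative 2 * F (Suc k) t) (at t)"
proof -
  \<comment> \<open>The \<open>4\<close> comes from \<open>(2 * x * h)\<^sup>2\<close>, and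
    \<open>t + 1\<close> bounds both \<open>t\<close> and \<open>t + h\<close>.\<close>
  define C where "C = 4 * exp (2 * \<bar>M\<bar> * (t + 1)) * (LINT x|\<rho>. \<bar>x ^ (k + 2)\<bar>)"
  have C: "\<bar>F k (t + h) - F k t - h * (2 * F (Suc k) t)\<bar> \<le> C * h\<^sup>2" if h: "\<bar>h\<bar> \<le> min t 1" for h
  proof -
    have th: "0 \<le> t + h" using h by linarith
    note i = integrable_F[OF th, of k] integrable_F[OF less_imp_le[OF t], of k] integrable_F[OF less_imp_le[OF t], of "Suc k"]
    have eq: "F k (t + h) - F k t - h * (2 * F (Suc k) t) =
        (LINT x|\<rho>. x ^ k * exp (2 * x * (t + h)) - x ^ k * exp (2 * x * t) - (2 * h) * (x ^ Suc k * exp (2 * x * t)))"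
    proof -
      have "(LINT x|\<rho>. x ^ k * exp (2 * x * (t + h)) - x ^ k * exp (2 * x * t) - (2 * h) * (x ^ Suc k * exp (2 * x * t))) =
          (LINT x|\<rho>. x ^ k * exp (2 * x * (t + h)) - x ^ k * exp (2 * x * t)) - (LINT x|\<rho>. (2 * h) * (x ^ Suc k * exp (2 * x * t)))"
        by (intro Bochner_Integration.integral_diff Bochner_Integration.integrable_diff integrable_mult_right i)
      also have "(LINT x|\<rho>. x ^ k * exp (2 * x * (t + h)) - x ^ k * exp (2 * x * t)) = F k (t + h) - F k t"
        unfolding F_def by (intro Bochner_Integration.integral_diff i)
      also have "(LINT x|\<rho>. (2 * h) * (x ^ Suc k * exp (2 * x * t))) = (2 * h) * F (Suc k) t"
        unfolding F_def by (rule integral_mult_right_zero)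
      finally show ?thesis by simp
    qed
    have "\<bar>F k (t + h) - F k t - h * (2 * F (Suc k) t)\<bar> \<le> (LINT x|\<rho>. \<bar>x ^ k * exp (2 * x * (t + h)) - x ^ k * exp (2 * x * t) - (2 * h) * (x ^ Suc k * exp (2 * x * t))\<bar>)"
      unfolding eq by (rule integral_abs_bound)
    also have "\<dots> \<le> (LINT x|\<rho>. (4 * exp (2 * \<bar>M\<bar> * (t + 1)) * h\<^sup>2) * \<bar>x ^ (k + 2)\<bar>)"
    proof (rule integral_mono_AE)
      show "integrable \<rho> (\<lambda>x. \<bar>x ^ k * exp (2 * x * (t + h)) - x ^ k * exp (2 * x * t) - (2 * h) * (x ^ Suc k * exp (2 * x * t))\<bar>)"
        by (rule integrable_abs[OF Bochner_Integration.integrable_diff[OF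
              Bochner_Integration.integrable_diff[OF i(1,2)] integrable_mult_right[OF i(3)]]])
      show "integrable \<rho> (\<lambda>x. (4 * exp (2 * \<bar>M\<bar> * (t + 1)) * h\<^sup>2) * \<bar>x ^ (k + 2)\<bar>)"
        by (rule integrable_mult_right[OF integrable_abs[OF moments]])
      show "AE x in \<rho>. \<bar>x ^ k * exp (2 * x * (t + h)) - x ^ k * exp (2 * x * t) - (2 * h) * (x ^ Suc k * exp (2 * x * t))\<bar>
          \<le> (4 * exp (2 * \<bar>M\<bar> * (t + 1)) * h\<^sup>2) * \<bar>x ^ (k + 2)\<bar>"
        using below
      proof eventually_elim
        case (elim x)
        let ?v = "2 * x * h" and ?E = "exp (2 * \<bar>M\<bar> * (t + 1))"
        have e: "exp (2 * x * (t + h)) = exp (2 * x * t) * exp ?v"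
          by (simp add: exp_add[symmetric] algebra_simps)
        have eq: "\<bar>x ^ k * exp (2 * x * (t + h)) - x ^ k * exp (2 * x * t) - (2 * h) * (x ^ Suc k * exp (2 * x * t))\<bar> =
            \<bar>x ^ k\<bar> * (exp (2 * x * t) * \<bar>exp ?v - 1 - ?v\<bar>)"
        proof -
          have "x ^ k * exp (2 * x * (t + h)) - x ^ k * exp (2 * x * t) - (2 * h) * (x ^ Suc k * exp (2 * x * t)) =
              x ^ k * (exp (2 * x * t) * (exp ?v - 1 - ?v))"
            unfolding e by (simp add: algebra_simps)
          then show ?thesis by (simp add: abs_mult)
        qed
        have "\<bar>x ^ k\<bar> * (exp (2 * x * t) * \<bar>exp ?v - 1 - ?v\<bar>) \<le> \<bar>x ^ k\<bar> * (exp (2 * x * t) * (?v\<^sup>2 * max 1 (exp ?v)))"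
          by (intro mult_left_mono abs_exp_remainder_le) auto
        \<comment> \<open>Inside the maximum only exponentials at the times \<open>t\<close> and
          \<open>t + h\<close> remain; both times are nonnegative, as \<open>exp_bound\<close>
          requires.\<close>
        also have "\<dots> = \<bar>x ^ k\<bar> * (?v\<^sup>2 * max (exp (2 * x * t)) (exp (2 * x * (t + h))))"
        proof -
          have "exp (2 * x * t) * max 1 (exp ?v) = max (exp (2 * x * t)) (exp (2 * x * (t + h)))"
            unfolding e by (auto simp: max_def)
          then show ?thesis by (metis mult.left_commute)
        qed
        also have "\<dots> \<le> \<bar>x ^ k\<bar> * (?v\<^sup>2 * ?E)"
          using exp_bound[OF elim, of t "t + 1"] exp_bound[OF elim, of "t + h" "t + 1"] h th t
          by (intro mult_left_mono) auto
        also have "\<dots> = (4 * ?E * h\<^sup>2) * \<bar>x ^ (k + 2)\<bar>"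
          by (simp add: power_add power_mult_distrib abs_mult mult_ac power2_eq_square)
        finally show ?case unfolding eq .
      qed
    qed
    also have "\<dots> = C * h\<^sup>2" by (simp add: C_def)
    finally show ?thesis .
  qed
  have "(\<lambda>h. (F k (t + h) - F k t) / h - 2 * F (Suc k) t) \<midarrow>0\<rightarrow> 0"
  proof (rule Lim_null_comparison)
    have "\<forall>\<^sub>F h in at 0. \<bar>h\<bar> < min t 1"
      using t by (intro order_tendstoD(2)[of _ 0]) (auto intro!: tendsto_eq_intros)
    then show "\<forall>\<^sub>F h in at 0. norm ((F k (t + h) - F k t) / h - 2 * F (Suc k) t) \<le> C * \<bar>h\<bar>"
      using eventually_neq_at_within[of 0 0 UNIV]
    proof eventually_elim
      case (elim h)
      have "(F k (t + h) - F k t) / h - 2 * F (Suc k) t = (F k (t + h) - F k t - h * (2 * F (Suc k) t)) / h"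
        using elim by (simp add: field_simps)
      also have "norm \<dots> \<le> C * h\<^sup>2 / \<bar>h\<bar>"
        using C[of h] elim by (simp add: abs_divide divide_right_mono)
      also have "\<dots> = C * \<bar>h\<bar>" using elim by (simp add: power2_eq_square abs_if)
      finally show ?case .
    qed
    show "(\<lambda>h. C * \<bar>h\<bar>) \<midarrow>0\<rightarrow> 0" by (auto intro!: tendsto_eq_intros)
  qed
  then show ?thesis unfolding DERIV_def by (rule LIM_zero_cancel)
qed

lemma F_0_pos:
  assumes one: "(LINT x|\<rho>. 1 :: real) = 1" and t: "t \<ge> 0"
  shows "F 0 t > 0"
proof -
  have "F 0 t \<noteq> 0"
  proof
    assume "F 0 t = 0"
    then have "AE x in \<rho>. exp (2 * x * t) = 0"
      using integrable_F[OF t, of 0] by (subst (asm) F_def, subst (asm) integral_nonneg_eq_0_iff_AE) auto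
    then have "AE x in \<rho>. (1::real) = 0" by simp
    then have "(LINT x|\<rho>. (1::real)) = (LINT x|\<rho>. 0)" by (intro integral_cong_AE) auto
    then have "(LINT x|\<rho>. (1::real)) = 0" by (simp only: Bochner_Integration.integral_zero)
    then show False using one by (simp only: one_neq_zero)
  qed
  moreover have "F 0 t \<ge> 0" unfolding F_def by (intro integral_nonneg_AE) auto
  ultimately show ?thesis by simp
qed

text \<open>In the coordinate \<open>y = 1 / (M + 1 - x) \<in> [0, 1]\<close> the integrand extends continuously by \<open>0\<close> at
  \<open>y = 0\<close>, so Weierstrass' theorem reduces the claim to the powers of \<open>y\<close>.\<close>

lemma exp_moments_tendsto:
  assumes one: "(LINT x|\<rho>. 1 :: real) = 1"
    and A: "\<And>N. N \<ge> 1 \<Longrightarrow> finite (A N)" "\<And>N x. N \<ge> 1 \<Longrightarrow> x \<in> A N \<Longrightarrow> x \<le> M"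
    and w: "\<And>N x. N \<ge> 1 \<Longrightarrow> w N x \<ge> 0" "\<And>N. N \<ge> 1 \<Longrightarrow> (\<Sum>x\<in>A N. w N x) = 1"
    and lim: "\<And>j. (\<lambda>N. \<Sum>x\<in>A N. w N x * (1 / (M + 1 - x)) ^ j) \<longlonglongrightarrow>
      (LINT x|\<rho>. indicator {..<M} x * (1 / (M + 1 - x)) ^ j)"
    and t: "t > 0"
  shows "(\<lambda>N. \<Sum>x\<in>A N. w N x * (x ^ k * exp (2 * x * t))) \<longlonglongrightarrow> F k t"
proof (rule tendstoI)
  fix e :: real assume e: "e > 0"
  define f where "f x = x ^ k * exp (2 * x * t)" for x
  define g where "g y = (if y = 0 then 0 else f (M + 1 - 1 / y))" for y
  have gx: "g (1 / (M + 1 - x)) = f x" if "x \<le> M" for x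
    using that by (simp add: g_def)
  have "continuous_on {0..1} g"
    unfolding continuous_on_eq_continuous_within
  proof
    fix y :: real assume y: "y \<in> {0..1}"
    show "continuous (at y within {0..1}) g"
    proof (cases "y = 0")
      case True
      \<comment> \<open>Here \<open>t > 0\<close> is decisive: as \<open>x\<close> tends to minus
        infinity, the exponential outweighs \<open>x ^ k\<close>.\<close>
      have "((\<lambda>y. f (M + 1 - 1 / y)) \<longlongrightarrow> 0) (at_right 0)"
        unfolding f_def using t by real_asymp
      then have "(g \<longlongrightarrow> 0) (at_right 0)"
        by (rule Lim_transform_eventually) (auto simp: g_def eventually_at_filter)
      then have "(g \<longlongrightarrow> g 0) (at 0 within {0..1})"
        by (simp add: g_def at_within_Icc_at_right)
      then show ?thesis using True by (simp add: continuous_within)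
    next
      case False
      have lim_f: "((\<lambda>y. f (M + 1 - 1 / y)) \<longlongrightarrow> f (M + 1 - 1 / y)) (at y within {0..1})"
        unfolding f_def using False by (intro tendsto_intros) auto
      have ne: "\<forall>\<^sub>F z in at y within {0..1}. z \<noteq> 0"
        using False by (intro tendsto_imp_eventually_ne[OF tendsto_ident_at])
      have "\<forall>\<^sub>F z in at y within {0..1}. f (M + 1 - 1 / z) = g z"
        using ne by eventually_elim (simp add: g_def)
      with lim_f have "(g \<longlongrightarrow> f (M + 1 - 1 / y)) (at y within {0..1})"
        by (rule Lim_transform_eventually)
      then show ?thesis using False by (simp add: continuous_within g_def)
    qed
  qed
  then obtain P where P: "real_polynomial_function P" "\<And>y. y \<in> {0..1} \<Longrightarrow> \<bar>g y - P y\<bar> < e / 3"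
    using Stone_Weierstrass_real_polynomial_function[OF compact_Icc, of 0 1 g "e / 3"] e by auto
  then obtain c n where c: "P = (\<lambda>y. \<Sum>i\<le>n. c i * y ^ i)"
    using real_polynomial_function_iff_sum by blast
  have fP: "\<bar>f x - P (1 / (M + 1 - x))\<bar> \<le> e / 3" if "x \<le> M" for x
    using P(2)[of "1 / (M + 1 - x)"] gx[OF that] that by (auto simp: divide_le_eq less_imp_le)
  define y where "y x = indicator {..<M} x * (1 / (M + 1 - x))" for x :: real
  have yi: "integrable \<rho> (\<lambda>x. indicator {..<M} x * (1 / (M + 1 - x)) ^ i)" for i
  proof (rule Bochner_Integration.integrable_bound)
    show "integrable \<rho> (\<lambda>x. 1 :: real)" using moments[of 0] by simp
    show "(\<lambda>x. indicator {..<M} x * (1 / (M + 1 - x)) ^ i) \<in> borel_measurable \<rho>"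
      by (rule measurable_\<rho>) measurable
    show "AE x in \<rho>. norm (indicator {..<M} x * (1 / (M + 1 - x)) ^ i) \<le> norm (1 :: real)"
      by (intro AE_I2) (auto simp: indicator_def power_le_one divide_le_eq)
  qed
  \<comment> \<open>The indicator removes the pole at \<open>x = M + 1\<close>; almost everywhere
    \<open>Q\<close> agrees with the polynomial in \<open>1 / (M + 1 - x)\<close>.\<close>
  define Q where "Q x = (\<Sum>i\<le>n. c i * (indicator {..<M} x * (1 / (M + 1 - x)) ^ i))" for x
  have QP: "Q x = P (1 / (M + 1 - x))" if "x < M" for x using that by (simp add: Q_def c)
  have Qi: "integrable \<rho> Q" unfolding Q_def by (intro Bochner_Integration.integrable_sum integrable_mult_right yi)
  have fi: "integrable \<rho> f" unfolding f_def by (rule integrable_F) (use t in simp)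
  have "\<bar>F k t - (LINT x|\<rho>. Q x)\<bar> \<le> e / 3"
  proof -
    have "F k t - (LINT x|\<rho>. Q x) = (LINT x|\<rho>. f x - Q x)"
      unfolding Bochner_Integration.integral_diff[OF fi Qi] by (simp only: F_def f_def[abs_def])
    then have "\<bar>F k t - (LINT x|\<rho>. Q x)\<bar> \<le> (LINT x|\<rho>. \<bar>f x - Q x\<bar>)"
      by (simp only: integral_abs_bound)
    also have "\<dots> \<le> (LINT x|\<rho>. e / 3 * 1)"
    proof (rule integral_mono_AE)
      show "AE x in \<rho>. \<bar>f x - Q x\<bar> \<le> e / 3 * 1"
        using below
      proof eventually_elim
        case (elim x)
        then show ?case using fP[of x] by (simp only: QP mult_1_right less_imp_le)
      qed
      show "integrable \<rho> (\<lambda>x. \<bar>f x - Q x\<bar>)"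
        by (rule integrable_abs[OF Bochner_Integration.integrable_diff[OF fi Qi]])
      have "integrable \<rho> (\<lambda>x. 1 :: real)" using moments[of 0] by (simp only: power_0)
      then show "integrable \<rho> (\<lambda>x. e / 3 * 1)" by (rule integrable_mult_right)
    qed
    also have "\<dots> = e / 3 * (LINT x|\<rho>. 1)" by (rule integral_mult_right_zero)
    finally show ?thesis using one by simp
  qed
  moreover have "(LINT x|\<rho>. Q x) = (\<Sum>i\<le>n. c i * (LINT x|\<rho>. indicator {..<M} x * (1 / (M + 1 - x)) ^ i))"
    unfolding Q_def using yi by (subst Bochner_Integration.integral_sum) auto
  moreover have "(\<lambda>N. \<Sum>i\<le>n. c i * (\<Sum>x\<in>A N. w N x * (1 / (M + 1 - x)) ^ i)) \<longlonglongrightarrow>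
      (\<Sum>i\<le>n. c i * (LINT x|\<rho>. indicator {..<M} x * (1 / (M + 1 - x)) ^ i))"
    by (intro tendsto_sum tendsto_mult tendsto_const lim)
  ultimately have *: "\<bar>F k t - L\<bar> \<le> e / 3" "(\<lambda>N. \<Sum>i\<le>n. c i * (\<Sum>x\<in>A N. w N x * (1 / (M + 1 - x)) ^ i)) \<longlonglongrightarrow> L"
    if "L = (\<Sum>i\<le>n. c i * (LINT x|\<rho>. indicator {..<M} x * (1 / (M + 1 - x)) ^ i))" for L
    using that by auto
  define L where "L = (\<Sum>i\<le>n. c i * (LINT x|\<rho>. indicator {..<M} x * (1 / (M + 1 - x)) ^ i))"
  have "\<forall>\<^sub>F N in sequentially. dist (\<Sum>i\<le>n. c i * (\<Sum>x\<in>A N. w N x * (1 / (M + 1 - x)) ^ i)) L < e / 3"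
    using tendstoD[OF *(2)[OF L_def], of "e / 3"] e by simp
  then show "\<forall>\<^sub>F N in sequentially. dist (\<Sum>x\<in>A N. w N x * (x ^ k * exp (2 * x * t))) (F k t) < e"
    using eventually_ge_at_top[of 1]
  proof eventually_elim
    case (elim N)
    have "(\<Sum>i\<le>n. c i * (\<Sum>x\<in>A N. w N x * (1 / (M + 1 - x)) ^ i)) = (\<Sum>x\<in>A N. w N x * P (1 / (M + 1 - x)))"
      unfolding c sum_distrib_left by (subst sum.swap) (simp add: mult_ac)
    moreover have "\<bar>(\<Sum>x\<in>A N. w N x * f x) - (\<Sum>x\<in>A N. w N x * P (1 / (M + 1 - x)))\<bar> \<le> e / 3"
    proof -
      have "\<bar>(\<Sum>x\<in>A N. w N x * f x) - (\<Sum>x\<in>A N. w N x * P (1 / (M + 1 - x)))\<bar> =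
          \<bar>\<Sum>x\<in>A N. w N x * (f x - P (1 / (M + 1 - x)))\<bar>"
        by (simp add: sum_subtractf right_diff_distrib)
      also have "\<dots> \<le> (\<Sum>x\<in>A N. \<bar>w N x * (f x - P (1 / (M + 1 - x)))\<bar>)" by (rule sum_abs)
      also have "\<dots> \<le> (\<Sum>x\<in>A N. w N x * (e / 3))"
      proof (rule sum_mono)
        fix x assume x: "x \<in> A N"
        have "w N x * \<bar>f x - P (1 / (M + 1 - x))\<bar> \<le> w N x * (e / 3)"
          by (rule mult_left_mono[OF fP[OF A(2)[OF elim(2) x]] w(1)[OF elim(2)]])
        then show "\<bar>w N x * (f x - P (1 / (M + 1 - x)))\<bar> \<le> w N x * (e / 3)"
          using w(1)[OF elim(2), of x] by (simp only: abs_mult abs_of_nonneg)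
      qed
      also have "\<dots> = e / 3" using w(2)[OF elim(2)] by (simp only: sum_distrib_right[symmetric] mult_1)
      finally show ?thesis .
    qed
    ultimately show ?case
      using elim(1) *(1)[OF L_def] unfolding f_def[symmetric] dist_real_def by linarith
  qed
qed

end

section \<open>Transfer of resolvent chains to the truncations\<close>

lemma sum_Re_square_le:
  assumes "f \<in> l2"
  shows "(\<Sum>n=1..N. (Re (f n))\<^sup>2) \<le> (l2_norm f)\<^sup>2"
proof -
  have "(\<Sum>n=1..N. (Re (f n))\<^sup>2) \<le> (\<Sum>n=1..N. (cmod (f n))\<^sup>2)"
    by (intro sum_mono) (simp add: cmod_def)
  also have "\<dots> \<le> (\<Sum>n. (cmod (f n))\<^sup>2)"
    using assms by (intro sum_le_suminf) (auto simp: l2_iff)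
  also have "\<dots> = (l2_norm f)\<^sup>2"
    using assms by (simp add: l2_norm_def suminf_nonneg l2_iff)
  finally show ?thesis .
qed

lemma Re_cjac: "Re (cjac a b f n) = jac a b (\<lambda>n. Re (f n)) n"
  by (simp add: cjac_def jac_def)

text \<open>Near each pair \<open>(u (Suc j), k j)\<close> lies a pair of the \<open>N\<close>-th
  block, and these form an approximate resolvent chain for the block. The factor
  \<open>\<bar>M + 1\<bar> + 3\<close> collects the defect of the given chain and the errors of
  \<open>\<phi> (Suc j)\<close>, of its image and of \<open>\<phi> j\<close>; the final
  \<open>e\<close> is the error of the first component.\<close>

lemma approximable_resolvent_chain:
  fixes u k :: "nat \<Rightarrow> nat \<Rightarrow> complex"
  assumes J: "\<And>N. N \<ge> 1 \<Longrightarrow> jacobi_truncation N a"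
    and ev: "\<And>N x. N \<ge> 1 \<Longrightarrow> x \<in> jacobi_truncation.ev N a b \<Longrightarrow> x \<le> M"
    and e: "e > 0"
    and l2: "\<And>j. u j \<in> l2" "\<And>j. k j \<in> l2"
    and u0: "l2_norm (\<lambda>n. u 0 n - (if n = 1 then 1 else 0)) < e"
    and appr: "\<And>j. approximable a b (u (Suc j)) (k j)"
    and step: "\<And>j. l2_norm (\<lambda>n. of_real (M + 1) * u (Suc j) n - k j n - u j n) < e"
  shows "\<forall>\<^sub>F N in sequentially. \<bar>(\<Sum>x\<in>jacobi_truncation.ev N a b. jacobi_truncation.wt N a b x * (1 / (M + 1 - x)) ^ i) - Re (u i 1)\<bar>
    \<le> real i * ((\<bar>M + 1\<bar> + 3) * e) + e"
proof -
  have "\<forall>\<^sub>F N in sequentially. \<forall>j\<in>{..<i}. \<exists>\<phi>. \<phi> 0 = 0 \<and> truncate N \<phi> = \<phi> \<and>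
      l2_norm (\<lambda>n. \<phi> n - u (Suc j) n) < e \<and> l2_norm (\<lambda>n. truncate N (cjac a b \<phi>) n - k j n) < e"
    using appr e by (intro eventually_ball_finite) (auto simp: approximable_def)
  then show ?thesis
    using eventually_ge_at_top[of 1]
  proof eventually_elim
    case (elim N)
    interpret jacobi_truncation N a b using J[OF elim(2)] .
    from elim(1) have "\<forall>j. \<exists>\<phi>. j < i \<longrightarrow> \<phi> 0 = 0 \<and> truncate N \<phi> = \<phi> \<and>
      l2_norm (\<lambda>n. \<phi> n - u (Suc j) n) < e \<and> l2_norm (\<lambda>n. truncate N (cjac a b \<phi>) n - k j n) < e" by auto
    then obtain \<psi> where \<psi>: "\<And>j. j < i \<Longrightarrow> \<psi> j 0 = 0 \<and> truncate N (\<psi> j) = \<psi> j \<and>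
      l2_norm (\<lambda>n. \<psi> j n - u (Suc j) n) < e \<and> l2_norm (\<lambda>n. truncate N (cjac a b (\<psi> j)) n - k j n) < e" by metis
    \<comment> \<open>\<open>resolvent_power_approx\<close> requires a chain starting exactly at
      \<open>e\<^sub>1\<close>, so the approximants \<open>\<psi>\<close> are shifted by one; beyond
      \<open>i\<close> the chain is filled with zeros.\<close>
    define \<phi> where "\<phi> j = (case j of 0 \<Rightarrow> (\<lambda>n. if n = 1 then 1 else 0) | Suc j \<Rightarrow> if j < i then \<psi> j else (\<lambda>n. 0))" for j
    have \<phi>_0: "\<phi> 0 = (\<lambda>n. if n = 1 then 1 else 0)"
      and \<phi>_Suc: "\<phi> (Suc j) = (if j < i then \<psi> j else (\<lambda>n. 0))" for j by (simp_all add: \<phi>_def)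
    have "\<phi> j 0 = 0 \<and> truncate N (\<phi> j) = \<phi> j" for j
    proof (cases j)
      case 0
      then show ?thesis using elim(2) by (auto simp: \<phi>_0 truncate_def)
    next
      case (Suc j')
      then show ?thesis using \<psi>[of j'] by (cases "j' < i") (auto simp: \<phi>_Suc truncate_def[of N "\<lambda>n. 0"])
    qed
    then have \<phi>0: "\<phi> j 0 = 0" and \<phi>t: "truncate N (\<phi> j) = \<phi> j" for j by auto
    have \<phi>l2: "\<phi> j \<in> l2" for j
      using finite_sequences_l2[OF truncate_finite[of "\<phi> j" N, OF \<phi>0]] by (simp only: \<phi>t)
    have near: "l2_norm (\<lambda>n. \<phi> j n - u j n) < e" if "j \<le> i" for j
    proof (cases j)
      case 0
      have "l2_norm (\<lambda>n. \<phi> 0 n - u 0 n) = l2_norm (\<lambda>n. u 0 n - (if n = 1 then 1 else 0))"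
        unfolding l2_norm_def \<phi>_0 by (simp add: norm_minus_commute)
      then show ?thesis using u0 0 by simp
    next
      case (Suc j')
      then show ?thesis using \<psi>[of j'] that by (simp add: \<phi>_Suc)
    qed
    have nearA: "l2_norm (\<lambda>n. truncate N (cjac a b (\<phi> (Suc j))) n - k j n) < e" if "j < i" for j
      using \<psi>[OF that] that by (simp add: \<phi>_Suc)
    define \<eta> where "\<eta> = (\<bar>M + 1\<bar> + 3) * e"
    have "\<bar>(\<Sum>x\<in>ev. wt x * (1 / (M + 1 - x)) ^ i) - Re (\<phi> i 1)\<bar> \<le> real i * \<eta>"
    proof (rule resolvent_power_approx[where r = "\<lambda>j n. Re (\<phi> j n)" and J = i])
      show "x \<le> M" if "x \<in> ev" for x using ev[OF elim(2) that] .
      show "Re (\<phi> j 0) = 0" for j using \<phi>0 by simp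
      show "Re (\<phi> j n) = 0" if "n > N" for j n
        using fun_cong[OF \<phi>t[of j], of n] that by (simp add: truncate_def)
      show "(\<lambda>n. Re (\<phi> 0 n)) = (\<lambda>n. if n = 1 then 1 else 0)" by (auto simp: \<phi>_0)
      show "\<eta> \<ge> 0" using e by (simp add: \<eta>_def)
      show "i \<le> i" by simp
      fix j assume j: "j < i"
      let ?A = "truncate N (cjac a b (\<phi> (Suc j)))"
      define g where "g = (\<lambda>n. of_real (M + 1) * \<phi> (Suc j) n - ?A n - \<phi> j n)"
      have Al2: "?A \<in> l2" by (intro finite_sequences_l2 truncate_finite) simp
      have gl2: "g \<in> l2" unfolding g_def by (intro l2_diff l2_scale \<phi>l2 Al2)
      have "(\<Sum>n=1..N. ((M + 1) * Re (\<phi> (Suc j) n) - jac a b (\<lambda>n. Re (\<phi> (Suc j) n)) n - Re (\<phi> j n))\<^sup>2)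
          = (\<Sum>n=1..N. (Re (g n))\<^sup>2)"
        by (intro sum.cong) (auto simp: g_def truncate_def Re_cjac)
      also have "\<dots> \<le> (l2_norm g)\<^sup>2" by (rule sum_Re_square_le[OF gl2])
      also have "\<dots> \<le> \<eta>\<^sup>2"
      proof (rule power_mono)
        define d1 where "d1 = (\<lambda>n. \<phi> (Suc j) n - u (Suc j) n)"
        define d2 where "d2 = (\<lambda>n. ?A n - k j n)"
        define d3 where "d3 = (\<lambda>n. \<phi> j n - u j n)"
        define d4 where "d4 = (\<lambda>n. of_real (M + 1) * u (Suc j) n - k j n - u j n)"
        have d: "d1 \<in> l2" "d2 \<in> l2" "d3 \<in> l2" "d4 \<in> l2"
          unfolding d1_def d2_def d3_def d4_def by (intro l2_diff l2_scale \<phi>l2 Al2 l2)+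
        have geq: "g = (\<lambda>n. ((d4 n + of_real (M + 1) * d1 n) + (- 1) * d2 n) + (- 1) * d3 n)"
          by (simp add: g_def d1_def d2_def d3_def d4_def fun_eq_iff algebra_simps)
        have "l2_norm g \<le> ((l2_norm d4 + cmod (of_real (M + 1)) * l2_norm d1) + cmod (- 1) * l2_norm d2) + cmod (- 1) * l2_norm d3"
          unfolding geq using l2_norm_lin[OF d(4,1), of "of_real (M + 1)"]
            l2_norm_lin[OF l2_lin[OF d(4,1), of "of_real (M + 1)"] d(2), of "- 1"]
            l2_norm_lin[OF l2_lin[OF l2_lin[OF d(4,1), of "of_real (M + 1)"] d(2), of "- 1"] d(3), of "- 1"]
          by linarith
        also have "\<dots> = l2_norm d4 + \<bar>M + 1\<bar> * l2_norm d1 + l2_norm d2 + l2_norm d3"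
          by (simp only: norm_of_real norm_minus_cancel norm_one mult_1)
        also have "\<dots> \<le> e + \<bar>M + 1\<bar> * e + e + e"
        proof -
          have le: "l2_norm d1 \<le> e" "l2_norm d2 \<le> e" "l2_norm d3 \<le> e" "l2_norm d4 \<le> e"
            using near[of "Suc j"] near[of j] nearA[OF j] step[of j] j
            unfolding d1_def d2_def d3_def d4_def by auto
          show ?thesis using le(2-4) mult_left_mono[OF le(1) abs_ge_zero[of "M + 1"]] by linarith
        qed
        also have "\<dots> = \<eta>" by (simp add: \<eta>_def algebra_simps)
        finally show "l2_norm g \<le> \<eta>" .
        show "0 \<le> l2_norm g" by (rule l2_norm_nonneg[OF gl2])
      qed
      finally show "(\<Sum>n=1..N. ((M + 1) * Re (\<phi> (Suc j) n) - jac a b (\<lambda>n. Re (\<phi> (Suc j) n)) n - Re (\<phi> j n))\<^sup>2) \<le> \<eta>\<^sup>2" .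
    qed
    moreover have "\<bar>Re (\<phi> i 1) - Re (u i 1)\<bar> \<le> e"
    proof -
      have "\<bar>Re (\<phi> i 1 - u i 1)\<bar> \<le> l2_norm (\<lambda>n. \<phi> i n - u i n)"
        using abs_Re_le_cmod[of "\<phi> i 1 - u i 1"] l2_coord_le[OF l2_diff[OF \<phi>l2[of i] l2(1)[of i]], of 1] by linarith
      then show ?thesis using near[of i] by simp
    qed
    ultimately show ?case unfolding \<eta>_def by linarith
  qed
qed

section \<open>The self-adjoint realization and the limits of its truncations\<close>

locale jacobi_resolution =
  fixes a b :: "nat \<Rightarrow> real" and \<alpha> :: "real option" and E and M :: real
  assumes a_pos: "\<And>n. n \<ge> 1 \<Longrightarrow> a n > 0"
    and boundary: "limit_circle a b \<Longrightarrow> is_boundary_parameter a b \<alpha>"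
    and resolution: "spectral_resolution E (jacobi_realization a b \<alpha>)"
    and support: "measure_support (scalar_spectral_measure E unit_e1) \<subseteq> {..<M}"
begin

definition S :: "(ell2 \<times> ell2) set" where
  "S = {(x, y). (coord x, coord y) \<in> jacobi_realization a b \<alpha>}"

definition P :: "real set \<Rightarrow> ell2 \<Rightarrow> ell2" where
  "P B x = Abs_ell2 (E B (coord x))"

definition rvec :: "(nat \<Rightarrow> real) \<Rightarrow> ell2" where
  "rvec f = Abs_ell2 (\<lambda>n. complex_of_real (f n))"

lemma realization_l2: "(f, g) \<in> jacobi_realization a b \<alpha> \<Longrightarrow> f \<in> l2 \<and> g \<in> l2"
  using jacobi_realization_subset_adjoint[of a b \<alpha>] op_adjoint_jacobi_op_iff[of f g a b] by blast

lemma realization_cjac: "f \<in> finite_sequences \<Longrightarrow> (f, cjac a b f) \<in> jacobi_realization a b \<alpha>"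
  using jacobi_op_subset_realization[of a b \<alpha>] jacobi_op_iff[of f "cjac a b f" a b] by blast

lemma realization_unit:
  "m \<ge> 1 \<Longrightarrow> (\<lambda>n. if n = m then 1 else 0) \<in> Domain (jacobi_realization a b \<alpha>)"
  by (rule DomainI[OF realization_cjac], rule finite_sequences_truncated[of _ m]) auto

sublocale spectral_operator S P
  unfolding S_def P_def[abs_def]
  by (rule spectral_operator_ell2(1)[OF resolution realization_l2 jacobi_realization_lin realization_unit])

lemma mu_eq: "mu x = scalar_spectral_measure E (coord x)"
  unfolding P_def[abs_def]
  by (rule spectral_operator_ell2(2)[OF resolution realization_l2 jacobi_realization_lin realization_unit])

lemma real_sequence_finite: "f 0 = 0 \<Longrightarrow> (\<And>n. n > K \<Longrightarrow> f n = 0) \<Longrightarrow> (\<lambda>n. complex_of_real (f n)) \<in> finite_sequences"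
  by (rule finite_sequences_truncated[of _ K]) auto

lemma coord_rvec: "f 0 = 0 \<Longrightarrow> (\<And>n. n > K \<Longrightarrow> f n = 0) \<Longrightarrow> coord (rvec f) = (\<lambda>n. complex_of_real (f n))"
  unfolding rvec_def by (rule coord_Abs[OF finite_sequences_l2[OF real_sequence_finite[of _ K]]]) auto

lemma cjac_of_real: "cjac a b (\<lambda>n. complex_of_real (f n)) = (\<lambda>n. complex_of_real (jac a b f n))"
  by (simp add: cjac_def jac_def fun_eq_iff)

lemma S_rvec:
  assumes f: "f 0 = 0" "\<And>n. n > K \<Longrightarrow> f n = 0"
  shows "(rvec f, rvec (jac a b f)) \<in> S"
proof -
  have "coord (rvec (jac a b f)) = (\<lambda>n. complex_of_real (jac a b f n))"
    by (rule coord_rvec[of _ "Suc K"]) (auto simp: jac_def f)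
  then show ?thesis
    using realization_cjac[OF real_sequence_finite[of f K, OF f]] coord_rvec[of f K, OF f]
    by (simp add: S_def cjac_of_real)
qed

text \<open>Index \<open>0\<close> yields the zero sequence, which stands for the missing left
  neighbour of \<open>e\<^sub>1\<close> in the recurrence.\<close>

definition unit_seq :: "nat \<Rightarrow> nat \<Rightarrow> real" where
  "unit_seq m n = (if n = m \<and> n \<noteq> 0 then 1 else 0)"

lemma unit_seq_simps [simp]: "unit_seq m 0 = 0" "n > m \<Longrightarrow> unit_seq m n = 0"
  by (simp_all add: unit_seq_def)

lemma coord_unit: "coord (rvec (unit_seq m)) = (\<lambda>n. complex_of_real (unit_seq m n))"
  by (rule coord_rvec[of _ m]) auto

lemma coord_unit_1: "coord (rvec (unit_seq 1)) = unit_e1"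
  by (auto simp: coord_unit unit_e1_def unit_seq_def)

text \<open>\<open>e\<^sub>1\<close> is cyclic: the recurrence expresses
  \<open>e\<^sub>j\<^sub>+\<^sub>1\<close> by \<open>T e\<^sub>j\<close>, \<open>e\<^sub>j\<close>
  and \<open>e\<^sub>j\<^sub>-\<^sub>1\<close>, and the projection commutes with \<open>T\<close>.
  So the support condition spreads from \<open>e\<^sub>1\<close> to every unit vector.\<close>

lemma P_unit: "m \<ge> 1 \<Longrightarrow> P {M..} (rvec (unit_seq m)) = 0"
proof (induction m rule: less_induct)
  case (less m)
  have B: "{M..} \<in> sets borel" by simp
  interpret L: linear "P {M..}" by (rule P_linear[OF B])
  show ?case
  proof (cases "m = 1")
    case True
    have "emeasure (mu (rvec (unit_seq 1))) {M..} = 0"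
    proof (rule measure_support_null)
      show "measure_support (mu (rvec (unit_seq 1))) \<inter> {M..} = {}"
        using support unfolding mu_eq coord_unit_1 by auto
    qed auto
    then show ?thesis using True by (simp add: emeasure_mu)
  next
    case False
    then obtain j where m: "m = Suc j" and j: "j \<ge> 1" using less.prems by (cases m) auto
    let ?v = "rvec (jac a b (unit_seq j))"
    have "P {M..} (rvec (unit_seq j)) = 0" using less.IH[of j] m j by simp
    then have "P {M..} ?v = 0"
      using T_P[OF B S_rvec[of "unit_seq j" j]] T_zero by simp
    moreover have "P {M..} (rvec (unit_seq (j - 1))) = 0"
    proof (cases "j = 1")
      case True
      have "rvec (unit_seq 0) = 0"
        unfolding coord_inject[symmetric] coord_unit coord_zero by (auto simp: unit_seq_def)
      then show ?thesis using True by (simp add: L.zero)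
    next
      case False
      then show ?thesis using less.IH[of "j - 1"] m j by simp
    qed
    moreover have "rvec (unit_seq m) = (1 / a j) *\<^sub>R (?v - b j *\<^sub>R rvec (unit_seq j) - a (j - 1) *\<^sub>R rvec (unit_seq (j - 1)))"
    proof -
      have v: "coord ?v = (\<lambda>n. complex_of_real (jac a b (unit_seq j) n))"
        by (rule coord_rvec[of _ "Suc j"]) (auto simp: jac_def)
      have "a j \<noteq> 0" using a_pos[OF j] by simp
      then have "unit_seq m n = (1 / a j) * (jac a b (unit_seq j) n - b j * unit_seq j n - a (j - 1) * unit_seq (j - 1) n)" for n
        using j by (auto simp: jac_def unit_seq_def m field_simps)
      then show ?thesis
        unfolding coord_inject[symmetric] coord_scaleR coord_diff coord_unit v
        by (simp only: of_real_mult of_real_diff)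
    qed
    ultimately show ?thesis
      using less.IH[of j] m j by (simp only: L.scale L.diff) simp
  qed
qed

lemma P_rvec:
  assumes f: "f 0 = 0" "\<And>n. n > K \<Longrightarrow> f n = 0"
  shows "P {M..} (rvec f) = 0"
proof -
  interpret L: linear "P {M..}" by (rule P_linear) simp
  have "rvec f = (\<Sum>m=1..K. f m *\<^sub>R rvec (unit_seq m))"
  proof -
    have cf: "coord (rvec f) = (\<lambda>n. complex_of_real (f n))" by (rule coord_rvec[of f K]) (use f in auto)
    have fn: "f n = (\<Sum>m=1..K. f m * unit_seq m n)" for n
    proof (cases "n \<in> {1..K}")
      case True
      then have "(\<Sum>m=1..K. f m * unit_seq m n) = (\<Sum>m\<in>{n}. f m * unit_seq m n)"
        by (intro sum.mono_neutral_right) (auto simp: unit_seq_def)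
      then show ?thesis using True by (simp add: unit_seq_def)
    next
      case False
      then have "n = 0 \<or> n > K" by auto
      then have "f n = 0" using f by auto
      moreover have "(\<Sum>m=1..K. f m * unit_seq m n) = 0"
        using False by (intro sum.neutral) (auto simp: unit_seq_def)
      ultimately show ?thesis by simp
    qed
    have "complex_of_real (f n) = (\<Sum>m=1..K. complex_of_real (f m) * complex_of_real (unit_seq m n))" for n
      unfolding of_real_mult[symmetric] of_real_sum[symmetric] by (rule arg_cong[OF fn])
    then have "(\<lambda>n. complex_of_real (f n)) = (\<lambda>n. \<Sum>m=1..K. complex_of_real (f m) * complex_of_real (unit_seq m n))"
      by (rule ext)
    then show ?thesis
      unfolding coord_inject[symmetric] coord_sum coord_scaleR coord_unit cf .
  qed
  then have "P {M..} (rvec f) = (\<Sum>m=1..K. f m *\<^sub>R P {M..} (rvec (unit_seq m)))"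
    by (simp only: L.sum L.scale)
  also have "\<dots> = 0" by (intro sum.neutral) (auto simp: P_unit)
  finally show ?thesis .
qed

lemma inner_rvec:
  assumes f: "f 0 = 0" "\<And>n. n > K \<Longrightarrow> f n = 0" and g: "g 0 = 0" "\<And>n. n > K' \<Longrightarrow> g n = 0"
  shows "inner (rvec f) (rvec g) = (\<Sum>n=1..K'. f n * g n)"
proof -
  have "(\<lambda>n. coord (rvec f) n * cnj (coord (rvec g) n)) sums
      (\<Sum>n=1..K'. coord (rvec f) n * cnj (coord (rvec g) n))"
  proof (rule sums_finite)
    fix n assume "n \<notin> {1..K'}"
    then have "n = 0 \<or> n > K'" by auto
    then show "coord (rvec f) n * cnj (coord (rvec g) n) = 0"
      using g by (auto simp: coord_rvec[of g K', OF g])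
  qed simp
  then show ?thesis
    by (simp add: inner_ell2.rep_eq l2_inner_def sums_iff coord_rvec[of f K, OF f] coord_rvec[of g K', OF g])
qed

lemma truncation: "N \<ge> 1 \<Longrightarrow> jacobi_truncation N a"
  using a_pos by unfold_locales auto

text \<open>The eigenvector of the block, extended by zero, lies in the domain. Its image is
  \<open>x * \<phi> n\<close> up to \<open>N\<close>; the entry at \<open>N + 1\<close> is
  multiplied by \<open>\<phi> (Suc N) = 0\<close> in the form, whose value is therefore
  \<open>x\<close> times the squared norm.\<close>

lemma ev_le:
  assumes N: "N \<ge> 1" and x: "x \<in> jacobi_truncation.ev N a b"
  shows "x \<le> M"
proof -
  interpret jacobi_truncation N a b using truncation[OF N] .
  define \<phi> where "\<phi> n = (if n \<le> N then p x n else 0)" for n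
  have \<phi>: "\<phi> 0 = 0" "\<phi> (Suc N) = 0" "\<And>n. n > N \<Longrightarrow> \<phi> n = 0" by (auto simp: \<phi>_def)
  have px: "p x (Suc N) = 0" using x by (simp add: ev_def)
  have jac: "jac a b \<phi> n = x * \<phi> n" if "n \<in> {1..N}" for n
  proof -
    have "jac a b \<phi> n = jac a' b \<phi> n" using jac_a'_eq[of \<phi> n] \<phi> that by simp
    also have "\<dots> = jac a' b (p x) n"
      using that px by (auto simp: jac_def \<phi>_def not_less_eq_eq le_Suc_eq)
    finally show ?thesis using that by (simp add: jac_p \<phi>_def)
  qed
  have \<phi>K: "jac a b \<phi> n = 0" if "n > Suc N" for n using that by (auto simp: jac_def \<phi>_def)
  have "inner (rvec (jac a b \<phi>)) (rvec \<phi>) = (\<Sum>n=1..N. jac a b \<phi> n * \<phi> n)"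
    by (rule inner_rvec[of _ "Suc N"]) (auto simp: \<phi> \<phi>K)
  also have "\<dots> = x * (\<Sum>n=1..N. \<phi> n * \<phi> n)"
    unfolding sum_distrib_left by (intro sum.cong) (auto simp: jac)
  also have "(\<Sum>n=1..N. \<phi> n * \<phi> n) = (\<Sum>n=1..N. (p x n)\<^sup>2)"
    by (intro sum.cong) (auto simp: \<phi>_def power2_eq_square)
  finally have 1: "inner (rvec (jac a b \<phi>)) (rvec \<phi>) = x * (\<Sum>n=1..N. (p x n)\<^sup>2)" .
  have "inner (rvec \<phi>) (rvec \<phi>) = (\<Sum>n=1..N. \<phi> n * \<phi> n)"
    by (rule inner_rvec[of _ N]) (auto simp: \<phi>)
  also have "\<dots> = (\<Sum>n=1..N. (p x n)\<^sup>2)"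
    by (intro sum.cong) (auto simp: \<phi>_def power2_eq_square)
  finally have 2: "(norm (rvec \<phi>))\<^sup>2 = (\<Sum>n=1..N. (p x n)\<^sup>2)" by (simp only: dot_square_norm)
  have "inner (rvec (jac a b \<phi>)) (rvec \<phi>) \<le> M * (norm (rvec \<phi>))\<^sup>2"
    by (rule T_form_le[OF P_rvec[of _ N] S_rvec[of _ N]]) (auto simp: \<phi>)
  then show ?thesis using norm_p_pos[of x] unfolding 1 2 by simp
qed

definition \<rho> where "\<rho> = scalar_spectral_measure E unit_e1"

lemma \<rho>_eq: "mu (rvec (unit_seq 1)) = \<rho>"
  by (simp only: mu_eq coord_unit_1 \<rho>_def)

lemma jmom_finite: "n > Suc k \<Longrightarrow> jmom a b k n = 0"
  by (induction k arbitrary: n) (auto simp: jac_def)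

text \<open>All iterates \<open>J\<^sup>k e\<^sub>1\<close> are finitely supported, hence in the
  domain, so the abstract lemma \<open>moments\<close> applies to them.\<close>

lemma \<rho>_moments: "integrable \<rho> (\<lambda>x. x ^ k)" "(LINT x|\<rho>. x ^ k) = jmom a b k 1"
proof -
  define g where "g k = rvec (jmom a b k)" for k
  have g0: "g 0 = rvec (unit_seq 1)"
    unfolding g_def by (rule arg_cong[of _ _ rvec]) (auto simp: unit_seq_def)
  have g: "(g k, g (Suc k)) \<in> S" for k
    using S_rvec[of "jmom a b k" "Suc k"] by (simp add: g_def jmom_finite)
  show "integrable \<rho> (\<lambda>x. x ^ k)"
    using moments(1)[of g k, OF g] unfolding g0 \<rho>_eq .
  have "inner (g k) (g 0) = (\<Sum>n=1..1. jmom a b k n * unit_seq 1 n)"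
    unfolding g0 unfolding g_def by (rule inner_rvec[of _ "Suc k"]) (auto simp: jmom_finite)
  then show "(LINT x|\<rho>. x ^ k) = jmom a b k 1"
    using moments(2)[of g k, OF g] unfolding g0 \<rho>_eq by (simp add: unit_seq_def)
qed

sublocale half_line: half_line_measure \<rho> M
proof
  show sets: "sets \<rho> = sets borel" using sets_mu[of "rvec (unit_seq 1)"] by (simp only: \<rho>_eq)
  show "integrable \<rho> (\<lambda>x. x ^ k)" for k by (rule \<rho>_moments)
  have "emeasure \<rho> {M..} = 0"
    using support by (intro measure_support_null sets) (auto simp: \<rho>_def)
  then show "AE x in \<rho>. x < M" by (intro AE_I[of _ _ "{M..}"]) (auto simp: sets)
qed

lemma \<rho>_one: "(LINT x|\<rho>. 1 :: real) = 1"
  using \<rho>_moments(2)[of 0] by simp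

lemma resolvent_convergence:
  "(\<lambda>N. \<Sum>x\<in>jacobi_truncation.ev N a b. jacobi_truncation.wt N a b x * (1 / (M + 1 - x)) ^ i) \<longlonglongrightarrow>
    (LINT x|\<rho>. indicator {..<M} x * (1 / (M + 1 - x)) ^ i)" (is "?X \<longlonglongrightarrow> ?L")
proof (rule tendstoI)
  fix r :: real assume r: "r > 0"
  \<comment> \<open>The total error is \<open>C * e\<close>: the transfer to the block costs
    \<open>real i * (\<bar>M + 1\<bar> + 3) + 1\<close> times \<open>e\<close>, and the integral one
    more \<open>e\<close>.\<close>
  define C where "C = real i * (\<bar>M + 1\<bar> + 3) + 2"
  have C: "C > 0" unfolding C_def by (intro add_nonneg_pos mult_nonneg_nonneg) auto
  define e where "e = r / (2 * C)"
  have e: "e > 0" and Ce: "C * e < r" using r C by (auto simp: e_def)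
  let ?e1 = "rvec (unit_seq 1)"
  obtain u k where u0: "norm (u 0 - ?e1) < e"
    and uk: "\<And>j. (u (Suc j), k j) \<in> S \<and> norm ((M + 1) *\<^sub>R u (Suc j) - k j - u j) < e"
    and lim: "\<And>j. j \<le> i \<Longrightarrow> \<bar>inner (u j) ?e1 - (LINT x|mu ?e1. indicator {..<M} x * (1 / (M + 1 - x)) ^ j)\<bar> < e"
    using resolvent_powers[OF P_unit[of 1] e, of i] by auto
  have "\<forall>\<^sub>F N in sequentially. \<bar>?X N - Re (coord (u i) 1)\<bar> \<le> real i * ((\<bar>M + 1\<bar> + 3) * e) + e"
  proof (rule approximable_resolvent_chain[where u = "\<lambda>j. coord (u j)" and k = "\<lambda>j. coord (k j)"])
    show "l2_norm (\<lambda>n. coord (u 0) n - (if n = 1 then 1 else 0)) < e"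
      using u0 unfolding norm_ell2.rep_eq coord_diff coord_unit_1 unit_e1_def .
    show "approximable a b (coord (u (Suc j))) (coord (k j))" for j
      using uk[of j] by (intro jacobi_sequence.approximable_realization[OF jacobi_sequence.intro[OF a_pos] boundary]) (auto simp: S_def)
    show "l2_norm (\<lambda>n. of_real (M + 1) * coord (u (Suc j)) n - coord (k j) n - coord (u j) n) < e" for j
      using uk[of j] unfolding norm_ell2.rep_eq coord_diff coord_scaleR by blast
  qed (use truncation ev_le e in auto)
  then show "\<forall>\<^sub>F N in sequentially. dist (?X N) ?L < r"
  proof eventually_elim
    case (elim N)
    have "inner (u i) ?e1 = Re (coord (u i) 1)"
      by (rule inner_ell2_single) (auto simp: coord_unit unit_seq_def)
    then have "\<bar>Re (coord (u i) 1) - ?L\<bar> < e" using lim[of i] unfolding \<rho>_eq by simp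
    moreover have "real i * ((\<bar>M + 1\<bar> + 3) * e) + e + e = C * e" by (simp add: C_def algebra_simps)
    ultimately show ?case using elim Ce unfolding dist_real_def by linarith
  qed
qed

lemma exp_moments_lim:
  assumes t: "t \<ge> 0"
  shows "(\<lambda>N. LINT x|block_spectral_measure (jacobi_block N a b). x ^ k * exp (2 * x * t)) \<longlonglongrightarrow> half_line.F k t"
proof -
  let ?X = "\<lambda>N. \<Sum>x\<in>jacobi_truncation.ev N a b. jacobi_truncation.wt N a b x * (x ^ k * exp (2 * x * t))"
  have eq: "\<forall>\<^sub>F N in sequentially. ?X N = (LINT x|block_spectral_measure (jacobi_block N a b). x ^ k * exp (2 * x * t))"
    using eventually_ge_at_top[of 1]
    by eventually_elim (simp add: jacobi_truncation.integral_block_spectral_measure[OF truncation])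
  have "?X \<longlonglongrightarrow> half_line.F k t"
  proof (cases "t = 0")
    case False
    show "?X \<longlonglongrightarrow> half_line.F k t"
    proof (rule half_line.exp_moments_tendsto[OF \<rho>_one])
      show "0 \<le> jacobi_truncation.wt N a b x" if "N \<ge> 1" for N x
        using jacobi_truncation.wt_pos[OF truncation[OF that], of b x] by simp
    qed (use t False in \<open>auto simp: jacobi_truncation.finite_ev[OF truncation] jacobi_truncation.sum_wt[OF truncation] ev_le
        intro!: resolvent_convergence simp del: power_divide power_one_over\<close>)
  next
    case True
    \<comment> \<open>Powers of \<open>x\<close> do not extend continuously to \<open>y = 0\<close>;
      instead the moments of the blocks coincide with those of \<open>\<rho>\<close> once
      \<open>N > k + 1\<close>.\<close>
    have "\<forall>\<^sub>F N in sequentially. ?X N = half_line.F k t"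
      using eventually_gt_at_top[of "Suc k"]
    proof eventually_elim
      case (elim N)
      \<comment> \<open>\<open>moment_block\<close> asks for a vanishing \<open>N\<close>-th entry,
        and the block of size \<open>N\<close> is unchanged by this update.\<close>
      define a1 where "a1 = a(N := 0)"
      interpret J: jacobi_truncation N a b using truncation[of N] elim by simp
      interpret J1: jacobi_truncation N a1 b
        using truncation[of N] elim unfolding jacobi_truncation_def a1_def by auto
      have "jacobi_block N a b = jacobi_block N a1 b"
        by (rule eq_matI) (auto simp: jacobi_block_def jacobi_entry_def a1_def)
      then have "?X N = (\<Sum>x\<in>J1.ev. J1.wt x * x ^ k)"
        using True J.integral_block_spectral_measure[of "\<lambda>x. x ^ k"] J1.integral_block_spectral_measure[of "\<lambda>x. x ^ k"] by simp
      also have "\<dots> = jmom a1 b k 1" by (rule J1.moment_block) (simp add: a1_def)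
      also have "\<dots> = jmom a b k 1" using elim by (intro jmom_cong[where K = N]) (auto simp: a1_def)
      finally show ?case using True \<rho>_moments(2)[of k] by (simp add: half_line.F_def)
    qed
    then show ?thesis by (rule tendsto_eventually)
  qed
  then show ?thesis using eq by (rule Lim_transform_eventually)
qed

end

section \<open>Limits of the Toda moments and their recurrence\<close>

theorem proposition7:
  fixes a0 b0 :: "nat \<Rightarrow> real"
    and a b :: "nat \<Rightarrow> nat \<Rightarrow> real \<Rightarrow> real"
    and \<alpha> :: "real option"
    and E :: "real set \<Rightarrow> (nat \<Rightarrow> complex) \<Rightarrow> (nat \<Rightarrow> complex)"
    and \<rho> :: "real measure"
    and \<rho>0 :: "nat \<Rightarrow> real measure"
    and sN :: "nat \<Rightarrow> nat \<Rightarrow> real \<Rightarrow> real"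
    and \<Omega>N :: "nat \<Rightarrow> real \<Rightarrow> real"
  assumes a0_pos: "\<And>n. n \<ge> 1 \<Longrightarrow> a0 n > 0"
    and alpha: "limit_circle a0 b0 \<Longrightarrow> is_boundary_parameter a0 b0 \<alpha>"
    and E: "spectral_resolution E (jacobi_realization a0 b0 \<alpha>)"
    and rho: "\<rho> = scalar_spectral_measure E unit_e1"
    and rho0: "\<And>N. N \<ge> 1 \<Longrightarrow> \<rho>0 N = block_spectral_measure (jacobi_block N a0 b0)"
    and toda: "\<And>N. N \<ge> 1 \<Longrightarrow> finite_toda N a0 b0 (a N) (b N)"
    and moments: "\<And>N k t. N \<ge> 1 \<Longrightarrow> t \<ge> 0 \<Longrightarrow>
      sN N k t = (LINT x|block_spectral_measure (jacobi_block N (\<lambda>n. a N n t) (\<lambda>n. b N n t)). x ^ k)"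
    and Omega: "\<And>N t. N \<ge> 1 \<Longrightarrow> t \<ge> 0 \<Longrightarrow> \<Omega>N N t = (LINT x|\<rho>0 N. exp (2 * x * t))"
    and supp: "\<exists>M. measure_support \<rho> \<subseteq> {..<M}"
  shows "\<exists>(s :: nat \<Rightarrow> real \<Rightarrow> real) (\<Omega> :: real \<Rightarrow> real).
    (\<forall>t\<ge>0. \<forall>k.
       integrable \<rho> (\<lambda>x. x ^ k * exp (2 * x * t)) \<and>
       (\<lambda>N. sN N k t) \<longlonglongrightarrow> s k t \<and>
       s k t = (LINT x|\<rho>. x ^ k * exp (2 * x * t)) / (LINT x|\<rho>. exp (2 * x * t))) \<and>
    (\<forall>t\<ge>0.
       (\<lambda>N. \<Omega>N N t) \<longlonglongrightarrow> \<Omega> t \<and>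
       \<Omega> t = (LINT x|\<rho>. exp (2 * x * t)) \<and> \<Omega> t > 0) \<and>
    (\<forall>k. \<forall>t>0.
       s k differentiable (at t) \<and>
       (\<lambda>u. ln (\<Omega> u)) differentiable (at t) \<and>
       deriv (s k) t + deriv (\<lambda>u. ln (\<Omega> u)) t * s k t = 2 * s (k + 1) t) \<and>
    (\<forall>t\<ge>0. s 0 t = 1)"
proof -
  from supp obtain M where M: "measure_support (scalar_spectral_measure E unit_e1) \<subseteq> {..<M}"
    by (auto simp: rho)
  interpret R: jacobi_resolution a0 b0 \<alpha> E M
    using a0_pos alpha E M by (rule jacobi_resolution.intro)
  have \<rho>: "R.\<rho> = \<rho>" by (simp only: R.\<rho>_def rho)
  define F where "F = R.half_line.F"
  have F: "F k t = (LINT x|\<rho>. x ^ k * exp (2 * x * t))" for k t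
    using R.half_line.F_def[of k t] unfolding F_def \<rho> .
  have F0: "F 0 t = (LINT x|\<rho>. exp (2 * x * t))" for t by (simp add: F)
  have pos: "F 0 t > 0" if "t \<ge> 0" for t
    unfolding F_def by (rule R.half_line.F_0_pos[OF R.\<rho>_one that])
  have deriv_F: "(F k has_real_derivative 2 * F (Suc k) t) (at t)" if "t > 0" for k t
    unfolding F_def by (rule R.half_line.F_derivative[OF that])
  have lim: "(\<lambda>N. LINT x|\<rho>0 N. x ^ k * exp (2 * x * t)) \<longlonglongrightarrow> F k t" if "t \<ge> 0" for k t
    using eventually_ge_at_top[of 1]
    by (rule Lim_transform_eventually[OF R.exp_moments_lim[OF that, of k, folded F_def] eventually_mono])
      (simp add: rho0)
  have Omega_lim: "(\<lambda>N. \<Omega>N N t) \<longlonglongrightarrow> F 0 t" if t: "t \<ge> 0" for t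
    using eventually_ge_at_top[of 1]
    by (rule Lim_transform_eventually[OF lim[OF t, of 0] eventually_mono]) (simp add: Omega t)
  have s_lim: "(\<lambda>N. sN N k t) \<longlonglongrightarrow> F k t / F 0 t" if t: "t \<ge> 0" for k t
  proof (rule Lim_transform_eventually)
    show "(\<lambda>N. (LINT x|\<rho>0 N. x ^ k * exp (2 * x * t)) / (LINT x|\<rho>0 N. x ^ 0 * exp (2 * x * t)))
        \<longlonglongrightarrow> F k t / F 0 t"
      using pos[OF t] by (intro tendsto_divide lim t) simp
    show "\<forall>\<^sub>F N in sequentially.
        (LINT x|\<rho>0 N. x ^ k * exp (2 * x * t)) / (LINT x|\<rho>0 N. x ^ 0 * exp (2 * x * t)) = sN N k t"
      using eventually_ge_at_top[of 1]
    proof eventually_elim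
      case (elim N)
      show ?case
        using finite_toda_moments[OF toda[OF elim] _ elim t, of k] a0_pos
        unfolding moments[OF elim t] rho0[OF elim] by simp
    qed
  qed
  \<comment> \<open>The quotient rule already contains the recurrence: the subtracted term is the
    logarithmic derivative of \<open>F 0\<close> times the quotient.\<close>
  have s_deriv: "((\<lambda>t. F k t / F 0 t) has_real_derivative
      2 * (F (Suc k) t / F 0 t) - 2 * F 1 t / F 0 t * (F k t / F 0 t)) (at t)" if t: "t > 0" for k t
    using pos[of t] t
    by (auto intro!: derivative_eq_intros deriv_F simp: field_simps power2_eq_square)
  have ln_deriv: "((\<lambda>t. ln (F 0 t)) has_real_derivative 2 * F 1 t / F 0 t) (at t)" if t: "t > 0" for t
    using pos[of t] t by (auto intro!: derivative_eq_intros deriv_F)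
  show ?thesis
  proof (intro exI[of _ "\<lambda>k t. F k t / F 0 t"] exI[of _ "F 0"] conjI allI impI)
    fix k t
    show "integrable \<rho> (\<lambda>x. x ^ k * exp (2 * x * t))" if "t \<ge> 0"
      using R.half_line.integrable_F[OF that] by (simp only: \<rho>)
    show "F k t / F 0 t = (LINT x|\<rho>. x ^ k * exp (2 * x * t)) / (LINT x|\<rho>. exp (2 * x * t))"
      by (simp only: F F0) simp
    show "(\<lambda>t. F k t / F 0 t) differentiable at t" if "t > 0"
      using s_deriv[OF that] by (auto simp: real_differentiable_def)
    show "(\<lambda>t. ln (F 0 t)) differentiable at t" if "t > 0"
      using ln_deriv[OF that] by (auto simp: real_differentiable_def)
    show "deriv (\<lambda>t. F k t / F 0 t) t + deriv (\<lambda>t. ln (F 0 t)) t * (F k t / F 0 t) = 2 * (F (k + 1) t / F 0 t)"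
      if "t > 0"
      unfolding DERIV_imp_deriv[OF s_deriv[OF that]] DERIV_imp_deriv[OF ln_deriv[OF that]] by simp
    show "F 0 t / F 0 t = 1" if "t \<ge> 0" using pos[OF that] by simp
  qed (auto simp: F0[symmetric] pos s_lim Omega_lim)
qed

end
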